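(* Let $d\ge1$ be a fixed integer, and for each $n$ let $\mathbf X=\mathbf X^{(n)}=(X_1,\dots,X_n)$ be an exchangeable and unconditional random vector in $\mathbb R^n$. Let $p=\binom nd$, let $m=m(p)\in\mathbb N$ with $p/m\to c$ for some fixed $c>0$, and let $K=\frac1m\sum_{k=1}^m\mathbf x^{(k)}(\mathbf x^{(k)})^{\mathrm T}$ where $\mathbf x^{(1)},\dots,\mathbf x^{(m)}$ are i.i.d. with law $\mathrm{PrincipalT}(n,d,\mathbf X)$. If (a) $\mathbb E X_1^2\to1$, (b) $\mathbb E(X_1^2X_2^2)-\mathbb E(X_1^2)\,\mathbb E(X_2^2)\to0$, and (c) there exists some $\epsilon>0$ such that $\sup_n\mathbb E(|X_1|^{4d+\epsilon})<\infty$, then there is a sequence $L=L_n$ with $Ld^2/n\to0$ such that (A) $\mathbb E(X_1^2\cdots X_d^2)\to 1$; (B) $\mathbb E(X_1^2\cdots X_{2d}^2)-\bigl(\mathbb E(X_1^2\cdots X_d^2)\bigr)^2\to0$; (C) for all $n$ large enough and for all $1\le r\le d$, $\ \mathbb E(X_1^4\cdots X_r^4X_{r+1}^2\cdots X_{2d-r}^2)\le L^r$; and, with probability $1$, $\mathrm{ESD}(K)$ converges weakly to $\mu_{\mathrm{MP}(c)}$.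
   Context: All limits are as $n\to\infty$, and all samples, for all $n$, live on a common probability space. $\mathbf X$ is exchangeable if $(X_1,\dots,X_n)$ has the same law as $(X_{\sigma(1)},\dots,X_{\sigma(n)})$ for every permutation $\sigma$ of $[n]=\{1,\dots,n\}$; it is unconditional if $(X_1,\dots,X_n)$ has the same law as $(\varepsilon_1X_1,\dots,\varepsilon_nX_n)$ where $\varepsilon_i$ are independent Rademacher signs independent of $\mathbf X$. $\mathrm{PrincipalT}(n,d,\mathbf X)$ is the law of the random vector $\bigl(\prod_{\alpha\in i}X_\alpha\bigr)_{i}\in\mathbb R^p$, $p=\binom nd$, whose coordinates are indexed by the subsets $i\subseteq[n]$ of size $d$. For a real symmetric $p\times p$ matrix $K$ with eigenvalues $\lambda_1\ge\dots\ge\lambda_p$, $\mathrm{ESD}(K)=\frac1p\sum_{j=1}^p\delta_{\lambda_j}$. For $c>0$ the standard Marchenko–Pastur law is $$\mu_{\mathrm{MP}(c)}=\bigl(1-\tfrac1c\bigr)^+\delta_0+\frac{\sqrt{(b-x)(x-a)}}{2\pi c x}\mathbf 1_{[a,b]}(x)\,dx,\quad a=(1-\sqrt c)^2,\ b=(1+\sqrt c)^2.$$ *)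

theory Defs
  imports
    "HOL-Probability.Probability"
    "HOL-Library.Ramsey"
    "Jordan_Normal_Form.Char_Poly"
begin

definition random_vector :: "nat \<Rightarrow> 'b measure \<Rightarrow> (nat \<Rightarrow> 'b \<Rightarrow> real) \<Rightarrow> bool" where
  "random_vector n N X \<longleftrightarrow> prob_space N \<and> (\<forall>i\<in>{1..n}. X i \<in> borel_measurable N)"

definition exchangeable :: "nat \<Rightarrow> 'b measure \<Rightarrow> (nat \<Rightarrow> 'b \<Rightarrow> real) \<Rightarrow> bool" where
  "exchangeable n N X \<longleftrightarrow>
     (\<forall>\<sigma>. \<sigma> permutes {1..n} \<longrightarrow>
        distr N (Pi\<^sub>M {1..n} (\<lambda>_. borel)) (\<lambda>\<omega>. \<lambda>i\<in>{1..n}. X (\<sigma> i) \<omega>) =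
        distr N (Pi\<^sub>M {1..n} (\<lambda>_. borel)) (\<lambda>\<omega>. \<lambda>i\<in>{1..n}. X i \<omega>))"

definition rademacher :: "real measure" where
  "rademacher = measure_pmf (pmf_of_set {-1, 1})"

text \<open>The signs live on a separate factor of a product space, which makes them
  independent of each other and of the vector.\<close>

definition unconditional :: "nat \<Rightarrow> 'b measure \<Rightarrow> (nat \<Rightarrow> 'b \<Rightarrow> real) \<Rightarrow> bool" where
  "unconditional n N X \<longleftrightarrow>
     distr (Pi\<^sub>M {1..n} (\<lambda>_. rademacher) \<Otimes>\<^sub>M N) (Pi\<^sub>M {1..n} (\<lambda>_. borel))
       (\<lambda>(\<epsilon>, \<omega>). \<lambda>i\<in>{1..n}. \<epsilon> i * X i \<omega>) =
     distr N (Pi\<^sub>M {1..n} (\<lambda>_. borel)) (\<lambda>\<omega>. \<lambda>i\<in>{1..n}. X i \<omega>)"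

definition PrincipalT :: "nat \<Rightarrow> nat \<Rightarrow> 'b measure \<Rightarrow> (nat \<Rightarrow> 'b \<Rightarrow> real) \<Rightarrow> (nat set \<Rightarrow> real) measure" where
  "PrincipalT n d N X =
     distr N (Pi\<^sub>M (nsets {1..n} d) (\<lambda>_. borel)) (\<lambda>\<omega>. \<lambda>i\<in>nsets {1..n} d. \<Prod>\<alpha>\<in>i. X \<alpha> \<omega>)"

text \<open>\<^term>\<open>from_nat_into I\<close> is a bijection from \<^term>\<open>{..<card I}\<close> onto the finite set
  \<^term>\<open>I\<close>. Another enumeration would conjugate the matrix by a permutation matrix, which does
  not change its eigenvalues.\<close>

definition sample_cov :: "'i set \<Rightarrow> nat \<Rightarrow> (nat \<Rightarrow> 'i \<Rightarrow> real) \<Rightarrow> real mat" where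
  "sample_cov I m x = mat (card I) (card I)
     (\<lambda>(i, j). 1 / real m * (\<Sum>k\<in>{1..m}. x k (from_nat_into I i) * x k (from_nat_into I j)))"

text \<open>The real eigenvalues in decreasing order, repeated according to algebraic multiplicity;
  for a symmetric matrix there are \<^term>\<open>dim_row K\<close> of them.\<close>

definition eigenvalue_list :: "real mat \<Rightarrow> real list" where
  "eigenvalue_list K = rev (sorted_list_of_multiset (proots (char_poly K)))"

text \<open>The push-forward of the uniform measure on the indices. For the empty matrix this is the
  null measure.\<close>

definition ESD :: "real mat \<Rightarrow> real measure" where
  "ESD K = distr (uniform_count_measure {..<dim_row K}) borel (\<lambda>j. eigenvalue_list K ! j)"

definition MP_density :: "real \<Rightarrow> real \<Rightarrow> real" where
  "MP_density c x =
     (let a = (1 - sqrt c)\<^sup>2; b = (1 + sqrt c)\<^sup>2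
      in sqrt ((b - x) * (x - a)) / (2 * pi * c * x) * indicator {a..b} x)"

definition marchenko_pastur :: "real \<Rightarrow> real measure" where
  "marchenko_pastur c = measure_of UNIV (sets borel)
     (\<lambda>A. ennreal (max 0 (1 - 1 / c)) * emeasure (return borel 0) A
        + emeasure (density lborel (\<lambda>x. ennreal (MP_density c x))) A)"

lemma borel_measurable_MP_density [measurable]: "MP_density c \<in> borel_measurable borel"
  unfolding MP_density_def Let_def by measurable

lemma sets_marchenko_pastur [simp, measurable_cong]: "sets (marchenko_pastur c) = sets borel"
  unfolding marchenko_pastur_def
  using sets.sets_measure_of_eq[of "borel :: real measure"] by simp

lemma emeasure_marchenko_pastur:
  assumes A: "A \<in> sets borel"
  shows "emeasure (marchenko_pastur c) A =
    ennreal (max 0 (1 - 1 / c)) * indicator A 0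
    + (\<integral>\<^sup>+x. ennreal (MP_density c x) * indicator A x \<partial>lborel)"
proof -
  let ?\<nu> = "density lborel (\<lambda>x. ennreal (MP_density c x))"
  let ?\<mu> = "\<lambda>A. ennreal (max 0 (1 - 1 / c)) * emeasure (return borel (0::real)) A + emeasure ?\<nu> A"
  have "countably_additive (sets borel) ?\<mu>"
  proof (rule countably_additiveI)
    fix F :: "nat \<Rightarrow> real set"
    assume F: "range F \<subseteq> sets borel" "disjoint_family F"
    have "(\<Sum>i. emeasure (return borel 0) (F i)) = emeasure (return borel 0) (\<Union>i. F i)"
      using F by (intro suminf_emeasure) auto
    moreover have "(\<Sum>i. emeasure ?\<nu> (F i)) = emeasure ?\<nu> (\<Union>i. F i)"
      using F by (intro suminf_emeasure) auto
    ultimately show "(\<Sum>i. ?\<mu> (F i)) = ?\<mu> (\<Union>i. F i)"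
      by (simp add: suminf_add[symmetric])
  qed
  moreover have "positive (sets borel) ?\<mu>"
    by (simp add: positive_def)
  ultimately have "emeasure (marchenko_pastur c) A = ?\<mu> A"
    using A sets.sigma_algebra_axioms[of "borel :: real measure"]
    unfolding marchenko_pastur_def by (intro emeasure_measure_of_sigma) auto
  with A show ?thesis
    by (simp add: emeasure_density)
qed

lemma random_vector_signed_measurable:
  assumes "random_vector n N X"
  shows "(\<lambda>(\<epsilon>, \<omega>). \<lambda>i\<in>{1..n}. \<epsilon> i * X i \<omega>)
     \<in> Pi\<^sub>M {1..n} (\<lambda>_. rademacher) \<Otimes>\<^sub>M N \<rightarrow>\<^sub>M Pi\<^sub>M {1..n} (\<lambda>_. borel)"
proof -
  have X: "X i \<in> borel_measurable N" if "i \<in> {1..n}" for i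
    using assms that by (auto simp: random_vector_def)
  have R: "(\<lambda>z. z) \<in> borel_measurable rademacher"
    by (simp add: rademacher_def)
  have "(\<lambda>p. fst p i) \<in> borel_measurable (Pi\<^sub>M {1..n} (\<lambda>_. rademacher) \<Otimes>\<^sub>M N)"
    if "i \<in> {1..n}" for i
    using measurable_compose[OF measurable_compose[OF measurable_fst
      measurable_component_singleton[OF that]] R] by simp
  moreover have "(\<lambda>p. X i (snd p)) \<in> borel_measurable (Pi\<^sub>M {1..n} (\<lambda>_. rademacher) \<Otimes>\<^sub>M N)"
    if "i \<in> {1..n}" for i
    using measurable_compose[OF measurable_snd X[OF that]] .
  ultimately show ?thesis
    by (auto simp: case_prod_beta intro!: measurable_restrict borel_measurable_times)
qed

lemma PrincipalT_measurable:
  assumes "random_vector n N X"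
  shows "(\<lambda>\<omega>. \<lambda>i\<in>nsets {1..n} d. \<Prod>\<alpha>\<in>i. X \<alpha> \<omega>) \<in> N \<rightarrow>\<^sub>M Pi\<^sub>M (nsets {1..n} d) (\<lambda>_. borel)"
proof (rule measurable_restrict, rule borel_measurable_prod)
  fix i \<alpha> assume "i \<in> nsets {1..n} d" "\<alpha> \<in> i"
  then have "\<alpha> \<in> {1..n}" by (auto simp: nsets_def)
  with assms show "X \<alpha> \<in> borel_measurable N" by (simp add: random_vector_def)
qed

lemma real_split_size_proots:
  fixes p :: "real poly"
  assumes "p \<noteq> 0" and "\<And>z. poly (map_poly complex_of_real p) z = 0 \<Longrightarrow> z \<in> \<real>"
  shows "size (proots p) = degree p"
  using assms
proof (induction "degree p" arbitrary: p rule: less_induct)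
  case less
  show ?case
  proof (cases "degree p = 0")
    case True
    then obtain a where "p = [:a:]" by (rule degree_eq_zeroE)
    with True show ?thesis by simp
  next
    case False
    interpret h: map_poly_idom_hom complex_of_real
      by unfold_locales auto
    have "\<not> constant (poly (map_poly complex_of_real p))"
      using False by (simp add: constant_degree)
    then obtain z where z: "poly (map_poly complex_of_real p) z = 0"
      using fundamental_theorem_of_algebra by blast
    with less.prems(2) obtain r where r: "z = complex_of_real r"
      by (meson Reals_cases)
    have "poly p r = 0"
      using z unfolding r by simp
    then obtain q where q: "p = [:-r, 1:] * q"
      by (meson dvdE poly_eq_0_iff_dvd)
    with less.prems have q0: "q \<noteq> 0" by auto
    have dq: "degree p = Suc (degree q)"
      unfolding q by (subst degree_mult_eq) (use q0 in auto)
    have "size (proots q) = degree q"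
    proof (rule less.hyps)
      fix w assume "poly (map_poly complex_of_real q) w = 0"
      then show "w \<in> \<real>"
        by (intro less.prems(2)) (simp only: q h.hom_mult poly_mult mult_zero_right)
    qed (use dq q0 in auto)
    moreover have "proots p = proots [:-r, 1:] + proots q"
      unfolding q by (rule proots_mult) (use q0 in auto)
    moreover have "size (proots [:-r, 1:]) = 1"
      by simp
    ultimately show ?thesis
      using dq by simp
  qed
qed

lemma length_eigenvalue_list:
  fixes K :: "real mat"
  assumes K: "K \<in> carrier_mat n n" and sym: "transpose_mat K = K"
  shows "length (eigenvalue_list K) = n"
proof -
  let ?C = "map_mat complex_of_real K"
  have C: "?C \<in> carrier_mat n n" using K by simp
  have deg: "degree (char_poly K) = n" and mon: "monic (char_poly K)"
    using degree_monic_char_poly[OF K] by auto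
  have "z \<in> \<real>" if "poly (map_poly complex_of_real (char_poly K)) z = 0" for z
  proof -
    have "poly (char_poly ?C) z = 0"
      using that by (subst of_real_hom.char_poly_hom[OF K])
    then have "eigenvalue ?C z"
      using eigenvalue_root_char_poly[OF C] by simp
    then obtain v where v: "v \<in> carrier_vec n" "v \<noteq> 0\<^sub>v n" "?C *\<^sub>v v = z \<cdot>\<^sub>v v"
      using C by (auto simp: eigenvalue_def eigenvector_def)
    have row: "(\<Sum>j<n. complex_of_real (K $$ (i, j)) * v $ j) = z * v $ i" if "i < n" for i
    proof -
      have "(?C *\<^sub>v v) $ i = z * v $ i" using v that by simp
      moreover have "(?C *\<^sub>v v) $ i = (\<Sum>j<n. complex_of_real (K $$ (i, j)) * v $ j)"
        using v(1) K that by (auto simp: scalar_prod_def atLeast0LessThan intro!: sum.cong)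
      ultimately show ?thesis by simp
    qed
    define S where "S = (\<Sum>i<n. \<Sum>j<n. cnj (v $ i) * complex_of_real (K $$ (i, j)) * v $ j)"
    define Q where "Q = (\<Sum>i<n. (cmod (v $ i))\<^sup>2)"
    have "S = (\<Sum>i<n. cnj (v $ i) * (z * v $ i))"
      unfolding S_def by (intro sum.cong refl) (simp add: row[symmetric] sum_distrib_left mult.assoc)
    also have "\<dots> = z * of_real Q"
      unfolding Q_def of_real_sum sum_distrib_left
      by (intro sum.cong refl) (simp add: complex_norm_square mult_ac del: of_real_power)
    finally have S: "S = z * of_real Q" .
    have symK: "K $$ (j, i) = K $$ (i, j)" if "i < n" "j < n" for i j
      using sym that K by (metis carrier_matD index_transpose_mat(1))
    have "cnj S = (\<Sum>i<n. \<Sum>j<n. cnj (v $ j) * complex_of_real (K $$ (j, i)) * v $ i)"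
      unfolding S_def cnj_sum by (intro sum.cong refl) (simp add: symK mult_ac)
    also have "\<dots> = S"
      unfolding S_def by (rule sum.swap)
    finally have "cnj S = S" .
    moreover have "Q \<noteq> 0"
    proof
      assume "Q = 0"
      then have "\<forall>i<n. v $ i = 0"
        unfolding Q_def by (subst (asm) sum_nonneg_eq_0_iff) auto
      with v(1,2) show False by (metis carrier_vecD eq_vecI index_zero_vec)
    qed
    ultimately have "cnj z = z"
      unfolding S by simp
    then show ?thesis
      by (simp add: Reals_cnj_iff)
  qed
  moreover have "char_poly K \<noteq> 0"
    using mon by auto
  ultimately have "size (proots (char_poly K)) = n"
    using real_split_size_proots deg by metis
  then show ?thesis
    by (simp add: eigenvalue_list_def flip: size_mset)
qed

lemma transpose_sample_cov: "transpose_mat (sample_cov I m x) = sample_cov I m x"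
  by (rule eq_matI) (auto simp: sample_cov_def mult.commute)

end

theory Submission
  imports Defs "Jordan_Normal_Form.Schur_Decomposition"
begin

text \<open>
  Everything is done with Stieltjes transforms on the negative half-line, where the resolvent
  $G = (K + t)^{-1}$, $t > 0$, is a real positive matrix. By Sherman--Morrison, replacing one column
  changes $\mathrm{tr}\,G$ by at most $1/t$, so the transform concentrates exponentially around its
  mean. The identity $p = t\,\mathrm{tr}\,G + \sum_k q_k / (1 + q_k)$ with
  $q_k = \frac1m x_k^T G_{(k)} x_k$, where $G_{(k)}$ omits the column $x_k$, becomes in the limit the
  quadratic equation of the Marchenko--Pastur law as soon as $x^T A x$ is close to $\mathrm{tr}\,A$
  for fixed bounded $A$.

  For the tensor vector, the off-diagonal terms $A_{ij} x_i x_j$ are uncorrelated unless the symmetric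
  differences $i \triangle j$ agree, which by unconditionality leaves a proportion $O(1/n)$ of pairs;
  the diagonal terms are controlled by $E(X_1^2 \cdots X_k^2) \to 1$ for $k \le 2d$. The latter holds
  since the average of the $X_i^2$ tends to $1$ in $L^2$ and each $X_k^2$ may be exchanged for that
  average; the moment of order $4d + \epsilon$ gives the uniform integrability. All mixed
  moments of degree $4d$ are bounded, so a constant $L$ suffices.
\<close>

section \<open>Concentration under bounded differences\<close>

text \<open>The samples for different n share only a common space, so almost sure convergence has to
  come from Borel-Cantelli. For d = 1 the dimension p is n itself, and a variance bound of order m /
  p^2, that is 1/n, is not summable; the exponential bound is. It is available for columns with
  heavy tails because the change 1/t of the trace does not depend on the size of the replaced
  column.

  For t > 0 the inverse exists whatever the data are, and building it by rank one updates makes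
  every entry a rational function of the data, hence measurable. The updates follow one fixed order,
  whereas the argument must single out an arbitrary column; uniqueness of the inverse reconciles the
  two.

  The degree 4d is that of a product of four tensor coordinates, as it occurs in the second moment
  of a quadratic form. At this degree a bounded moment alone gives no limit; the surplus \<epsilon>
  pays for the truncation that makes E(X_1^2 ... X_2d^2) converge.

  The limiting quadratic equation has exactly one positive root and is stable there, so an
  approximate solution is directly close to the limiting transform.\<close>

text \<open>One coordinate is integrated out at a time: the partial mean \<open>g\<close> inherits
  the bound and the differences, and with the other coordinates fixed Hoeffding's lemma controls the
  last one.\<close>

lemma bounded_differences_mgf:
  fixes f :: "('i \<Rightarrow> 'a) \<Rightarrow> real"
  assumes D: "\<And>i. prob_space (D i)" and S: "finite S" and c: "c > 0" and l: "l > 0"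
    and f: "f \<in> borel_measurable (Pi\<^sub>M S D)"
    and bdd: "\<And>w. w \<in> space (Pi\<^sub>M S D) \<Longrightarrow> \<bar>f w\<bar> \<le> B"
    and diff: "\<And>w i y. w \<in> space (Pi\<^sub>M S D) \<Longrightarrow> i \<in> S \<Longrightarrow> y \<in> space (D i) \<Longrightarrow>
                 \<bar>f w - f (w(i := y))\<bar> \<le> c"
  shows "(\<integral>\<^sup>+w. ennreal (exp (l * (f w - integral\<^sup>L (Pi\<^sub>M S D) f))) \<partial>Pi\<^sub>M S D)
           \<le> ennreal (exp (l\<^sup>2 * c\<^sup>2 * card S / 2))"
  using S f bdd diff
proof (induction S arbitrary: f rule: finite_induct)
  case empty
  interpret P: prob_space "Pi\<^sub>M {} D"
    by (rule prob_space_PiM) (rule D)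
  have "integral\<^sup>L (Pi\<^sub>M {} D) f = (\<integral>w. f (\<lambda>_. undefined) \<partial>Pi\<^sub>M {} D)"
    by (rule Bochner_Integration.integral_cong) (simp_all add: space_PiM)
  then have "integral\<^sup>L (Pi\<^sub>M {} D) f = f (\<lambda>_. undefined)"
    by (simp add: P.prob_space)
  then have "(\<integral>\<^sup>+w. ennreal (exp (l * (f w - integral\<^sup>L (Pi\<^sub>M {} D) f))) \<partial>Pi\<^sub>M {} D)
     = (\<integral>\<^sup>+w. 1 \<partial>Pi\<^sub>M {} D)"
    by (intro nn_integral_cong) (simp add: space_PiM)
  then show ?case by (simp add: P.emeasure_space_1)
next
  case (insert k J)
  interpret product_sigma_finite D
    by (simp add: product_sigma_finite_def D prob_space_imp_sigma_finite)
  interpret Dk: prob_space "D k" by (rule D)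
  interpret P: prob_space "Pi\<^sub>M (insert k J) D" by (rule prob_space_PiM) (rule D)
  interpret PJ: prob_space "Pi\<^sub>M J D" by (rule prob_space_PiM) (rule D)
  note [measurable] = insert.prems(1)
  have up [measurable]: "(\<lambda>p. f ((fst p)(k := snd p))) \<in> borel_measurable (Pi\<^sub>M J D \<Otimes>\<^sub>M D k)"
    using measurable_compose[OF measurable_add_dim[of k J D] insert.prems(1)]
    by (simp add: case_prod_beta)
  have sp: "w(k := y) \<in> space (Pi\<^sub>M (insert k J) D)" if "w \<in> space (Pi\<^sub>M J D)" "y \<in> space (D k)" for w y
    using that by (simp add: space_PiM PiE_fun_upd)
  have fk: "(\<lambda>y. f (w(k := y))) \<in> borel_measurable (D k)" if "w \<in> space (Pi\<^sub>M J D)" for w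
    using measurable_compose[OF measurable_Pair1'[OF that] up] by simp
  have int_fk: "integrable (D k) (\<lambda>y. f (w(k := y)))" if "w \<in> space (Pi\<^sub>M J D)" for w
    using that sp insert.prems(2) by (intro Dk.integrable_const_bound[where B=B] fk) auto
  define g where "g w = (\<integral>y. f (w(k := y)) \<partial>D k)" for w
  have g [measurable]: "g \<in> borel_measurable (Pi\<^sub>M J D)"
    unfolding g_def
    by (rule sigma_finite_measure.borel_measurable_lebesgue_integral[OF prob_space_imp_sigma_finite[OF D]]) (use up in \<open>simp add: case_prod_beta\<close>)
  have "integrable (Pi\<^sub>M (insert k J) D) f"
    using insert.prems(1,2) by (intro P.integrable_const_bound[where B=B]) auto
  then have Eg: "integral\<^sup>L (Pi\<^sub>M (insert k J) D) f = integral\<^sup>L (Pi\<^sub>M J D) g"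
    unfolding g_def using insert.hyps by (intro product_integral_insert) auto
  define \<mu> where "\<mu> = integral\<^sup>L (Pi\<^sub>M J D) g"
  have bound: "\<bar>\<integral>y. h y \<partial>D k\<bar> \<le> C"
    if "integrable (D k) h" and "\<And>y. y \<in> space (D k) \<Longrightarrow> \<bar>h y\<bar> \<le> C" for h :: "'a \<Rightarrow> real" and C
  proof -
    have "\<bar>\<integral>y. h y \<partial>D k\<bar> \<le> (\<integral>y. \<bar>h y\<bar> \<partial>D k)"
      by (rule integral_abs_bound)
    also have "\<dots> \<le> (\<integral>y. C \<partial>D k)"
      using that by (intro integral_mono) auto
    finally show ?thesis by (simp add: Dk.prob_space)
  qed
  have IH: "(\<integral>\<^sup>+w. ennreal (exp (l * (g w - \<mu>))) \<partial>Pi\<^sub>M J D) \<le> ennreal (exp (l\<^sup>2 * c\<^sup>2 * card J / 2))"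
    unfolding \<mu>_def
  proof (rule insert.IH[OF g])
    show "\<bar>g w\<bar> \<le> B" if "w \<in> space (Pi\<^sub>M J D)" for w
      unfolding g_def using that sp insert.prems(2) by (intro bound int_fk) auto
  next
    fix w i y assume w: "w \<in> space (Pi\<^sub>M J D)" and i: "i \<in> J" and y: "y \<in> space (D i)"
    have ik: "i \<noteq> k" using i insert.hyps by auto
    have w': "w(i := y) \<in> space (Pi\<^sub>M J D)"
      using w i y by (auto simp: space_PiM PiE_iff extensional_def)
    have "g w - g (w(i := y)) = (\<integral>z. f (w(k := z)) - f (w(i := y, k := z)) \<partial>D k)"
      unfolding g_def by (rule Bochner_Integration.integral_diff[symmetric, OF int_fk[OF w] int_fk[OF w']])
    moreover have "\<bar>\<integral>z. f (w(k := z)) - f (w(i := y, k := z)) \<partial>D k\<bar> \<le> c"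
    proof (rule bound)
      show "integrable (D k) (\<lambda>z. f (w(k := z)) - f (w(i := y, k := z)))"
        using int_fk[OF w] int_fk[OF w'] by simp
      fix z assume "z \<in> space (D k)"
      from insert.prems(3)[OF sp[OF w this] insertI2[OF i] y]
      show "\<bar>f (w(k := z)) - f (w(i := y, k := z))\<bar> \<le> c"
        unfolding fun_upd_twist[OF ik] .
    qed
    ultimately show "\<bar>g w - g (w(i := y))\<bar> \<le> c" by simp
  qed
  have inner: "(\<integral>\<^sup>+y. ennreal (exp (l * (f (w(k := y)) - g w))) \<partial>D k) \<le> ennreal (exp (l\<^sup>2 * c\<^sup>2 / 2))"
    if w: "w \<in> space (Pi\<^sub>M J D)" for w
  proof -
    \<comment> \<open>All values lie within c of this reference value, in an interval of length 2c,
      so Hoeffding's exponent l^2 (2c)^2 / 8 becomes l^2 c^2 / 2.\<close>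
    obtain y0 where y0: "y0 \<in> space (D k)" using Dk.not_empty by blast
    define u where "u = f (w(k := y0))"
    have near: "\<bar>f (w(k := y)) - u\<bar> \<le> c" if "y \<in> space (D k)" for y
      using insert.prems(3)[OF sp[OF w that] insertI1 y0] unfolding fun_upd_upd u_def .
    interpret interval_bounded_random_variable "D k" "\<lambda>y. f (w(k := y))" "u - c" "u + c"
    proof
      show "AE y in D k. f (w(k := y)) \<in> {u - c..u + c}"
      proof (rule AE_I2)
        fix y assume "y \<in> space (D k)"
        from near[OF this] show "f (w(k := y)) \<in> {u - c..u + c}" by (auto simp: abs_le_iff)
      qed
    qed (rule fk[OF w])
    have "(\<integral>\<^sup>+y. ennreal (exp (l * (f (w(k := y)) - g w))) \<partial>D k)
        \<le> ennreal (exp (l\<^sup>2 * ((u + c) - (u - c))\<^sup>2 / 8))"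
      unfolding g_def by (rule Hoeffdings_lemma_nn_integral[OF l])
    then show ?thesis by (simp add: power2_eq_square mult_ac)
  qed
  have "(\<integral>\<^sup>+w. ennreal (exp (l * (f w - \<mu>))) \<partial>Pi\<^sub>M (insert k J) D)
     = (\<integral>\<^sup>+w. \<integral>\<^sup>+y. ennreal (exp (l * (f (w(k := y)) - \<mu>))) \<partial>D k \<partial>Pi\<^sub>M J D)"
    using insert.hyps by (intro product_nn_integral_insert) auto
  also have "\<dots> = (\<integral>\<^sup>+w. ennreal (exp (l * (g w - \<mu>))) *
        (\<integral>\<^sup>+y. ennreal (exp (l * (f (w(k := y)) - g w))) \<partial>D k) \<partial>Pi\<^sub>M J D)"
  proof (rule nn_integral_cong)
    fix w assume w: "w \<in> space (Pi\<^sub>M J D)"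
    note [measurable] = fk[OF w]
    have "(\<integral>\<^sup>+y. ennreal (exp (l * (f (w(k := y)) - \<mu>))) \<partial>D k)
        = (\<integral>\<^sup>+y. ennreal (exp (l * (g w - \<mu>))) * ennreal (exp (l * (f (w(k := y)) - g w))) \<partial>D k)"
      by (rule nn_integral_cong)
        (simp only: ennreal_mult[symmetric] exp_ge_zero exp_add[symmetric] distrib_left[symmetric], simp)
    also have "\<dots> = ennreal (exp (l * (g w - \<mu>))) * (\<integral>\<^sup>+y. ennreal (exp (l * (f (w(k := y)) - g w))) \<partial>D k)"
      by (rule nn_integral_cmult) measurable
    finally show "(\<integral>\<^sup>+y. ennreal (exp (l * (f (w(k := y)) - \<mu>))) \<partial>D k)
      = ennreal (exp (l * (g w - \<mu>))) * (\<integral>\<^sup>+y. ennreal (exp (l * (f (w(k := y)) - g w))) \<partial>D k)" .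
  qed
  also have "\<dots> \<le> (\<integral>\<^sup>+w. ennreal (exp (l * (g w - \<mu>))) * ennreal (exp (l\<^sup>2 * c\<^sup>2 / 2)) \<partial>Pi\<^sub>M J D)"
    by (intro nn_integral_mono mult_left_mono inner) auto
  also have "\<dots> = (\<integral>\<^sup>+w. ennreal (exp (l * (g w - \<mu>))) \<partial>Pi\<^sub>M J D) * ennreal (exp (l\<^sup>2 * c\<^sup>2 / 2))"
    by (intro nn_integral_multc) auto
  also have "\<dots> \<le> ennreal (exp (l\<^sup>2 * c\<^sup>2 * card J / 2)) * ennreal (exp (l\<^sup>2 * c\<^sup>2 / 2))"
    by (intro mult_right_mono IH) auto
  also have "\<dots> = ennreal (exp (l\<^sup>2 * c\<^sup>2 * card (insert k J) / 2))"
    using insert.hyps by (subst ennreal_mult[symmetric]) (simp_all only: exp_ge_zero exp_add[symmetric], simp add: field_simps)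
  finally show ?case unfolding Eg \<mu>_def .
qed

section \<open>Resolvents of Gram matrices\<close>

text \<open>Vectors and matrices are functions of which only the values on \<open>I\<close> count,
  so that the d-subsets can serve as indices directly; an enumeration enters only together with
  eigenvalues.\<close>

definition inner_on :: "'i set \<Rightarrow> ('i \<Rightarrow> real) \<Rightarrow> ('i \<Rightarrow> real) \<Rightarrow> real" where
  "inner_on I u v = (\<Sum>i\<in>I. u i * v i)"

definition mult_vec :: "'i set \<Rightarrow> ('i \<Rightarrow> 'i \<Rightarrow> real) \<Rightarrow> ('i \<Rightarrow> real) \<Rightarrow> 'i \<Rightarrow> real" where
  "mult_vec I G v i = (\<Sum>j\<in>I. G i j * v j)"

definition trace_on :: "'i set \<Rightarrow> ('i \<Rightarrow> 'i \<Rightarrow> real) \<Rightarrow> real" where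
  "trace_on I G = (\<Sum>i\<in>I. G i i)"

text \<open>By the Sherman--Morrison formula, this is the effect on the inverse \<open>G\<close> of adding
  the rank one matrix $a\, y y^T$.\<close>

definition sm_update :: "'i set \<Rightarrow> real \<Rightarrow> ('i \<Rightarrow> real) \<Rightarrow> ('i \<Rightarrow> 'i \<Rightarrow> real) \<Rightarrow> 'i \<Rightarrow> 'i \<Rightarrow> real" where
  "sm_update I a y G i j =
     G i j - a * mult_vec I G y i * mult_vec I G y j / (1 + a * inner_on I y (mult_vec I G y))"

text \<open>Columns enter one after the other, the head of the list last, starting from the inverse
  of t times the identity. The recursion keeps the entries measurable in the data.\<close>

fun gram_resolvent :: "'i set \<Rightarrow> real \<Rightarrow> real \<Rightarrow> (nat \<Rightarrow> 'i \<Rightarrow> real) \<Rightarrow> nat list \<Rightarrow> 'i \<Rightarrow> 'i \<Rightarrow> real" where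
  "gram_resolvent I a t x [] = (\<lambda>i j. if i = j then 1 / t else 0)"
| "gram_resolvent I a t x (k # ks) = sm_update I a (x k) (gram_resolvent I a t x ks)"

text \<open>As \<^term>\<open>G\<close> is symmetric, the second condition says that
  $(t + a \sum_{k \in S} x_k x_k^T)\, G = 1$.\<close>

definition is_resolvent ::
    "'i set \<Rightarrow> real \<Rightarrow> real \<Rightarrow> (nat \<Rightarrow> 'i \<Rightarrow> real) \<Rightarrow> nat set \<Rightarrow> ('i \<Rightarrow> 'i \<Rightarrow> real) \<Rightarrow> bool" where
  "is_resolvent I a t x S G \<longleftrightarrow>
     (\<forall>i\<in>I. \<forall>j\<in>I. G i j = G j i) \<and>
     (\<forall>i\<in>I. \<forall>j\<in>I. t * G i j + a * (\<Sum>k\<in>S. x k i * mult_vec I G (x k) j) = (if i = j then 1 else 0))"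

section \<open>Positivity and rank one updates of resolvents\<close>

lemma inner_on_commute: "inner_on I u v = inner_on I v u"
  by (simp add: inner_on_def mult.commute)

lemma inner_on_self_nonneg: "0 \<le> inner_on I u u"
  by (simp add: inner_on_def sum_nonneg)

lemma inner_on_self_eq_0: "finite I \<Longrightarrow> inner_on I u u = 0 \<Longrightarrow> i \<in> I \<Longrightarrow> u i = 0"
  by (simp add: inner_on_def sum_nonneg_eq_0_iff)

lemma inner_on_mult_vec_commute:
  assumes "\<And>i j. i \<in> I \<Longrightarrow> j \<in> I \<Longrightarrow> G i j = G j i"
  shows "inner_on I (mult_vec I G u) v = inner_on I u (mult_vec I G v)"
proof -
  have "inner_on I (mult_vec I G u) v = (\<Sum>i\<in>I. \<Sum>j\<in>I. G i j * u j * v i)"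
    by (simp add: inner_on_def mult_vec_def sum_distrib_right)
  also have "\<dots> = (\<Sum>j\<in>I. \<Sum>i\<in>I. G i j * u j * v i)"
    by (rule sum.swap)
  also have "\<dots> = (\<Sum>j\<in>I. \<Sum>i\<in>I. u j * (G j i * v i))"
    by (intro sum.cong refl) (simp add: assms mult_ac)
  also have "\<dots> = inner_on I u (mult_vec I G v)"
    by (simp add: inner_on_def mult_vec_def sum_distrib_left)
  finally show ?thesis .
qed

lemma mult_vec_delta: "finite I \<Longrightarrow> j \<in> I \<Longrightarrow> mult_vec I G (\<lambda>i. if i = j then 1 else 0) i = G i j"
  by (simp add: mult_vec_def if_distrib cong: if_cong)

context
  fixes I :: "'i set" and a t :: real and x :: "nat \<Rightarrow> 'i \<Rightarrow> real"
  assumes I: "finite I" and a: "a \<ge> 0" and t: "t > 0"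
begin

text \<open>The identity (t + K) G = 1 applied to v, with K the Gram part; symmetry of G moves it
  onto v inside the inner products. In this form, pairing with G v yields energies.\<close>

lemma resolvent_apply:
  assumes G: "is_resolvent I a t x S G" and "i \<in> I"
  shows "v i = t * mult_vec I G v i + a * (\<Sum>k\<in>S. x k i * inner_on I (x k) (mult_vec I G v))"
proof -
  have sym: "\<And>i j. i \<in> I \<Longrightarrow> j \<in> I \<Longrightarrow> G i j = G j i"
    using G unfolding is_resolvent_def by blast
  have "v i = (\<Sum>j\<in>I. (if i = j then 1 else 0) * v j)"
    using I \<open>i \<in> I\<close> by (simp add: if_distrib[of "\<lambda>z. z * _"] cong: if_cong)
  also have "\<dots> = (\<Sum>j\<in>I. (t * G i j + a * (\<Sum>k\<in>S. x k i * mult_vec I G (x k) j)) * v j)"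
    by (intro sum.cong refl)
      (simp only: G[unfolded is_resolvent_def, THEN conjunct2, rule_format, OF \<open>i \<in> I\<close>])
  also have "\<dots> = t * mult_vec I G v i + (\<Sum>j\<in>I. \<Sum>k\<in>S. a * (x k i * (mult_vec I G (x k) j * v j)))"
    by (simp add: mult_vec_def algebra_simps sum.distrib sum_distrib_left sum_distrib_right)
  also have "(\<Sum>j\<in>I. \<Sum>k\<in>S. a * (x k i * (mult_vec I G (x k) j * v j)))
      = (\<Sum>k\<in>S. \<Sum>j\<in>I. a * (x k i * (mult_vec I G (x k) j * v j)))"
    by (rule sum.swap)
  also have "\<dots> = a * (\<Sum>k\<in>S. x k i * inner_on I (mult_vec I G (x k)) v)"
    by (simp add: inner_on_def sum_distrib_left)
  also have "\<dots> = a * (\<Sum>k\<in>S. x k i * inner_on I (x k) (mult_vec I G v))"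
    by (simp add: inner_on_mult_vec_commute[OF sym])
  finally show ?thesis .
qed

text \<open>The energy identity: pairing (t + K) w with w splits into nonnegative terms. Positivity,
  the norm bound and uniqueness all rest on it.\<close>

lemma inner_on_gram:
  assumes "\<And>i. i \<in> I \<Longrightarrow> v i = t * w i + a * (\<Sum>k\<in>S. x k i * inner_on I (x k) w)"
  shows "inner_on I v w = t * inner_on I w w + a * (\<Sum>k\<in>S. (inner_on I (x k) w)\<^sup>2)"
proof -
  have "inner_on I v w = (\<Sum>i\<in>I. t * (w i * w i) + (\<Sum>k\<in>S. a * (x k i * w i * inner_on I (x k) w)))"
    unfolding inner_on_def[of I v w]
    by (intro sum.cong refl) (subst assms, simp_all add: algebra_simps sum_distrib_left sum_distrib_right)
  also have "\<dots> = t * inner_on I w w + (\<Sum>i\<in>I. \<Sum>k\<in>S. a * (x k i * w i * inner_on I (x k) w))"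
    by (simp add: sum.distrib sum_distrib_left inner_on_def)
  also have "(\<Sum>i\<in>I. \<Sum>k\<in>S. a * (x k i * w i * inner_on I (x k) w))
      = (\<Sum>k\<in>S. \<Sum>i\<in>I. a * (x k i * w i * inner_on I (x k) w))"
    by (rule sum.swap)
  also have "\<dots> = (\<Sum>k\<in>S. a * ((\<Sum>i\<in>I. x k i * w i) * inner_on I (x k) w))"
    by (simp add: sum_distrib_left sum_distrib_right)
  also have "\<dots> = a * (\<Sum>k\<in>S. (inner_on I (x k) w)\<^sup>2)"
    by (simp add: inner_on_def power2_eq_square sum_distrib_left)
  finally show ?thesis .
qed

text \<open>Dropping the Gram energies leaves an inequality that contains both the positivity of G
  and its norm bound 1/t.\<close>

lemma resolvent_pos:
  assumes "is_resolvent I a t x S G"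
  shows "t * inner_on I (mult_vec I G v) (mult_vec I G v) \<le> inner_on I v (mult_vec I G v)"
proof -
  have "inner_on I v (mult_vec I G v) = t * inner_on I (mult_vec I G v) (mult_vec I G v) + a * (\<Sum>k\<in>S. (inner_on I (x k) (mult_vec I G v))\<^sup>2)"
    by (rule inner_on_gram) (rule resolvent_apply[OF assms])
  moreover have "0 \<le> a * (\<Sum>k\<in>S. (inner_on I (x k) (mult_vec I G v))\<^sup>2)"
    using a by (simp add: sum_nonneg)
  ultimately show ?thesis by linarith
qed

lemma resolvent_form_nonneg:
  assumes "is_resolvent I a t x S G"
  shows "0 \<le> inner_on I v (mult_vec I G v)"
  using resolvent_pos[OF assms, of v] inner_on_self_nonneg[of I "mult_vec I G v"] t
  by (meson mult_nonneg_nonneg less_imp_le order_trans)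

text \<open>A difference of two solutions is annihilated by t + K, so its energy vanishes. This
  makes the order of the columns irrelevant: any column may be regarded as the one added
  last.\<close>

lemma resolvent_unique:
  assumes G: "is_resolvent I a t x S G" and H: "is_resolvent I a t x S H" and ij: "i \<in> I" "j \<in> I"
  shows "G i j = H i j"
proof -
  define v where "v = (\<lambda>i. if i = j then 1 else 0 :: real)"
  define u where "u i = mult_vec I G v i - mult_vec I H v i" for i
  have ipu: "inner_on I y u = inner_on I y (mult_vec I G v) - inner_on I y (mult_vec I H v)" for y
    by (simp add: inner_on_def u_def algebra_simps sum_subtractf)
  have "(\<lambda>_. 0) i = t * u i + a * (\<Sum>k\<in>S. x k i * inner_on I (x k) u)" if "i \<in> I" for i
    using resolvent_apply[OF G that, of v] resolvent_apply[OF H that, of v]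
    by (simp add: ipu u_def algebra_simps sum_subtractf)
  from inner_on_gram[where v="\<lambda>_. 0", OF this] have "0 = t * inner_on I u u + a * (\<Sum>k\<in>S. (inner_on I (x k) u)\<^sup>2)"
    by (simp add: inner_on_def)
  moreover have "0 \<le> a * (\<Sum>k\<in>S. (inner_on I (x k) u)\<^sup>2)" "0 \<le> t * inner_on I u u"
    using a t by (simp_all add: sum_nonneg inner_on_self_nonneg)
  ultimately have "inner_on I u u = 0"
    using t by (metis add_nonneg_eq_0_iff mult_eq_0_iff less_irrefl)
  then have "u i = 0"
    using inner_on_self_eq_0[OF I] ij by blast
  then show ?thesis
    using I ij by (simp add: u_def v_def mult_vec_delta)
qed

lemma mult_vec_sm_update:
  "mult_vec I (sm_update I a y G) v i
     = mult_vec I G v i - a * mult_vec I G y i * inner_on I (mult_vec I G y) v / (1 + a * inner_on I y (mult_vec I G y))"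
  by (simp add: mult_vec_def[of I "sm_update I a y G"] sm_update_def algebra_simps sum_subtractf
      mult_vec_def[of I G v] inner_on_def[of I "mult_vec I G y"] sum_distrib_left sum_divide_distrib)

text \<open>Sherman-Morrison checked against the defining equation. The denominator 1 + q is at
  least 1 because G is positive.\<close>

lemma is_resolvent_update:
  assumes G: "is_resolvent I a t x S G" and k: "k \<notin> S" and S: "finite S"
  shows "is_resolvent I a t x (insert k S) (sm_update I a (x k) G)"
  unfolding is_resolvent_def
proof (intro conjI ballI)
  have sym: "\<And>i j. i \<in> I \<Longrightarrow> j \<in> I \<Longrightarrow> G i j = G j i"
    using G unfolding is_resolvent_def by blast
  fix i j assume ij: "i \<in> I" "j \<in> I"
  show "sm_update I a (x k) G i j = sm_update I a (x k) G j i"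
    using sym[OF ij] by (simp add: sm_update_def mult_ac)
  define w where "w = mult_vec I G (x k)"
  define q where "q = a * inner_on I (x k) w"
  have "q \<ge> 0"
    using a resolvent_form_nonneg[OF G] by (simp add: q_def w_def)
  have mult_vec': "mult_vec I (sm_update I a (x k) G) v i = mult_vec I G v i - a * w i * inner_on I w v / (1 + q)" for v i
    by (simp add: mult_vec_sm_update w_def q_def)
  have 1: "t * w i + a * (\<Sum>l\<in>S. x l i * inner_on I w (x l)) = x k i"
    using resolvent_apply[OF G ij(1), of "x k"] by (simp add: w_def inner_on_commute)
  have 2: "t * G i j + a * (\<Sum>l\<in>S. x l i * mult_vec I G (x l) j) = (if i = j then 1 else 0)"
    using G ij by (simp add: is_resolvent_def)
  have 3: "(\<Sum>l\<in>S. x l i * mult_vec I (sm_update I a (x k) G) (x l) j)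
      = (\<Sum>l\<in>S. x l i * mult_vec I G (x l) j) - a * w j / (1 + q) * (\<Sum>l\<in>S. x l i * inner_on I w (x l))"
    by (simp add: mult_vec' algebra_simps sum_subtractf sum_distrib_left)
  have 4: "t * sm_update I a (x k) G i j = t * G i j - a * w j / (1 + q) * (t * w i)"
    by (simp add: sm_update_def w_def[symmetric] q_def[symmetric] algebra_simps)
  have "t * sm_update I a (x k) G i j + a * (\<Sum>l\<in>S. x l i * mult_vec I (sm_update I a (x k) G) (x l) j)
     = (t * G i j + a * (\<Sum>l\<in>S. x l i * mult_vec I G (x l) j))
       - a * w j / (1 + q) * (t * w i + a * (\<Sum>l\<in>S. x l i * inner_on I w (x l)))"
    unfolding 3 4 by (simp add: algebra_simps)
  also have "\<dots> = (if i = j then 1 else 0) - a * w j / (1 + q) * x k i"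
    by (simp only: 1 2)
  finally have "t * sm_update I a (x k) G i j + a * (\<Sum>l\<in>S. x l i * mult_vec I (sm_update I a (x k) G) (x l) j)
     = (if i = j then 1 else 0) - a * w j / (1 + q) * x k i" .
  \<comment> \<open>The new column, multiplied by w / (1 + q), compensates exactly the deficit left
    by the old columns.\<close>
  moreover have "mult_vec I (sm_update I a (x k) G) (x k) j = w j / (1 + q)"
    using \<open>q \<ge> 0\<close> by (subst mult_vec') (simp add: w_def[symmetric] inner_on_commute q_def[symmetric] field_simps,
        simp add: q_def inner_on_commute algebra_simps)
  ultimately show "t * sm_update I a (x k) G i j
      + a * (\<Sum>l\<in>insert k S. x l i * mult_vec I (sm_update I a (x k) G) (x l) j) = (if i = j then 1 else 0)"
    using k S by (simp add: algebra_simps)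
qed

lemma is_resolvent_gram_resolvent: "distinct ks \<Longrightarrow> is_resolvent I a t x (set ks) (gram_resolvent I a t x ks)"
proof (induction ks)
  case Nil
  then show ?case using t by (simp add: is_resolvent_def)
next
  case (Cons k ks)
  then show ?case using is_resolvent_update by simp
qed

lemma trace_sm_update:
  "trace_on I (sm_update I a y G) = trace_on I G - a * inner_on I (mult_vec I G y) (mult_vec I G y) / (1 + a * inner_on I y (mult_vec I G y))"
  by (simp add: trace_on_def sm_update_def sum_subtractf inner_on_def[of I "mult_vec I G y"] sum_distrib_left
      sum_divide_distrib mult.assoc)

text \<open>The trace drops by a |Gy|^2 / (1 + q), and t a |Gy|^2 \<le> q bounds this by 1/t
  whatever the size of y. This is the bounded difference that tolerates unbounded columns.\<close>

lemma trace_sm_update_bounds: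
  assumes "is_resolvent I a t x S G"
  shows "trace_on I (sm_update I a y G) \<le> trace_on I G" "trace_on I G - 1 / t \<le> trace_on I (sm_update I a y G)"
proof -
  define q where "q = a * inner_on I y (mult_vec I G y)"
  have "q \<ge> 0"
    using a resolvent_form_nonneg[OF assms] by (simp add: q_def)
  have n: "0 \<le> a * inner_on I (mult_vec I G y) (mult_vec I G y)"
    using a by (simp add: inner_on_self_nonneg)
  have "t * (a * inner_on I (mult_vec I G y) (mult_vec I G y)) \<le> q"
    using mult_left_mono[OF resolvent_pos[OF assms, of y] a] by (simp add: q_def mult_ac)
  then have "a * inner_on I (mult_vec I G y) (mult_vec I G y) / (1 + q) \<le> 1 / t"
    using t \<open>q \<ge> 0\<close> by (simp add: field_simps)
  then show "trace_on I G - 1 / t \<le> trace_on I (sm_update I a y G)"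
    by (simp add: trace_sm_update q_def)
  show "trace_on I (sm_update I a y G) \<le> trace_on I G"
    using n \<open>q \<ge> 0\<close> by (simp add: trace_sm_update q_def[symmetric])
qed

text \<open>Passing from the resolvent without y to the one with y turns q into q / (1 + q), the
  bounded function through which the self-consistent equation closes.\<close>

lemma inner_on_sm_update:
  assumes "is_resolvent I a t x S G"
  shows "a * inner_on I y (mult_vec I (sm_update I a y G) y)
    = a * inner_on I y (mult_vec I G y) / (1 + a * inner_on I y (mult_vec I G y))"
proof -
  define q where "q = a * inner_on I y (mult_vec I G y)"
  have "q \<ge> 0"
    using a resolvent_form_nonneg[OF assms] by (simp add: q_def)
  have "mult_vec I (sm_update I a y G) y i = mult_vec I G y i / (1 + q)" for i
    using \<open>q \<ge> 0\<close> by (simp only: mult_vec_sm_update inner_on_commute[of I "mult_vec I G y" y])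
      (simp add: q_def field_simps)
  then show ?thesis
    by (simp add: q_def[symmetric]) (simp add: q_def inner_on_def sum_distrib_left sum_divide_distrib)
qed

text \<open>The trace of (t + K) G = 1.\<close>

lemma resolvent_trace_identity:
  assumes "is_resolvent I a t x S G"
  shows "t * trace_on I G + (\<Sum>k\<in>S. a * inner_on I (x k) (mult_vec I G (x k))) = card I"
proof -
  have "(\<Sum>i\<in>I. t * G i i + a * (\<Sum>k\<in>S. x k i * mult_vec I G (x k) i)) = (\<Sum>i\<in>I. 1)"
    using assms by (intro sum.cong refl) (simp add: is_resolvent_def)
  also have "(\<Sum>i\<in>I. t * G i i + a * (\<Sum>k\<in>S. x k i * mult_vec I G (x k) i))
     = t * trace_on I G + (\<Sum>i\<in>I. \<Sum>k\<in>S. a * (x k i * mult_vec I G (x k) i))"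
    by (simp add: trace_on_def sum.distrib sum_distrib_left)
  also have "(\<Sum>i\<in>I. \<Sum>k\<in>S. a * (x k i * mult_vec I G (x k) i)) = (\<Sum>k\<in>S. \<Sum>i\<in>I. a * (x k i * mult_vec I G (x k) i))"
    by (rule sum.swap)
  finally show ?thesis
    by (simp add: inner_on_def sum_distrib_left)
qed

text \<open>Positivity tested on a unit vector bounds t times the squared norm of row i by G_ii.
  Since G_ii^2 is part of that norm, G_ii \<le> 1/t follows, and then the row bound. These are the
  two conditions under which quadratic forms are shown to concentrate.\<close>

lemma resolvent_entries:
  assumes G: "is_resolvent I a t x S G" and i: "i \<in> I"
  shows "0 \<le> G i i" "G i i \<le> 1 / t" "(\<Sum>j\<in>I. (G i j)\<^sup>2) \<le> 1 / t\<^sup>2"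
proof -
  have sym: "\<And>i j. i \<in> I \<Longrightarrow> j \<in> I \<Longrightarrow> G i j = G j i"
    using G unfolding is_resolvent_def by blast
  define v where "v = (\<lambda>j. if j = i then 1 else 0 :: real)"
  have w: "mult_vec I G v j = G j i" for j
    using I i by (simp add: v_def mult_vec_delta)
  have vw: "inner_on I v (mult_vec I G v) = G i i"
    using I i by (simp add: inner_on_def w) (simp add: v_def if_distrib[of "\<lambda>z. z * _"] cong: if_cong)
  have ww: "inner_on I (mult_vec I G v) (mult_vec I G v) = (\<Sum>j\<in>I. (G i j)\<^sup>2)"
    using sym i by (simp add: inner_on_def w power2_eq_square)
  have 1: "t * (\<Sum>j\<in>I. (G i j)\<^sup>2) \<le> G i i"
    using resolvent_pos[OF G, of v] unfolding vw ww .
  have 2: "(G i i)\<^sup>2 \<le> (\<Sum>j\<in>I. (G i j)\<^sup>2)"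
    using I i by (intro member_le_sum) auto
  show 3: "0 \<le> G i i"
    using resolvent_form_nonneg[OF G, of v] unfolding vw .
  have "t * (G i i)\<^sup>2 \<le> G i i"
    using mult_left_mono[OF 2, of t] 1 t by linarith
  then have "G i i * (t * G i i) \<le> G i i * 1"
    by (simp add: power2_eq_square mult_ac)
  then have "t * G i i \<le> 1"
    using 3 by (metis mult_le_cancel_left_pos mult_zero_right order_le_less zero_le_one)
  then show 4: "G i i \<le> 1 / t"
    using t by (simp add: field_simps)
  have "t * (\<Sum>j\<in>I. (G i j)\<^sup>2) \<le> 1 / t"
    using 1 4 by linarith
  then show "(\<Sum>j\<in>I. (G i j)\<^sup>2) \<le> 1 / t\<^sup>2"
    using t by (simp add: field_simps power2_eq_square)
qed

lemma resolvent_trace_bounds: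
  assumes G: "is_resolvent I a t x S G"
  shows "0 \<le> trace_on I G" "trace_on I G \<le> card I / t"
  using sum_nonneg[of I "\<lambda>i. G i i"] sum_bounded_above[of I "\<lambda>i. G i i" "1 / t"] resolvent_entries[OF G]
  by (auto simp: trace_on_def)

end

section \<open>Convergence of Stieltjes transforms\<close>

locale nonneg_distr_seq =
  fixes \<mu> :: "nat \<Rightarrow> real measure" and \<nu> :: "real measure"
  assumes \<mu>: "\<And>n. real_distribution (\<mu> n)" and \<nu>: "real_distribution \<nu>"
    and \<mu>_pos: "\<And>n. AE x in \<mu> n. 0 \<le> x" and \<nu>_pos: "AE x in \<nu>. 0 \<le> x"
begin

text \<open>The test functions for which convergence is known. Boundedness is asked on [0,
  \<infinity>) only, where the measures live; the kernels 1/(x + t) are unbounded elsewhere.\<close>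

definition integrals_converge :: "(real \<Rightarrow> real) \<Rightarrow> bool" where
  "integrals_converge f \<longleftrightarrow> f \<in> borel_measurable borel \<and> (\<exists>B. \<forall>x\<ge>0. \<bar>f x\<bar> \<le> B)
     \<and> (\<lambda>n. integral\<^sup>L (\<mu> n) f) \<longlonglongrightarrow> integral\<^sup>L \<nu> f"

lemma integrable_bounded:
  assumes "f \<in> borel_measurable borel" "\<forall>x\<ge>0. \<bar>f x\<bar> \<le> (B::real)"
  shows "integrable (\<mu> n) f" "integrable \<nu> f"
proof -
  interpret m: real_distribution "\<mu> n" by (rule \<mu>)
  interpret v: real_distribution \<nu> by (rule \<nu>)
  show "integrable (\<mu> n) f" using \<mu>_pos[of n] assms
    by (intro m.integrable_const_bound[where B=B]) (auto elim!: eventually_mono)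
  show "integrable \<nu> f" using \<nu>_pos assms
    by (intro v.integrable_const_bound[where B=B]) (auto elim!: eventually_mono)
qed

lemma integrals_converge_add:
  assumes "integrals_converge f" "integrals_converge g" shows "integrals_converge (\<lambda>x. f x + g x)"
proof -
  obtain B C where f: "f \<in> borel_measurable borel" "\<forall>x\<ge>0. \<bar>f x\<bar> \<le> B"
    and g: "g \<in> borel_measurable borel" "\<forall>x\<ge>0. \<bar>g x\<bar> \<le> C"
    using assms unfolding integrals_converge_def by blast
  have "\<forall>x\<ge>0. \<bar>f x + g x\<bar> \<le> B + C"
    using f(2) g(2) by (meson abs_triangle_ineq add_mono order_trans)
  moreover have "(\<lambda>n. integral\<^sup>L (\<mu> n) f + integral\<^sup>L (\<mu> n) g) \<longlonglongrightarrow> integral\<^sup>L \<nu> f + integral\<^sup>L \<nu> g"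
    using assms unfolding integrals_converge_def by (intro tendsto_add) auto
  ultimately show ?thesis
    using f g integrable_bounded[OF f] integrable_bounded[OF g] unfolding integrals_converge_def by auto
qed

lemma integrals_converge_scale:
  assumes "integrals_converge f" shows "integrals_converge (\<lambda>x. c * f x)"
proof -
  obtain B where f: "f \<in> borel_measurable borel" "\<forall>x\<ge>0. \<bar>f x\<bar> \<le> B"
    using assms unfolding integrals_converge_def by blast
  have "\<forall>x\<ge>0. \<bar>c * f x\<bar> \<le> \<bar>c\<bar> * B"
    using f(2) by (simp add: abs_mult mult_left_mono)
  moreover have "(\<lambda>n. c * integral\<^sup>L (\<mu> n) f) \<longlonglongrightarrow> c * integral\<^sup>L \<nu> f"
    using assms unfolding integrals_converge_def by (intro tendsto_mult_left) auto
  ultimately show ?thesis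
    using f unfolding integrals_converge_def by auto
qed

lemma integrals_converge_diff: "integrals_converge f \<Longrightarrow> integrals_converge g \<Longrightarrow> integrals_converge (\<lambda>x. f x - g x)"
  using integrals_converge_add[OF _ integrals_converge_scale[of g "-1"], of f] by simp

lemma integrals_converge_const: "integrals_converge (\<lambda>x. c)"
proof -
  interpret m: real_distribution "\<mu> n" for n by (rule \<mu>)
  interpret v: real_distribution \<nu> by (rule \<nu>)
  show ?thesis by (auto simp: integrals_converge_def m.prob_space[simplified] v.prob_space[simplified])
qed

lemma integrals_converge_sum: "finite A \<Longrightarrow> (\<And>i. i \<in> A \<Longrightarrow> integrals_converge (f i)) \<Longrightarrow> integrals_converge (\<lambda>x. \<Sum>i\<in>A. f i x)"
  by (induction A rule: finite_induct) (auto intro: integrals_converge_add integrals_converge_const)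

text \<open>Closure under uniform approximation on the half-line, by three errors of r/3; one
  approximant also transmits its bound to f.\<close>

lemma integrals_converge_approx:
  assumes f: "f \<in> borel_measurable borel"
    and appr: "\<And>e. e > 0 \<Longrightarrow> \<exists>g. integrals_converge g \<and> (\<forall>x\<ge>0. \<bar>f x - g x\<bar> \<le> e)"
  shows "integrals_converge f"
proof -
  obtain g where "integrals_converge g" and fg: "\<forall>x\<ge>0. \<bar>f x - g x\<bar> \<le> 1"
    using appr[of 1] by auto
  then obtain C where g: "\<forall>x\<ge>0. \<bar>g x\<bar> \<le> C"
    unfolding integrals_converge_def by blast
  have fB: "\<forall>x\<ge>0. \<bar>f x\<bar> \<le> C + 1"
  proof (intro allI impI)
    fix x :: real assume "x \<ge> 0"
    with g fg have "\<bar>g x\<bar> \<le> C" "\<bar>f x - g x\<bar> \<le> 1" by auto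
    then show "\<bar>f x\<bar> \<le> C + 1" by linarith
  qed
  have close: "\<bar>integral\<^sup>L M f - integral\<^sup>L M h\<bar> \<le> e"
    if M: "real_distribution M" "AE x in M. 0 \<le> x" and int: "integrable M f" "integrable M h"
      and fh: "\<forall>x\<ge>0. \<bar>f x - h x\<bar> \<le> e" for M :: "real measure" and h e
  proof -
    interpret M: real_distribution M by fact
    have "\<bar>integral\<^sup>L M f - integral\<^sup>L M h\<bar> = \<bar>\<integral>x. f x - h x \<partial>M\<bar>"
      using int by simp
    also have "\<dots> \<le> (\<integral>x. \<bar>f x - h x\<bar> \<partial>M)"
      by (rule integral_abs_bound)
    also have "\<dots> \<le> (\<integral>x. e \<partial>M)"
      using int M(2) fh by (intro integral_mono_AE) (auto elim!: eventually_mono)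
    finally show ?thesis by (simp add: M.prob_space[simplified])
  qed
  have "(\<lambda>n. integral\<^sup>L (\<mu> n) f) \<longlonglongrightarrow> integral\<^sup>L \<nu> f"
  proof (rule LIMSEQ_I)
    fix r :: real assume "r > 0"
    then obtain h where h: "integrals_converge h" "\<forall>x\<ge>0. \<bar>f x - h x\<bar> \<le> r / 3"
      using appr[of "r / 3"] by auto
    obtain B where hB: "h \<in> borel_measurable borel" "\<forall>x\<ge>0. \<bar>h x\<bar> \<le> B"
      using h(1) unfolding integrals_converge_def by blast
    have "(\<lambda>n. integral\<^sup>L (\<mu> n) h) \<longlonglongrightarrow> integral\<^sup>L \<nu> h"
      using h(1) unfolding integrals_converge_def by blast
    from LIMSEQ_D[OF this, of "r / 3"] \<open>r > 0\<close> obtain N where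
      N: "\<And>n. n \<ge> N \<Longrightarrow> \<bar>integral\<^sup>L (\<mu> n) h - integral\<^sup>L \<nu> h\<bar> < r / 3"
      by auto
    have 1: "\<bar>integral\<^sup>L (\<mu> n) f - integral\<^sup>L (\<mu> n) h\<bar> \<le> r / 3" for n
      using h(2) by (intro close \<mu> \<mu>_pos integrable_bounded[OF f fB] integrable_bounded[OF hB])
    have 2: "\<bar>integral\<^sup>L \<nu> f - integral\<^sup>L \<nu> h\<bar> \<le> r / 3"
      using h(2) by (intro close \<nu> \<nu>_pos integrable_bounded[OF f fB] integrable_bounded[OF hB])
    have "norm (integral\<^sup>L (\<mu> n) f - integral\<^sup>L \<nu> f) < r" if "n \<ge> N" for n
      using 1[of n] 2 N[OF that] unfolding real_norm_def by linarith
    then show "\<exists>no. \<forall>n\<ge>no. norm (integral\<^sup>L (\<mu> n) f - integral\<^sup>L \<nu> f) < r" by blast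
  qed
  then show ?thesis
    unfolding integrals_converge_def using f fB by blast
qed

end

section \<open>From Stieltjes kernels to continuous test functions\<close>

text \<open>The difference quotient in t of (x + t)^-(k+1) against its derivative, up to sign and
  the factor k + 1. The quotient lies between b^(k+2) and a^(k+2), which differ by at most the
  stated error. That the error is uniform in x \<ge> 0 is what allows approximation.\<close>

lemma power_difference_quotient:
  fixes x t h :: real
  assumes x: "x \<ge> 0" and t: "t > 0" and h: "h > 0"
  defines "a \<equiv> 1 / (x + t)" and "b \<equiv> 1 / (x + (t + h))"
  shows "\<bar>a ^ (k + 2) - (a ^ Suc k - b ^ Suc k) / (h * Suc k)\<bar> \<le> h * (k + 2) * (1 / t) ^ (k + 3)"
proof -
  have ab: "0 \<le> b" "b \<le> a" "a \<le> 1 / t" "0 \<le> a"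
    using assms by (auto simp: frac_le)
  have diff: "a - b = h * (a * b)"
    using x t h unfolding a_def b_def by (simp add: field_simps)
  have q: "(a ^ Suc k - b ^ Suc k) / (h * Suc k) = (\<Sum>i<Suc k. a * b * (b ^ (Suc k - Suc i) * a ^ i)) / Suc k"
  proof -
    have "a ^ Suc k - b ^ Suc k = h * (\<Sum>i<Suc k. a * b * (b ^ (Suc k - Suc i) * a ^ i))"
      unfolding power_diff_sumr2[of a "Suc k" b] diff
      by (simp add: sum_distrib_left mult_ac del: sum.lessThan_Suc)
    then show ?thesis using h by simp
  qed
  have le: "(\<Sum>i<Suc k. a * b * (b ^ (Suc k - Suc i) * a ^ i)) \<le> Suc k * a ^ (k + 2)"
  proof -
    have "a * b * (b ^ (Suc k - Suc i) * a ^ i) \<le> a ^ (k + 2)" if "i < Suc k" for i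
    proof -
      have "a * b * (b ^ (Suc k - Suc i) * a ^ i) \<le> a * a * (a ^ (Suc k - Suc i) * a ^ i)"
        using ab by (intro mult_mono power_mono) auto
      also have "\<dots> = a ^ (k + 2)"
        using that by (simp flip: power_add add: power2_eq_square[symmetric])
      finally show ?thesis .
    qed
    then have "(\<Sum>i<Suc k. a * b * (b ^ (Suc k - Suc i) * a ^ i)) \<le> (\<Sum>i<Suc k. a ^ (k + 2))"
      by (intro sum_mono) simp
    then show ?thesis by simp
  qed
  have ge: "Suc k * b ^ (k + 2) \<le> (\<Sum>i<Suc k. a * b * (b ^ (Suc k - Suc i) * a ^ i))"
  proof -
    have "b ^ (k + 2) \<le> a * b * (b ^ (Suc k - Suc i) * a ^ i)" if "i < Suc k" for i
    proof -
      have "b ^ (k + 2) = b * b * (b ^ (Suc k - Suc i) * b ^ i)"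
        using that by (simp flip: power_add add: power2_eq_square[symmetric])
      also have "\<dots> \<le> a * b * (b ^ (Suc k - Suc i) * a ^ i)"
        using ab by (intro mult_mono power_mono) auto
      finally show ?thesis .
    qed
    then have "(\<Sum>i<Suc k. b ^ (k + 2)) \<le> (\<Sum>i<Suc k. a * b * (b ^ (Suc k - Suc i) * a ^ i))"
      by (intro sum_mono) simp
    then show ?thesis by simp
  qed
  have "a ^ (k + 2) - b ^ (k + 2) = h * (\<Sum>i<k+2. a * b * (b ^ (k + 2 - Suc i) * a ^ i))"
    unfolding power_diff_sumr2[of a "k + 2" b] diff by (simp add: sum_distrib_left mult_ac del: sum.lessThan_Suc)
  also have "\<dots> \<le> h * (\<Sum>i<k+2. (1 / t) ^ (k + 3))"
  proof (intro mult_left_mono sum_mono)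
    fix i assume i: "i \<in> {..<k+2}"
    have "a * b * (b ^ (k + 2 - Suc i) * a ^ i) \<le> (1/t) * (1/t) * ((1/t) ^ (k + 2 - Suc i) * (1/t) ^ i)"
      using ab t by (intro mult_mono power_mono) auto
    also have "\<dots> = (1 / t) ^ (k + 3)"
      using i by (simp only: power_add[symmetric] power2_eq_square[symmetric]) (simp add: numeral_3_eq_3)
    finally show "a * b * (b ^ (k + 2 - Suc i) * a ^ i) \<le> (1 / t) ^ (k + 3)" .
  qed (use h in auto)
  finally have up: "a ^ (k + 2) - b ^ (k + 2) \<le> h * (k + 2) * (1 / t) ^ (k + 3)"
    by (simp add: algebra_simps)
  define Q where "Q = (\<Sum>i<Suc k. a * b * (b ^ (Suc k - Suc i) * a ^ i)) / Suc k"
  have "Q \<le> a ^ (k + 2)" "b ^ (k + 2) \<le> Q"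
    using le ge unfolding Q_def by (simp_all add: field_simps)
  then show ?thesis
    using up unfolding q Q_def[symmetric] by linarith
qed

context nonneg_distr_seq
begin

text \<open>Each further power is a uniform limit of difference quotients in t.\<close>

lemma integrals_converge_power:
  assumes stieltjes: "\<And>t. t \<in> \<rat> \<Longrightarrow> t > 0 \<Longrightarrow> integrals_converge (\<lambda>x. 1 / (x + t))"
    and t: "t \<in> \<rat>" "t > 0"
  shows "integrals_converge (\<lambda>x. (1 / (x + t)) ^ Suc k)"
  using t
proof (induction k arbitrary: t)
  case 0
  then show ?case using stieltjes by simp
next
  case (Suc k)
  show ?case
  proof (rule integrals_converge_approx)
    fix e :: real assume "e > 0"
    define K where "K = (k + 2) * (1 / t) ^ (k + 3)"
    have "K > 0" using Suc.prems by (simp add: K_def)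
    obtain m where m: "inverse (real (Suc m)) < e / K"
      using reals_Archimedean \<open>e > 0\<close> \<open>K > 0\<close> by (meson divide_pos_pos)
    \<comment> \<open>The increment is rational, so that t + h stays among the parameters covered by
      the hypothesis.\<close>
    define h where "h = inverse (real (Suc m))"
    have h: "h > 0" "h \<in> \<rat>" by (simp_all add: h_def)
    have hK: "h * K \<le> e"
      using m \<open>K > 0\<close> by (simp add: h_def field_simps)
    have "integrals_converge (\<lambda>x. (1 / (h * Suc k)) * ((1 / (x + t)) ^ Suc k - (1 / (x + (t + h))) ^ Suc k))"
      using Suc.prems h by (intro integrals_converge_scale integrals_converge_diff Suc.IH) auto
    moreover have "\<bar>(1 / (x + t)) ^ Suc (Suc k)
        - (1 / (h * Suc k)) * ((1 / (x + t)) ^ Suc k - (1 / (x + (t + h))) ^ Suc k)\<bar> \<le> e" if "x \<ge> 0" for x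
      using power_difference_quotient[OF that Suc.prems(2) h(1), of k] hK by (simp add: K_def mult_ac)
    ultimately show "\<exists>g. integrals_converge g \<and> (\<forall>x\<ge>0. \<bar>(1 / (x + t)) ^ Suc (Suc k) - g x\<bar> \<le> e)"
      by blast
  qed simp
qed

text \<open>With y = 1/(x + 1) the half-line becomes (0,1], and polynomials in y are already test
  functions; Bernstein polynomials then reach every function continuous up to y = 0. Continuous
  steps suffice for weak convergence, and they extend to y = 0 because they vanish for large
  x.\<close>

theorem stieltjes_imp_weak_conv:
  assumes stieltjes: "\<And>t. t \<in> \<rat> \<Longrightarrow> t > 0 \<Longrightarrow>
      (\<lambda>n. \<integral>x. 1 / (x + t) \<partial>\<mu> n) \<longlonglongrightarrow> (\<integral>x. 1 / (x + t) \<partial>\<nu>)"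
  shows "weak_conv_m \<mu> \<nu>"
proof (rule integral_cts_step_conv_imp_weak_conv[OF \<mu> \<nu>])
  have "integrals_converge (\<lambda>x. 1 / (x + t))" if "t \<in> \<rat>" "t > 0" for t
  proof -
    have "\<forall>x\<ge>0. \<bar>1 / (x + t)\<bar> \<le> 1 / t"
      using that by (simp add: frac_le)
    then show ?thesis
      using stieltjes[OF that] unfolding integrals_converge_def by auto
  qed
  then have pw: "integrals_converge (\<lambda>x. (1 / (x + 1)) ^ k)" for k
    using integrals_converge_power[of 1 "k - 1"] integrals_converge_const[of 1] by (cases k) auto
  have pq: "integrals_converge (\<lambda>x. (1 / (x + 1)) ^ k * (1 - 1 / (x + 1)) ^ j)" for k j
  proof (induction j arbitrary: k)
    case 0
    then show ?case using pw by simp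
  next
    case (Suc j)
    have "(\<lambda>x::real. (1 / (x + 1)) ^ k * (1 - 1 / (x + 1)) ^ Suc j)
       = (\<lambda>x. (1 / (x + 1)) ^ k * (1 - 1 / (x + 1)) ^ j - (1 / (x + 1)) ^ Suc k * (1 - 1 / (x + 1)) ^ j)"
      by (auto simp: algebra_simps)
    then show ?case by (simp only:) (rule integrals_converge_diff[OF Suc Suc])
  qed
  fix u v :: real assume uv: "u < v"
  have cont: "continuous_on UNIV (cts_step u v)"
    by (rule uniformly_continuous_imp_continuous[OF cts_step_uniformly_continuous[OF uv]])
  \<comment> \<open>The inverse map x = 1/y - 1 blows up at y = 0, so y is cut off at \<delta>. The
    cut corresponds to x = 1 + |v| > v, where the step has already reached 0.\<close>
  define \<delta> where "\<delta> = 1 / (2 + \<bar>v\<bar>)"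
  have \<delta>: "\<delta> > 0" by (simp add: \<delta>_def)
  define \<phi> where "\<phi> y = cts_step u v (1 / max y \<delta> - 1)" for y
  have \<phi>_cont: "continuous_on {0..1} \<phi>"
    unfolding \<phi>_def using \<delta>
    by (intro continuous_on_compose2[OF cont] continuous_intros) (auto simp: max_def)
  have \<phi>_eq: "\<phi> (1 / (x + 1)) = cts_step u v x" if "x \<ge> 0" for x
  proof (cases "\<delta> \<le> 1 / (x + 1)")
    case True
    then show ?thesis using that by (simp add: \<phi>_def max_def)
  next
    case False
    then have "2 + \<bar>v\<bar> < x + 1"
      using that by (simp add: \<delta>_def field_simps)
    then show ?thesis
      using False \<delta> uv by (auto simp: \<phi>_def max_def cts_step_def \<delta>_def)
  qed
  have "integrals_converge (cts_step u v)"
  proof (rule integrals_converge_approx)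
    show "cts_step u v \<in> borel_measurable borel"
      by (rule borel_measurable_continuous_onI[OF cont])
    fix e :: real assume "e > 0"
    from Bernstein_Weierstrass[OF \<phi>_cont this] obtain N where N: "\<And>n x. N \<le> n \<Longrightarrow> x \<in> {0..1} \<Longrightarrow>
        \<bar>\<phi> x - (\<Sum>k\<le>n. \<phi> (k / n) * Bernstein n k x)\<bar> < e" by blast
    define g where "g x = (\<Sum>k\<le>N. \<phi> (k / N) * Bernstein N k (1 / (x + 1)))" for x :: real
    have "integrals_converge g"
    proof -
      have "g = (\<lambda>x. \<Sum>k\<le>N. (\<phi> (k / N) * of_nat (N choose k)) * ((1 / (x + 1)) ^ k * (1 - 1 / (x + 1)) ^ (N - k)))"
        by (simp add: g_def Bernstein_def fun_eq_iff mult_ac)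
      then show ?thesis
        by (simp only:) (intro integrals_converge_sum integrals_converge_scale pq finite_atMost)
    qed
    moreover have "\<bar>cts_step u v x - g x\<bar> \<le> e" if "x \<ge> 0" for x
      using N[OF order_refl, of "1 / (x + 1)"] that by (simp add: g_def \<phi>_eq)
    ultimately show "\<exists>g. integrals_converge g \<and> (\<forall>x\<ge>0. \<bar>cts_step u v x - g x\<bar> \<le> e)" by blast
  qed
  then show "(\<lambda>n. integral\<^sup>L (\<mu> n) (cts_step u v)) \<longlonglongrightarrow> integral\<^sup>L \<nu> (cts_step u v)"
    by (simp add: integrals_converge_def)
qed

end

section \<open>The Marchenko--Pastur law\<close>

text \<open>The antiderivative is sqrt (1 - y^2) + w arcsin y - sqrt (w^2 - 1) arcsin u, with the
  Moebius map u = (1 + w y) / (w + y) of [-1,1] fixing the end points. The case w = 1 is separate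
  because u is then singular at y = -1, while its coefficient vanishes; it occurs for c = 1 and t =
  0.\<close>

lemma semicircle_antiderivative:
  fixes w :: real
  assumes w: "w \<ge> 1"
  obtains F :: "real \<Rightarrow> real" where "continuous_on {-1..1} F"
    "\<And>y. \<bar>y\<bar> < 1 \<Longrightarrow> (F has_real_derivative sqrt (1 - y\<^sup>2) / (y + w)) (at y)"
    "F 1 - F (-1) = pi * (w - sqrt (w\<^sup>2 - 1))"
proof (cases "w = 1")
  case True
  define F where "F y = sqrt (1 - y\<^sup>2) + arcsin y" for y :: real
  have "continuous_on {-1..1} F"
    unfolding F_def by (intro continuous_intros) auto
  moreover have "(F has_real_derivative sqrt (1 - y\<^sup>2) / (y + w)) (at y)" if y: "\<bar>y\<bar> < 1" for y
  proof -
    have pos: "1 - y\<^sup>2 > 0" using y by (simp add: abs_square_less_1)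
    define s where "s = sqrt (1 - y\<^sup>2)"
    have s: "s > 0" "s * s = 1 - y * y" using pos by (auto simp: s_def power2_eq_square)
    have "(F has_real_derivative (- (2 * y) * (inverse s / 2)) + inverse s) (at y)"
      unfolding F_def s_def using pos y by (auto intro!: derivative_eq_intros)
    moreover have "(- (2 * y) * (inverse s / 2)) + inverse s = s / (y + w)"
      using s y True by (simp add: field_simps)
    ultimately show ?thesis by (simp add: s_def)
  qed
  moreover have "F 1 - F (-1) = pi * (w - sqrt (w\<^sup>2 - 1))"
    using True by (simp add: F_def arcsin_minus)
  ultimately show ?thesis using that by blast
next
  case False
  with w have w1: "w > 1" by simp
  define v where "v = sqrt (w\<^sup>2 - 1)"
  have "w * w > 1" using w1 by (simp add: less_1_mult)
  then have v: "v > 0" "v * v = w * w - 1" by (auto simp: v_def power2_eq_square)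
  define u where "u y = (1 + w * y) / (w + y)" for y
  define F where "F y = sqrt (1 - y\<^sup>2) + w * arcsin y - v * arcsin (u y)" for y :: real
  \<comment> \<open>This factorisation serves twice: it shows |u| \<le> 1, and it simplifies the
    derivative of arcsin u.\<close>
  have u2: "1 - (u y)\<^sup>2 = v\<^sup>2 * (1 - y\<^sup>2) / (w + y)\<^sup>2" if "\<bar>y\<bar> \<le> 1" for y
  proof -
    have "w + y \<noteq> 0" using that w1 by linarith
    moreover have "(w + y)\<^sup>2 - (1 + w * y)\<^sup>2 = v\<^sup>2 * (1 - y\<^sup>2)"
      using v by (simp add: power2_eq_square) (simp add: algebra_simps)
    ultimately show ?thesis
      unfolding u_def by (simp add: power_divide diff_divide_eq_iff)
  qed
  have u1: "\<bar>u y\<bar> \<le> 1" if "\<bar>y\<bar> \<le> 1" for y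
  proof -
    have "0 \<le> 1 - (u y)\<^sup>2"
      unfolding u2[OF that] using that by (intro divide_nonneg_nonneg mult_nonneg_nonneg) (auto simp: abs_square_le_1)
    then show ?thesis by (simp add: abs_square_le_1)
  qed
  have "continuous_on {-1..1} F"
    unfolding F_def
  proof (intro continuous_intros)
    show "continuous_on {-1..1} u"
      unfolding u_def using w1 by (intro continuous_intros) auto
  qed (use u1 in \<open>auto simp: abs_le_iff\<close>)
  moreover have "(F has_real_derivative sqrt (1 - y\<^sup>2) / (y + w)) (at y)" if y: "\<bar>y\<bar> < 1" for y
  proof -
    have pos: "1 - y\<^sup>2 > 0" using y by (simp add: abs_square_less_1)
    have wy: "w + y > 0" using y w1 by linarith
    define z where "z = w + y"
    have z: "z > 0" using wy by (simp add: z_def)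
    define s where "s = sqrt (1 - y\<^sup>2)"
    have s: "s > 0" "s * s = 1 - y * y" using pos by (auto simp: s_def power2_eq_square)
    have su: "sqrt (1 - (u y)\<^sup>2) = v * s / (w + y)"
      using y v wy by (simp add: u2 real_sqrt_divide real_sqrt_mult s_def)
    have "1 - (u y)\<^sup>2 > 0"
      using y u2[of y] v pos wy by simp
    then have uy: "-1 < u y" "u y < 1"
      by (auto simp: abs_square_less_1 abs_less_iff)
    have du: "(u has_real_derivative (w * w - 1) / (w + y)\<^sup>2) (at y)"
      unfolding u_def using wy
      by (auto intro!: derivative_eq_intros simp: field_simps power2_eq_square)
    have "((\<lambda>y. arcsin (u y)) has_real_derivative inverse (sqrt (1 - (u y)\<^sup>2)) * ((w * w - 1) / (w + y)\<^sup>2)) (at y)"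
      by (rule DERIV_chain2[OF DERIV_arcsin du]) (use uy in auto)
    moreover have "inverse (v * s / z) * (v * v / z\<^sup>2) = v / (s * z)"
      using v(1) s(1) z by (simp add: field_simps power2_eq_square)
    ultimately have da: "((\<lambda>y. arcsin (u y)) has_real_derivative v / (s * z)) (at y)"
      unfolding su v(2)[symmetric] z_def by simp
    have ds: "((\<lambda>y. sqrt (1 - y\<^sup>2)) has_real_derivative - (y / s)) (at y)"
      unfolding s_def using pos by (auto intro!: derivative_eq_intros simp: field_simps)
    have dr: "(arcsin has_real_derivative inverse s) (at y)"
      unfolding s_def using y by (intro DERIV_arcsin) auto
    have "(F has_real_derivative - (y / s) + w * inverse s - v * (v / (s * z))) (at y)"
      unfolding F_def by (intro DERIV_add DERIV_diff DERIV_cmult ds dr da)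
    moreover have "- (y / s) + w * inverse s - v * (v / (s * z)) = s / (y + w)"
    proof -
      have "- (y / s) + w * inverse s - v * (v / (s * z)) = ((w - y) * z - v * v) / (s * z)"
        using s(1) z by (simp add: field_simps)
      also have "(w - y) * z - v * v = s * s"
        unfolding v s z_def by (simp add: algebra_simps)
      also have "s * s / (s * z) = s / (y + w)"
        using s(1) by (simp add: z_def add.commute)
      finally show ?thesis .
    qed
    ultimately show ?thesis by (simp add: s_def)
  qed
  moreover have "F 1 - F (-1) = pi * (w - sqrt (w\<^sup>2 - 1))"
  proof -
    have "u 1 = 1" "u (-1) = -1"
      using w1 by (auto simp: u_def field_simps)
    then show ?thesis by (simp add: F_def arcsin_minus v_def algebra_simps)
  qed
  ultimately show ?thesis using that by blast
qed

lemma MP_edges: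
  assumes "c > 0"
  shows "(1 - sqrt c)\<^sup>2 = 1 + c - 2 * sqrt c" "(1 + sqrt c)\<^sup>2 = 1 + c + 2 * sqrt c"
  using assms by (simp_all add: power2_eq_square algebra_simps)

text \<open>The affine map y = (x - (1 + c)) / (2 sqrt c) sends the edges to -1 and 1 and the pole
  -t to -w. The value t = 0 is included: it gives the mass of the density.\<close>

lemma MP_kernel_has_integral:
  fixes c t :: real
  assumes c: "c > 0" and t: "t \<ge> 0"
  defines "a \<equiv> (1 - sqrt c)\<^sup>2" and "b \<equiv> (1 + sqrt c)\<^sup>2"
  shows "((\<lambda>x. sqrt ((b - x) * (x - a)) / (x + t)) has_integral
     pi * (1 + c + t - sqrt ((1 + c + t)\<^sup>2 - 4 * c))) {a..b}"
proof -
  define r where "r = 2 * sqrt c"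
  have r: "r > 0" "r\<^sup>2 = 4 * c" using c by (simp_all add: r_def power_mult_distrib)
  have ab: "a = 1 + c - r" "b = 1 + c + r"
    unfolding a_def b_def r_def using MP_edges[OF c] by simp_all
  define w where "w = (1 + c + t) / r"
  have "a \<ge> 0" by (simp add: a_def)
  then have "w \<ge> 1" using ab t r by (simp add: w_def)
  then obtain F where F: "continuous_on {-1..1} F"
    "\<And>y. \<bar>y\<bar> < 1 \<Longrightarrow> (F has_real_derivative sqrt (1 - y\<^sup>2) / (y + w)) (at y)"
    "F 1 - F (-1) = pi * (w - sqrt (w\<^sup>2 - 1))"
    using semicircle_antiderivative[OF \<open>w \<ge> 1\<close>] by blast
  define y where "y x = (x - (1 + c)) / r" for x
  have yab: "y a = -1" "y b = 1" using r by (simp_all add: y_def ab)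
  have "((\<lambda>x. sqrt ((b - x) * (x - a)) / (x + t)) has_integral r * F (y b) - r * F (y a)) {a..b}"
  proof (rule fundamental_theorem_of_calculus_interior)
    show "a \<le> b" using r ab by simp
    show "continuous_on {a..b} (\<lambda>x. r * F (y x))"
    proof (intro continuous_on_mult continuous_on_const continuous_on_compose2[OF F(1)])
      show "continuous_on {a..b} y"
        unfolding y_def using r(1) by (intro continuous_intros) auto
      show "y ` {a..b} \<subseteq> {-1..1}"
        using r(1) by (auto simp: y_def ab field_simps)
    qed
    fix x assume x: "x \<in> {a<..<b}"
    have yx: "\<bar>y x\<bar> < 1" using x r by (auto simp: y_def ab abs_less_iff field_simps)
    have dy: "(y has_real_derivative 1 / r) (at x)"
      unfolding y_def using r by (auto intro!: derivative_eq_intros)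
    have "((\<lambda>x. r * F (y x)) has_real_derivative r * (sqrt (1 - (y x)\<^sup>2) / (y x + w) * (1 / r))) (at x)"
      by (intro DERIV_cmult DERIV_chain2[OF F(2)[OF yx] dy])
    moreover have "r * (sqrt (1 - (y x)\<^sup>2) / (y x + w) * (1 / r)) = sqrt ((b - x) * (x - a)) / (x + t)"
    proof -
      have "(b - x) * (x - a) = r\<^sup>2 * (1 - (y x)\<^sup>2)"
        using r(1) by (simp add: y_def ab power2_eq_square field_simps)
      then have "sqrt ((b - x) * (x - a)) = r * sqrt (1 - (y x)\<^sup>2)"
        using r(1) by (simp add: real_sqrt_mult)
      moreover have "x + t = r * (y x + w)"
        using r(1) by (simp add: y_def w_def field_simps)
      ultimately show ?thesis using r(1) by simp
    qed
    ultimately show "((\<lambda>x. r * F (y x)) has_vector_derivative sqrt ((b - x) * (x - a)) / (x + t)) (at x)"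
      by (simp add: has_real_derivative_iff_has_vector_derivative)
  qed
  moreover have "r * F (y b) - r * F (y a) = pi * (1 + c + t - sqrt ((1 + c + t)\<^sup>2 - 4 * c))"
  proof -
    have "r * F (y b) - r * F (y a) = r * (pi * (w - sqrt (w\<^sup>2 - 1)))"
      unfolding yab F(3)[symmetric] by (simp add: algebra_simps)
    also have "\<dots> = pi * (r * w - r * sqrt (w\<^sup>2 - 1))"
      by (simp add: algebra_simps)
    also have "r * sqrt (w\<^sup>2 - 1) = sqrt (r\<^sup>2 * (w\<^sup>2 - 1))"
      using r(1) by (simp add: real_sqrt_mult)
    also have "r\<^sup>2 * (w\<^sup>2 - 1) = (r * w)\<^sup>2 - r\<^sup>2"
      by (simp add: power_mult_distrib right_diff_distrib)
    also have "(r * w)\<^sup>2 - r\<^sup>2 = (1 + c + t)\<^sup>2 - 4 * c"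
      unfolding r(2) using r(1) by (simp add: w_def)
    finally show ?thesis using r(1) by (simp add: w_def)
  qed
  ultimately show ?thesis by simp
qed

section \<open>Integration against the Marchenko-Pastur law\<close>

text \<open>Induction over measurable functions. The law is given as a sum of two set functions, so
  its integrals have to be split in this way into atom and density.\<close>

lemma nn_integral_measure_sum:
  assumes sets: "sets M1 = sets M" "sets M2 = sets M"
    and em: "\<And>A. A \<in> sets M \<Longrightarrow> emeasure M A = emeasure M1 A + emeasure M2 A"
    and f: "f \<in> borel_measurable M"
  shows "integral\<^sup>N M f = integral\<^sup>N M1 f + integral\<^sup>N M2 f"
proof -
  have m: "u \<in> borel_measurable M1" "u \<in> borel_measurable M2" if "u \<in> borel_measurable M" for u :: "'a \<Rightarrow> ennreal"
    using that measurable_cong_sets[OF sets(1) refl, of borel] measurable_cong_sets[OF sets(2) refl, of borel]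
    by blast+
  show ?thesis
    using f
  proof (induction rule: borel_measurable_induct)
    case (cong f g)
    have eq: "integral\<^sup>N N' f = integral\<^sup>N N' g" if "sets N' = sets M" for N'
      using cong(3) sets_eq_imp_space_eq[OF that] by (intro nn_integral_cong) metis
    show ?case
      unfolding eq[OF refl] eq[OF sets(1)] eq[OF sets(2)] by (rule cong(4))
  next
    case (set A)
    then have "A \<in> sets M1" "A \<in> sets M2" by (simp_all only: sets)
    then show ?case by (simp only: nn_integral_indicator em set)
  next
    case (mult u c)
    then show ?case by (simp only: nn_integral_cmult m distrib_left)
  next
    case (add u v)
    have uv: "u \<in> borel_measurable M" "v \<in> borel_measurable M" by fact+
    have IH: "integral\<^sup>N M u = integral\<^sup>N M1 u + integral\<^sup>N M2 u"
      "integral\<^sup>N M v = integral\<^sup>N M1 v + integral\<^sup>N M2 v" by fact+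
    show ?case
      by (simp only: nn_integral_add uv m IH add_ac)
  next
    case (seq U)
    have IH: "integral\<^sup>N M (U i) = integral\<^sup>N M1 (U i) + integral\<^sup>N M2 (U i)" for i by fact
    have S: "integral\<^sup>N N' (SUP i. U i) = (SUP i. integral\<^sup>N N' (U i))"
      if "\<And>i. U i \<in> borel_measurable N'" for N'
      unfolding SUP_apply[abs_def] using seq(3) that
      by (rule nn_integral_monotone_convergence_SUP)
    have inc: "incseq (\<lambda>i. integral\<^sup>N N' (U i))" for N'
      using seq(3) unfolding mono_def le_fun_def by (intro allI impI nn_integral_mono) blast
    have "integral\<^sup>N M (SUP i. U i) = (SUP i. integral\<^sup>N M1 (U i) + integral\<^sup>N M2 (U i))"
      unfolding S[of M, OF seq(1)] IH ..
    also have "\<dots> = (SUP i. integral\<^sup>N M1 (U i)) + (SUP i. integral\<^sup>N M2 (U i))"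
      by (intro ennreal_SUP_add inc)
    finally show ?case unfolding S[OF m(1)[OF seq(1)]] S[OF m(2)[OF seq(1)]] .
  qed
qed

lemma nn_integral_marchenko_pastur:
  assumes "f \<in> borel_measurable borel"
  shows "integral\<^sup>N (marchenko_pastur c) f = ennreal (max 0 (1 - 1 / c)) * f 0
     + (\<integral>\<^sup>+x. ennreal (MP_density c x) * f x \<partial>lborel)"
proof -
  let ?M1 = "scale_measure (ennreal (max 0 (1 - 1 / c))) (return borel (0::real))"
  let ?M2 = "density lborel (\<lambda>x. ennreal (MP_density c x))"
  have "integral\<^sup>N (marchenko_pastur c) f = integral\<^sup>N ?M1 f + integral\<^sup>N ?M2 f"
  proof (rule nn_integral_measure_sum)
    show "f \<in> borel_measurable (marchenko_pastur c)"
      using assms measurable_cong_sets[OF sets_marchenko_pastur refl] by blast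
    fix A :: "real set" assume "A \<in> sets (marchenko_pastur c)"
    then show "emeasure (marchenko_pastur c) A = emeasure ?M1 A + emeasure ?M2 A"
      by (simp add: emeasure_marchenko_pastur emeasure_density)
  qed simp_all
  then show ?thesis
    using assms by (simp add: nn_integral_scale_measure nn_integral_return nn_integral_density)
qed

lemma AE_marchenko_pastur_nonneg: "AE x in marchenko_pastur c. 0 \<le> x"
proof -
  have "MP_density c x = 0" if "x < 0" for x
  proof -
    have "\<not> (1 - sqrt c)\<^sup>2 \<le> x"
      using that order_trans[OF zero_le_power2] by (metis not_less)
    then show ?thesis by (simp add: MP_density_def Let_def)
  qed
  then have "(\<integral>\<^sup>+x. ennreal (MP_density c x) * indicator {..<0} x \<partial>lborel) = (\<integral>\<^sup>+x. 0 \<partial>(lborel::real measure))"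
    by (intro nn_integral_cong) (auto simp: indicator_def)
  then have "emeasure (marchenko_pastur c) {..<0} = 0"
    by (simp add: emeasure_marchenko_pastur)
  then show ?thesis
    by (intro AE_I[where N="{..<0}"]) auto
qed

text \<open>Both facts come from one family of integrals, taken at 0 and at t, through 1/(x (x + t))
  = (1/x - 1/(x + t)) / t. The atom (1 - 1/c)^+ makes up for the mass that the density lacks when c
  > 1.\<close>

lemma
  assumes c: "c > 0"
  shows emeasure_marchenko_pastur_UNIV: "emeasure (marchenko_pastur c) UNIV = 1"
    and stieltjes_marchenko_pastur: "\<And>t. t > 0 \<Longrightarrow> (\<integral>x. 1 / (x + t) \<partial>marchenko_pastur c)
          = (c - 1 - t + sqrt ((1 + c + t)\<^sup>2 - 4 * c)) / (2 * c * t)"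
proof -
  define a b where "a = (1 - sqrt c)\<^sup>2" and "b = (1 + sqrt c)\<^sup>2"
  have a0: "a \<ge> 0" by (simp add: a_def)
  define f where "f t x = sqrt ((b - x) * (x - a)) / (x + t)" for t x
  define A where "A t = pi * (1 + c + t - sqrt ((1 + c + t)\<^sup>2 - 4 * c))" for t
  have hi: "(f t has_integral A t) {a..b}" if "t \<ge> 0" for t
    using MP_kernel_has_integral[OF c that] unfolding f_def A_def a_def b_def .
  have fm [measurable]: "f t \<in> borel_measurable borel" for t
    unfolding f_def by measurable
  have fpos: "0 \<le> f t x" if "t \<ge> 0" "x \<in> {a..b}" for t x
    using that a0 unfolding f_def by (auto intro!: divide_nonneg_nonneg)
  \<comment> \<open>The root at t = 0 is |1 - c|; this absolute value is what the positive part in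
    the atom cancels.\<close>
  have A0: "A 0 = pi * (1 + c - \<bar>1 - c\<bar>)"
  proof -
    have "(1 + c)\<^sup>2 - 4 * c = (1 - c)\<^sup>2" by (simp add: power2_eq_square algebra_simps)
    then show ?thesis by (simp add: A_def)
  qed
  have dens: "MP_density c x = f 0 x / (2 * pi * c) * indicator {a..b} x" for x
    by (simp add: MP_density_def f_def a_def b_def Let_def mult_ac)
  have "(\<integral>\<^sup>+x. ennreal (MP_density c x) \<partial>lborel) = ennreal (A 0 / (2 * pi * c))"
  proof -
    have "((\<lambda>x. f 0 x / (2 * pi * c)) has_integral A 0 / (2 * pi * c)) {a..b}"
      by (intro has_integral_divide hi) simp
    then have "(\<integral>\<^sup>+x. ennreal (indicator {a..b} x * (f 0 x / (2 * pi * c))) \<partial>lborel) = ennreal (A 0 / (2 * pi * c))"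
      using fpos[of 0] c by (intro nn_integral_has_integral_lebesgue) auto
    then show ?thesis by (simp add: dens mult_ac)
  qed
  then have "emeasure (marchenko_pastur c) UNIV = ennreal (max 0 (1 - 1 / c)) + ennreal (A 0 / (2 * pi * c))"
    by (simp add: emeasure_marchenko_pastur)
  also have "\<dots> = ennreal (max 0 (1 - 1 / c) + A 0 / (2 * pi * c))"
    using c by (intro ennreal_plus[symmetric]) (auto simp: A0)
  also have "max 0 (1 - 1 / c) + A 0 / (2 * pi * c) = 1"
    using c by (auto simp: A0 max_def abs_if field_simps)
  finally show "emeasure (marchenko_pastur c) UNIV = 1" by simp
  fix t :: real assume t: "t > 0"
  have hi1: "((\<lambda>x. (f 0 x - f t x) / (2 * pi * c * t)) has_integral (A 0 - A t) / (2 * pi * c * t)) {a..b}"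
    using t by (intro has_integral_divide has_integral_diff hi) auto
  have eq: "(f 0 x - f t x) / (2 * pi * c * t) = f 0 x / (2 * pi * c) * (1 / (x + t))"
    if x: "x \<in> {a..b}" for x
  \<comment> \<open>The partial fraction fails only at x = 0, which lies in the interval only if a =
    0; both sides vanish there.\<close>
  proof (cases "x = 0")
    case True
    then have "a = 0" using a0 x by auto
    with True show ?thesis by (simp add: f_def)
  next
    case False
    then have "x > 0" using x a0 by auto
    define R where "R = sqrt ((b - x) * (x - a))"
    have "R / x - R / (x + t) = R / x * (t / (x + t))"
      using \<open>x > 0\<close> t by (simp add: field_simps)
    then have "f 0 x - f t x = f 0 x * (t / (x + t))"
      by (simp add: f_def R_def)
    then show ?thesis using t c by simp
  qed
  have hi2: "((\<lambda>x. f 0 x / (2 * pi * c) * (1 / (x + t))) has_integral (A 0 - A t) / (2 * pi * c * t)) {a..b}"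
    by (rule has_integral_eq[OF eq hi1])
  \<comment> \<open>The absolute value makes the kernel nonnegative on the whole line, as the
    extended integral requires; on x \<ge> 0, which carries the law, it changes nothing.\<close>
  have pointwise: "ennreal (indicator {a..b} x * (f 0 x / (2 * pi * c) * (1 / (x + t))))
      = ennreal (MP_density c x) * ennreal (1 / \<bar>x + t\<bar>)" for x
  proof (cases "x \<in> {a..b}")
    case True
    then have "\<bar>x + t\<bar> = x + t" using a0 t by simp
    moreover have "0 \<le> f 0 x / (2 * pi * c)"
      using fpos[of 0 x] True c by simp
    moreover have "ennreal (f 0 x / (2 * pi * c)) * ennreal (1 / \<bar>x + t\<bar>)
        = ennreal (f 0 x / (2 * pi * c) * (1 / \<bar>x + t\<bar>))"
      using calculation(2) by (intro ennreal_mult[symmetric]) auto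
    ultimately show ?thesis
      using True by (simp add: dens)
  next
    case False
    then show ?thesis by (simp add: dens)
  qed
  have "(\<integral>\<^sup>+x. ennreal (indicator {a..b} x * (f 0 x / (2 * pi * c) * (1 / (x + t)))) \<partial>lborel)
      = ennreal ((A 0 - A t) / (2 * pi * c * t))"
  proof (rule nn_integral_has_integral_lebesgue[OF _ hi2])
    show "0 \<le> f 0 x / (2 * pi * c) * (1 / (x + t))" if "x \<in> {a..b}" for x
      using fpos[of 0 x] that c t a0 by simp
  qed
  then have 1: "(\<integral>\<^sup>+x. ennreal (MP_density c x) * ennreal (1 / \<bar>x + t\<bar>) \<partial>lborel) = ennreal ((A 0 - A t) / (2 * pi * c * t))"
    unfolding pointwise .
  have nn: "(A 0 - A t) / (2 * pi * c * t) \<ge> 0"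
    by (rule has_integral_nonneg[OF hi2]) (use fpos[of 0] a0 t c in auto)
  have "(\<integral>\<^sup>+x. ennreal (1 / \<bar>x + t\<bar>) \<partial>marchenko_pastur c)
     = ennreal (max 0 (1 - 1 / c) / t + (A 0 - A t) / (2 * pi * c * t))"
  proof -
    have "(\<integral>\<^sup>+x. ennreal (1 / \<bar>x + t\<bar>) \<partial>marchenko_pastur c)
        = ennreal (max 0 (1 - 1 / c)) * ennreal (1 / t) + ennreal ((A 0 - A t) / (2 * pi * c * t))"
      using t by (subst nn_integral_marchenko_pastur) (simp_all only: 1, simp_all)
    also have "ennreal (max 0 (1 - 1 / c)) * ennreal (1 / t) = ennreal (max 0 (1 - 1 / c) / t)"
      using t by (subst ennreal_mult[symmetric]) auto
    finally show ?thesis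
      using t nn by (simp only: ennreal_plus[symmetric] divide_nonneg_nonneg max.cobounded1 less_imp_le)
  qed
  then have "(\<integral>x. 1 / \<bar>x + t\<bar> \<partial>marchenko_pastur c) = max 0 (1 - 1 / c) / t + (A 0 - A t) / (2 * pi * c * t)"
  proof -
    assume nnV: "(\<integral>\<^sup>+x. ennreal (1 / \<bar>x + t\<bar>) \<partial>marchenko_pastur c)
       = ennreal (max 0 (1 - 1 / c) / t + (A 0 - A t) / (2 * pi * c * t))"
    have "(\<integral>x. 1 / \<bar>x + t\<bar> \<partial>marchenko_pastur c) = enn2real (\<integral>\<^sup>+x. ennreal (1 / \<bar>x + t\<bar>) \<partial>marchenko_pastur c)"
      by (rule integral_eq_nn_integral) auto
    then show ?thesis
      unfolding nnV using t nn by (simp only: enn2real_ennreal add_nonneg_nonneg divide_nonneg_nonneg max.cobounded1 less_imp_le)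
  qed
  moreover have "(\<integral>x. 1 / \<bar>x + t\<bar> \<partial>marchenko_pastur c) = (\<integral>x. 1 / (x + t) \<partial>marchenko_pastur c)"
    using AE_marchenko_pastur_nonneg[of c] t by (intro integral_cong_AE) (auto elim!: eventually_mono)
  moreover have "max 0 (1 - 1 / c) / t + (A 0 - A t) / (2 * pi * c * t)
     = (c - 1 - t + sqrt ((1 + c + t)\<^sup>2 - 4 * c)) / (2 * c * t)"
  proof -
    have "(A 0 - A t) / (2 * pi * c * t) = (sqrt ((1 + c + t)\<^sup>2 - 4 * c) - t - \<bar>1 - c\<bar>) / (2 * c * t)"
    proof -
      have "A 0 - A t = pi * (sqrt ((1 + c + t)\<^sup>2 - 4 * c) - t - \<bar>1 - c\<bar>)"
        by (simp add: A0 A_def[of t] right_diff_distrib distrib_left)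
      then show ?thesis by simp
    qed
    moreover have "max 0 (1 - 1 / c) / t = (c - 1 + \<bar>1 - c\<bar>) / (2 * c * t)"
      using c t by (auto simp: max_def abs_if field_simps)
    ultimately show ?thesis by (simp add: add_divide_distrib diff_divide_distrib)
  qed
  ultimately show "(\<integral>x. 1 / (x + t) \<partial>marchenko_pastur c)
          = (c - 1 - t + sqrt ((1 + c + t)\<^sup>2 - 4 * c)) / (2 * c * t)" by simp
qed

lemma real_distribution_marchenko_pastur: "c > 0 \<Longrightarrow> real_distribution (marchenko_pastur c)"
  using sets_eq_imp_space_eq[OF sets_marchenko_pastur, of c] emeasure_marchenko_pastur_UNIV[of c]
  by (auto simp: real_distribution_def real_distribution_axioms_def intro!: prob_spaceI)

section \<open>Traces of resolvents and empirical spectral distributions\<close>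

text \<open>One root is divided out at a time. This turns the count of real eigenvalues into the
  linear factorisation from which Schur triangularisation starts.\<close>

lemma monic_split_proots:
  fixes p :: "'a::idom poly"
  assumes "monic p" "size (proots p) = degree p"
  shows "p = (\<Prod>x\<in>#proots p. [:-x, 1:])"
  using assms
proof (induction "degree p" arbitrary: p)
  case 0
  then have "p = 1" by (metis monic_degree_0)
  then show ?case by simp
next
  case (Suc n)
  then have "p \<noteq> 0" by auto
  have "proots p \<noteq> {#}" using Suc.prems(2) Suc.hyps(2) by auto
  then obtain r where "r \<in># proots p" by blast
  then have "poly p r = 0" using \<open>p \<noteq> 0\<close> by simp
  then obtain q where q: "p = [:-r, 1:] * q" by (meson dvdE poly_eq_0_iff_dvd)
  then have "q \<noteq> 0" using \<open>p \<noteq> 0\<close> by auto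
  have pr: "proots p = {#r#} + proots q"
    unfolding q by (subst proots_mult) (use \<open>q \<noteq> 0\<close> in auto)
  have dg: "degree p = Suc (degree q)"
    unfolding q by (subst degree_mult_eq) (use \<open>q \<noteq> 0\<close> in auto)
  have "monic q" using Suc.prems(1) unfolding q by (simp only: lead_coeff_mult) simp
  moreover have "size (proots q) = degree q" using Suc.prems(2) by (simp add: pr dg)
  ultimately have IH: "q = (\<Prod>x\<in>#proots q. [:-x, 1:])"
    using Suc.hyps dg by (metis nat.inject)
  have "(\<Prod>x\<in>#proots p. [:-x, 1:]) = [:-r, 1:] * (\<Prod>x\<in>#proots q. [:-x, 1:])"
    unfolding pr by (simp del: mult_pCons_left)
  also have "\<dots> = p" unfolding IH[symmetric] q ..
  finally show ?case ..
qed

text \<open>Back substitution from the last row upwards: the rows of C below i are already known to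
  vanish left of the diagonal, so only the diagonal term of the product survives.\<close>

lemma upper_triangular_inverse_diag:
  fixes B C :: "nat \<Rightarrow> nat \<Rightarrow> real"
  assumes ut: "\<And>i j. i < n \<Longrightarrow> j < i \<Longrightarrow> B i j = 0"
    and inv: "\<And>i j. i < n \<Longrightarrow> j < n \<Longrightarrow> (\<Sum>k<n. B i k * C k j) = (if i = j then 1 else 0)"
    and i: "i < n"
  shows "B i i * C i i = 1 \<and> (\<forall>j<i. C i j = 0)"
  using i
proof (induction "n - i" arbitrary: i rule: less_induct)
  case less
  have eq: "B i i * C i j = (if i = j then 1 else 0)" if "j \<le> i" for j
  proof -
    have "B i k * C k j = 0" if "k < n" "k \<noteq> i" for k
    proof (cases "k < i")
      case True
      then show ?thesis using ut less.prems by simp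
    next
      case False
      then have "C k j = 0" using less.hyps[of k] that \<open>j \<le> i\<close> less.prems by auto
      then show ?thesis by simp
    qed
    then have "(\<Sum>k<n. B i k * C k j) = (\<Sum>k\<in>{i}. B i k * C k j)"
      using less.prems by (intro sum.mono_neutral_right) auto
    then show ?thesis using inv[of i j] less.prems that by simp
  qed
  from eq[of i] have "B i i * C i i = 1" by simp
  moreover from this have "B i i \<noteq> 0" by auto
  moreover have "B i i * C i j = 0" if "j < i" for j using eq[of j] that by simp
  ultimately show ?case by simp
qed

text \<open>Schur triangularisation puts the eigenvalues on the diagonal of B. The conjugate of G
  inverts B + t, so its diagonal entries are 1/(e + t), and the trace does not see the
  conjugation.\<close>

lemma trace_inverse_eigenvalues:
  fixes K G :: "real mat"
  assumes K: "K \<in> carrier_mat n n" and sym: "transpose_mat K = K"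
    and G: "G \<in> carrier_mat n n" and inv: "(K + t \<cdot>\<^sub>m 1\<^sub>m n) * G = 1\<^sub>m n"
  shows "(\<Sum>e\<leftarrow>eigenvalue_list K. 1 / (e + t)) = (\<Sum>i<n. G $$ (i, i))"
    and "\<forall>e\<in>set (eigenvalue_list K). e + t \<noteq> 0"
proof -
  define es where "es = eigenvalue_list K"
  have deg: "degree (char_poly K) = n" "monic (char_poly K)"
    using degree_monic_char_poly[OF K] by auto
  have mset_es: "mset es = proots (char_poly K)"
    by (simp add: es_def eigenvalue_list_def)
  have len: "length es = n"
    unfolding es_def by (rule length_eigenvalue_list[OF K sym])
  have "size (proots (char_poly K)) = n"
    using len mset_es by (metis size_mset)
  then have "char_poly K = (\<Prod>x\<in>#proots (char_poly K). [:-x, 1:])"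
    using deg by (intro monic_split_proots) auto
  also have "\<dots> = (\<Prod>e\<leftarrow>es. [:-e, 1:])"
    unfolding mset_es[symmetric] by (metis mset_map prod_mset_prod_list)
  finally have cp: "char_poly K = (\<Prod>e\<leftarrow>es. [:-e, 1:])" .
  obtain B P Q where "schur_decomposition K es = (B, P, Q)"
    by (cases "schur_decomposition K es") auto
  from schur_decomposition[OF K cp this] have sim: "similar_mat_wit K B P Q"
    and ut: "upper_triangular B" and diag: "diag_mat B = es" by auto
  from similar_mat_witD2[OF K sim] have PQ: "P * Q = 1\<^sub>m n" "Q * P = 1\<^sub>m n" "K = P * B * Q"
    and carr: "B \<in> carrier_mat n n" "P \<in> carrier_mat n n" "Q \<in> carrier_mat n n" by auto
  define C where "C = Q * (G * P)"
  have C: "C \<in> carrier_mat n n" using carr G by (simp add: C_def)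
  define Bt where "Bt = B + t \<cdot>\<^sub>m 1\<^sub>m n"
  have Bt: "Bt \<in> carrier_mat n n" using carr by (simp add: Bt_def)
  have Kt: "K + t \<cdot>\<^sub>m 1\<^sub>m n \<in> carrier_mat n n" using K by simp
  have QK: "Bt * Q = Q * (K + t \<cdot>\<^sub>m 1\<^sub>m n)"
  proof -
    have "Q * (K + t \<cdot>\<^sub>m 1\<^sub>m n) = Q * K + Q * (t \<cdot>\<^sub>m 1\<^sub>m n)"
      using carr K by (intro mult_add_distrib_mat) auto
    also have "Q * K = B * Q"
    proof -
      have "Q * K = Q * (P * (B * Q))"
        unfolding PQ(3) using carr by (simp add: assoc_mult_mat[of P n n B n Q n])
      also have "\<dots> = (Q * P) * (B * Q)"
        using carr by (intro assoc_mult_mat[symmetric]) auto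
      finally show ?thesis using carr by (simp add: PQ)
    qed
    also have "Q * (t \<cdot>\<^sub>m 1\<^sub>m n) = (t \<cdot>\<^sub>m 1\<^sub>m n) * Q"
      using mult_smult_distrib[OF carr(3) one_carrier_mat] mult_smult_assoc_mat[OF one_carrier_mat carr(3)] carr
      by simp
    also have "B * Q + (t \<cdot>\<^sub>m 1\<^sub>m n) * Q = Bt * Q"
      unfolding Bt_def using carr by (intro add_mult_distrib_mat[symmetric]) auto
    finally show ?thesis ..
  qed
  have "Bt * C = (Bt * Q) * (G * P)"
    unfolding C_def using Bt carr G by (intro assoc_mult_mat[symmetric]) auto
  also have "\<dots> = Q * ((K + t \<cdot>\<^sub>m 1\<^sub>m n) * (G * P))"
    unfolding QK using Kt carr G by (intro assoc_mult_mat) auto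
  also have "(K + t \<cdot>\<^sub>m 1\<^sub>m n) * (G * P) = (K + t \<cdot>\<^sub>m 1\<^sub>m n) * G * P"
    using Kt carr G by (intro assoc_mult_mat[symmetric]) auto
  also have "\<dots> = P" using carr by (simp add: inv)
  finally have BC: "Bt * C = 1\<^sub>m n" by (simp add: PQ)
  have BCs: "(\<Sum>k<n. Bt $$ (i, k) * C $$ (k, j)) = (if i = j then 1 else 0)" if "i < n" "j < n" for i j
  proof -
    have "(Bt * C) $$ (i, j) = (\<Sum>k<n. Bt $$ (i, k) * C $$ (k, j))"
      using Bt C that by (auto simp: scalar_prod_def atLeast0LessThan intro!: sum.cong)
    then show ?thesis using that by (simp add: BC)
  qed
  have Bt_diag: "Bt $$ (i, i) = es ! i + t" if "i < n" for i
    using carr that diag by (auto simp: Bt_def diag_mat_def)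
  have Bt_ut: "Bt $$ (i, j) = 0" if "i < n" "j < i" for i j
    using carr that ut by (auto simp: Bt_def upper_triangular_def)
  have key: "(es ! i + t) * C $$ (i, i) = 1" if "i < n" for i
    using upper_triangular_inverse_diag[of n "\<lambda>i j. Bt $$ (i, j)" "\<lambda>i j. C $$ (i, j)" i]
      Bt_ut BCs that by (simp add: Bt_diag)
  then have "es ! i + t \<noteq> 0" if "i < n" for i
    using that by (metis mult_zero_left zero_neq_one)
  then show "\<forall>e\<in>set (eigenvalue_list K). e + t \<noteq> 0"
    using len by (auto simp: es_def[symmetric] in_set_conv_nth)
  define D where "D = G * P"
  have D: "D \<in> carrier_mat n n" using carr G by (simp add: D_def)
  have ent: "C $$ (i, i) = (\<Sum>k<n. Q $$ (i, k) * D $$ (k, i))" if "i < n" for i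
    using carr D that unfolding C_def D_def[symmetric] by (auto simp: scalar_prod_def atLeast0LessThan intro!: sum.cong)
  have "(\<Sum>e\<leftarrow>es. 1 / (e + t)) = (\<Sum>i<n. 1 / (es ! i + t))"
    by (simp add: sum_list_sum_nth len atLeast0LessThan)
  also have "\<dots> = (\<Sum>i<n. C $$ (i, i))"
  proof (intro sum.cong refl)
    fix i assume "i \<in> {..<n}"
    then have "(es ! i + t) * C $$ (i, i) = 1" using key by simp
    moreover from this have "es ! i + t \<noteq> 0" by (metis mult_zero_left zero_neq_one)
    ultimately show "1 / (es ! i + t) = C $$ (i, i)" by (simp add: divide_eq_eq mult.commute)
  qed
  also have "\<dots> = (\<Sum>i<n. \<Sum>k<n. Q $$ (i, k) * D $$ (k, i))"
    by (intro sum.cong refl) (simp add: ent)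
  also have "\<dots> = (\<Sum>k<n. \<Sum>i<n. D $$ (k, i) * Q $$ (i, k))"
    by (subst sum.swap) (simp add: mult.commute)
  also have "\<dots> = (\<Sum>k<n. (D * Q) $$ (k, k))"
    using carr D by (intro sum.cong refl) (auto simp: scalar_prod_def atLeast0LessThan intro!: sum.cong)
  also have "D * Q = G"
    unfolding D_def using carr G by (simp add: assoc_mult_mat[of G n n P n Q n] PQ)
  finally show "(\<Sum>e\<leftarrow>eigenvalue_list K. 1 / (e + t)) = (\<Sum>i<n. G $$ (i, i))"
    by (simp add: es_def)
qed

text \<open>Passage from functions on \<open>I\<close> to matrices along the enumeration used in
  \<open>sample_cov\<close>. The second claim says that -t is not an eigenvalue and serves to locate
  the spectrum.\<close>

lemma sample_cov_eigenvalues: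
  assumes I: "finite I" and t: "t > 0"
    and R: "is_resolvent I (1 / real m) t x {1..m} R"
  shows "(\<Sum>e\<leftarrow>eigenvalue_list (sample_cov I m x). 1 / (e + t)) = trace_on I R"
    and "\<forall>e\<in>set (eigenvalue_list (sample_cov I m x)). e + t \<noteq> 0"
proof -
  define e where "e = from_nat_into I"
  define p where "p = card I"
  have e: "bij_betw e {..<p} I"
    unfolding e_def p_def by (rule bij_betw_from_nat_into_finite[OF I])
  have eI: "e i \<in> I" if "i < p" for i
    using bij_betwE[OF e] that by auto
  have einj: "e i = e j \<longleftrightarrow> i = j" if "i < p" "j < p" for i j
    using e that by (auto simp: bij_betw_def inj_on_def)
  define G where "G = mat p p (\<lambda>(i, j). R (e i) (e j))"
  define K where "K = sample_cov I m x"
  have K: "K \<in> carrier_mat p p" and G: "G \<in> carrier_mat p p"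
    by (simp_all add: K_def sample_cov_def p_def G_def)
  have Kij: "K $$ (i, j) = 1 / real m * (\<Sum>k\<in>{1..m}. x k (e i) * x k (e j))" if "i < p" "j < p" for i j
    using that by (simp add: K_def sample_cov_def p_def e_def)
  have sym: "R i j = R j i" if "i \<in> I" "j \<in> I" for i j
    using R that unfolding is_resolvent_def by blast
  have inv: "(K + t \<cdot>\<^sub>m 1\<^sub>m p) * G = 1\<^sub>m p"
  proof (rule eq_matI)
    fix i j assume "i < dim_row (1\<^sub>m p :: real mat)" "j < dim_col (1\<^sub>m p :: real mat)"
    then have ij: "i < p" "j < p" by simp_all
    have "((K + t \<cdot>\<^sub>m 1\<^sub>m p) * G) $$ (i, j)
        = (\<Sum>l<p. (K $$ (i, l) + t * (if i = l then 1 else 0)) * R (e l) (e j))"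
      using K G ij by (auto simp: scalar_prod_def atLeast0LessThan G_def intro!: sum.cong)
    also have "\<dots> = (\<Sum>l<p. K $$ (i, l) * R (e l) (e j)) + (\<Sum>l<p. if i = l then t * R (e l) (e j) else 0)"
      by (simp add: distrib_right sum.distrib if_distrib[of "\<lambda>z. t * z * _"] cong: if_cong)
    also have "(\<Sum>l<p. if i = l then t * R (e l) (e j) else 0) = t * R (e i) (e j)"
      using ij by simp
    also have "(\<Sum>l<p. K $$ (i, l) * R (e l) (e j))
        = (\<Sum>l<p. \<Sum>k\<in>{1..m}. 1 / real m * (x k (e i) * (R (e j) (e l) * x k (e l))))"
    proof (rule sum.cong[OF refl])
      fix l assume "l \<in> {..<p}"
      then have l: "l < p" by simp
      show "K $$ (i, l) * R (e l) (e j)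
          = (\<Sum>k\<in>{1..m}. 1 / real m * (x k (e i) * (R (e j) (e l) * x k (e l))))"
        unfolding Kij[OF ij(1) l] sym[OF eI[OF l] eI[OF ij(2)]] sum_distrib_left sum_distrib_right
        by (intro sum.cong refl) (simp only: mult_ac)
    qed
    also have "\<dots> = (\<Sum>k\<in>{1..m}. \<Sum>l<p. 1 / real m * (x k (e i) * (R (e j) (e l) * x k (e l))))"
      by (rule sum.swap)
    also have "\<dots> = 1 / real m * (\<Sum>k\<in>{1..m}. x k (e i) * (\<Sum>l<p. R (e j) (e l) * x k (e l)))"
      by (simp add: sum_distrib_left)
    also have "\<dots> = 1 / real m * (\<Sum>k\<in>{1..m}. x k (e i) * mult_vec I R (x k) (e j))"
    proof -
      have "(\<Sum>l<p. R (e j) (e l) * x k (e l)) = mult_vec I R (x k) (e j)" for k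
        unfolding mult_vec_def by (rule sum.reindex_bij_betw[OF e])
      then show ?thesis by (simp only:)
    qed
    also have "\<dots> + t * R (e i) (e j) = (if e i = e j then 1 else 0)"
      using R eI ij unfolding is_resolvent_def by (simp add: add.commute)
    finally show "((K + t \<cdot>\<^sub>m 1\<^sub>m p) * G) $$ (i, j) = 1\<^sub>m p $$ (i, j)"
      using ij einj by simp
  qed (use K G in auto)
  have symK: "transpose_mat K = K"
    unfolding K_def by (rule transpose_sample_cov)
  have "(\<Sum>i<p. G $$ (i, i)) = trace_on I R"
    unfolding trace_on_def using sum.reindex_bij_betw[OF e, of "\<lambda>i. R i i"] by (simp add: G_def)
  then show "(\<Sum>e\<leftarrow>eigenvalue_list (sample_cov I m x). 1 / (e + t)) = trace_on I R"
    using trace_inverse_eigenvalues(1)[OF K symK G inv] by (simp add: K_def)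
  show "\<forall>e\<in>set (eigenvalue_list (sample_cov I m x)). e + t \<noteq> 0"
    using trace_inverse_eigenvalues(2)[OF K symK G inv] by (simp add: K_def)
qed

lemma real_distribution_ESD: "dim_row K > 0 \<Longrightarrow> real_distribution (ESD K)"
  unfolding ESD_def
  by (intro prob_space.real_distribution_distr prob_space_uniform_count_measure)
    (auto simp: measurable_def space_uniform_count_measure sets_uniform_count_measure)

lemma integral_ESD:
  fixes f :: "real \<Rightarrow> real"
  assumes "f \<in> borel_measurable borel" and len: "length (eigenvalue_list K) = dim_row K"
  shows "integral\<^sup>L (ESD K) f = (\<Sum>e\<leftarrow>eigenvalue_list K. f e) / real (dim_row K)"
proof -
  have "(\<lambda>j. eigenvalue_list K ! j) \<in> measurable (uniform_count_measure {..<dim_row K}) borel"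
    by (auto simp: measurable_def space_uniform_count_measure sets_uniform_count_measure)
  then have "integral\<^sup>L (ESD K) f
      = (\<integral>j. f (eigenvalue_list K ! j) \<partial>uniform_count_measure {..<dim_row K})"
    unfolding ESD_def using assms by (intro integral_distr) auto
  then show ?thesis
    by (simp add: integral_uniform_count_measure sum_list_sum_nth len atLeast0LessThan)
qed

lemma ESD_sample_cov:
  assumes I: "finite I" "I \<noteq> {}"
  shows "real_distribution (ESD (sample_cov I m x))"
    and "AE y in ESD (sample_cov I m x). 0 \<le> y"
    and "\<And>t. t > 0 \<Longrightarrow> (\<integral>y. 1 / (y + t) \<partial>ESD (sample_cov I m x))
           = trace_on I (gram_resolvent I (1 / real m) t x [1..<Suc m]) / card I"
proof -
  define K where "K = sample_cov I m x"
  have dim: "dim_row K = card I" by (simp add: K_def sample_cov_def)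
  have len: "length (eigenvalue_list K) = card I"
    unfolding K_def by (rule length_eigenvalue_list[OF _ transpose_sample_cov]) (simp add: sample_cov_def)
  have gram_resolvent: "is_resolvent I (1 / real m) t x {1..m} (gram_resolvent I (1 / real m) t x [1..<Suc m])" if "t > 0" for t
    using is_resolvent_gram_resolvent[OF I(1), of "1 / real m" t "[1..<Suc m]" x] that
    by (simp add: atLeastLessThanSuc_atLeastAtMost del: upt_Suc)
  show "real_distribution (ESD (sample_cov I m x))"
    using I by (intro real_distribution_ESD) (simp add: sample_cov_def card_gt_0_iff)
  have "0 \<le> e" if "e \<in> set (eigenvalue_list K)" for e
  proof (rule ccontr)
    assume "\<not> 0 \<le> e"
    \<comment> \<open>A negative eigenvalue e would make t = -e an admissible parameter with e + t =
      0.\<close>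
    then have "- e > 0" by simp
    from sample_cov_eigenvalues(2)[OF I(1) this gram_resolvent[OF this]] that show False
      by (auto simp: K_def)
  qed
  then have nn: "0 \<le> eigenvalue_list K ! j" if "j < card I" for j
    using that len by simp
  have "(\<lambda>j. eigenvalue_list K ! j) \<in> measurable (uniform_count_measure {..<dim_row K}) borel"
    by (auto simp: measurable_def space_uniform_count_measure sets_uniform_count_measure)
  then show "AE y in ESD (sample_cov I m x). 0 \<le> y"
    unfolding ESD_def K_def[symmetric] using nn dim
    by (subst AE_distr_iff) (auto simp: space_uniform_count_measure)
  fix t :: real assume "t > 0"
  then show "(\<integral>y. 1 / (y + t) \<partial>ESD (sample_cov I m x))
           = trace_on I (gram_resolvent I (1 / real m) t x [1..<Suc m]) / card I"
    using sample_cov_eigenvalues(1)[OF I(1) \<open>t > 0\<close> gram_resolvent] len dim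
    by (subst integral_ESD) (simp_all add: K_def)
qed

section \<open>Moments of exchangeable vectors\<close>

text \<open>A bijection from U to V is glued with one between the complements. Through it,
  exchangeability makes square moments depend on the size of the index set only.\<close>

lemma permutes_mapping_subset:
  assumes S: "finite S" and U: "U \<subseteq> S" and V: "V \<subseteq> S" and card: "card U = card V"
  obtains \<sigma> where "\<sigma> permutes S" "\<sigma> ` U = V"
proof -
  have fin: "finite U" "finite V" using S U V finite_subset by auto
  obtain f where f: "bij_betw f U V"
    using finite_same_card_bij[OF fin card] by blast
  have "card (S - U) = card (S - V)"
    using S U V fin card by (simp add: card_Diff_subset)
  then obtain g where g: "bij_betw g (S - U) (S - V)"
    using finite_same_card_bij[of "S - U" "S - V"] S by blast
  define \<sigma> where "\<sigma> x = (if x \<in> U then f x else if x \<in> S then g x else x)" for x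
  have fU: "bij_betw \<sigma> U V"
    using f by (subst bij_betw_cong[of U \<sigma> f]) (auto simp: \<sigma>_def)
  have gU: "bij_betw \<sigma> (S - U) (S - V)"
    using g by (subst bij_betw_cong[of "S - U" \<sigma> g]) (auto simp: \<sigma>_def)
  have "bij_betw \<sigma> (U \<union> (S - U)) (V \<union> (S - V))"
    by (rule bij_betw_combine[OF fU gU]) auto
  then have "bij_betw \<sigma> S S"
    using U V by (simp add: Un_absorb1)
  moreover have "\<sigma> x = x" if "x \<notin> S" for x
    using that U by (auto simp: \<sigma>_def)
  ultimately have "\<sigma> permutes S"
    by (rule bij_imp_permutes)
  moreover have "\<sigma> ` U = V"
    using fU by (rule bij_betw_imp_surj_on)
  ultimately show ?thesis using that by blast
qed

section \<open>Truncation bounds for monomials\<close>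

lemma monomial_le_power:
  fixes y :: "'a \<Rightarrow> real" and e :: "'a \<Rightarrow> nat"
  assumes U: "finite U" and y: "\<And>a. a \<in> U \<Longrightarrow> 0 \<le> y a" "\<And>a. a \<in> U \<Longrightarrow> y a \<le> M"
    and M: "1 \<le> M" and e: "sum e U \<le> D"
  shows "(\<Prod>a\<in>U. y a ^ e a) \<le> M ^ D"
proof -
  have "(\<Prod>a\<in>U. y a ^ e a) \<le> (\<Prod>a\<in>U. M ^ e a)"
    using y by (intro prod_mono) (auto intro: power_mono)
  also have "\<dots> = M ^ sum e U"
    by (simp add: power_sum)
  also have "\<dots> \<le> M ^ D"
    using M e by (intro power_increasing)
  finally show ?thesis .
qed

text \<open>Uniform integrability in pointwise form: the largest value V exceeds M, so writing V^D
  as V^-\<epsilon> times V^(D+\<epsilon>) gains the factor M^-\<epsilon> at the price of a moment of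
  order D + \<epsilon>.\<close>

lemma monomial_le_powr_sum:
  fixes y :: "'a \<Rightarrow> real" and e :: "'a \<Rightarrow> nat" and \<epsilon> :: real
  assumes U: "finite U" and y: "\<And>a. a \<in> U \<Longrightarrow> 0 \<le> y a"
    and M: "1 \<le> M" and big: "\<exists>a\<in>U. M < y a" and e: "sum e U \<le> D" and \<epsilon>: "0 \<le> \<epsilon>"
  shows "(\<Prod>a\<in>U. y a ^ e a) \<le> M powr (- \<epsilon>) * (\<Sum>a\<in>U. y a powr (D + \<epsilon>))"
proof -
  have ne: "U \<noteq> {}" using big by auto
  define V where "V = Max (y ` U)"
  have le: "y a \<le> V" if "a \<in> U" for a using that U by (simp add: V_def)
  from big obtain a where "a \<in> U" "M < y a" by blast
  then have "M < V" using le[of a] by linarith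
  then have V: "1 \<le> V" "0 < V" using M by simp_all
  have "V \<in> y ` U"
    unfolding V_def using U ne by (intro Max_in) simp_all
  then obtain b where b: "b \<in> U" "V = y b" by blast
  have "(\<Prod>a\<in>U. y a ^ e a) \<le> V ^ D"
    by (rule monomial_le_power[OF U y le V(1) e])
  also have "V ^ D = V powr (- \<epsilon>) * V powr (D + \<epsilon>)"
  proof -
    have "V powr (- \<epsilon>) * V powr (D + \<epsilon>) = V powr (- \<epsilon> + (D + \<epsilon>))"
      by (rule powr_add[symmetric])
    also have "- \<epsilon> + (D + \<epsilon>) = real D" by simp
    finally show ?thesis using V(2) by (simp only: powr_realpow)
  qed
  also have "\<dots> \<le> M powr (- \<epsilon>) * (\<Sum>a\<in>U. y a powr (D + \<epsilon>))"
  proof (rule mult_mono)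
    show "V powr (- \<epsilon>) \<le> M powr (- \<epsilon>)"
      using M \<open>M < V\<close> \<epsilon> by (intro powr_mono2') auto
    show "V powr (D + \<epsilon>) \<le> (\<Sum>a\<in>U. y a powr (D + \<epsilon>))"
      unfolding b(2) using b(1) U by (intro member_le_sum) auto
  qed auto
  finally show ?thesis .
qed

text \<open>The case M = 1 of the previous bound, together with the trivial bound 1 when no value
  exceeds 1.\<close>

lemma monomial_le_one_plus:
  fixes y :: "'a \<Rightarrow> real" and e :: "'a \<Rightarrow> nat" and \<epsilon> :: real
  assumes U: "finite U" and y: "\<And>a. a \<in> U \<Longrightarrow> 0 \<le> y a" and e: "sum e U \<le> D" and \<epsilon>: "0 \<le> \<epsilon>"
  shows "(\<Prod>a\<in>U. y a ^ e a) \<le> 1 + (\<Sum>a\<in>U. y a powr (D + \<epsilon>))"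
proof (cases "\<exists>a\<in>U. 1 < y a")
  case True
  then show ?thesis using monomial_le_powr_sum[OF U y order_refl True e \<epsilon>] by simp
next
  case False
  then have "y a \<le> 1" if "a \<in> U" for a using that by force
  then have "(\<Prod>a\<in>U. y a ^ e a) \<le> 1 ^ D"
    by (intro monomial_le_power[OF U y]) (use e in auto)
  moreover have "0 \<le> (\<Sum>a\<in>U. y a powr (D + \<epsilon>))" by (simp add: sum_nonneg)
  ultimately show ?thesis by simp
qed

section \<open>Moments under exchangeability\<close>

lemma exchangeable_integral:
  fixes h :: "(nat \<Rightarrow> real) \<Rightarrow> real"
  assumes rv: "random_vector n N X" and ex: "exchangeable n N X" and \<sigma>: "\<sigma> permutes {1..n}"
    and h: "h \<in> borel_measurable (Pi\<^sub>M {1..n} (\<lambda>_. borel))"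
  shows "(\<integral>w. h (\<lambda>i\<in>{1..n}. X (\<sigma> i) w) \<partial>N) = (\<integral>w. h (\<lambda>i\<in>{1..n}. X i w) \<partial>N)"
proof -
  have m: "(\<lambda>w. \<lambda>i\<in>{1..n}. X (\<tau> i) w) \<in> N \<rightarrow>\<^sub>M Pi\<^sub>M {1..n} (\<lambda>_. borel)"
    if "\<And>i. i \<in> {1..n} \<Longrightarrow> \<tau> i \<in> {1..n}" for \<tau>
    using rv that by (intro measurable_restrict) (auto simp: random_vector_def)
  have "(\<integral>w. h (\<lambda>i\<in>{1..n}. X (\<sigma> i) w) \<partial>N)
      = integral\<^sup>L (distr N (Pi\<^sub>M {1..n} (\<lambda>_. borel)) (\<lambda>w. \<lambda>i\<in>{1..n}. X (\<sigma> i) w)) h"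
    by (rule integral_distr[symmetric, OF m h]) (use permutes_in_image[OF \<sigma>] in auto)
  also have "\<dots> = integral\<^sup>L (distr N (Pi\<^sub>M {1..n} (\<lambda>_. borel)) (\<lambda>w. \<lambda>i\<in>{1..n}. X i w)) h"
    using ex \<sigma> by (simp add: exchangeable_def)
  also have "\<dots> = (\<integral>w. h (\<lambda>i\<in>{1..n}. X i w) \<partial>N)"
    by (rule integral_distr[OF m[of "\<lambda>i. i"] h])
  finally show ?thesis .
qed

text \<open>The constants D, \<epsilon> and C will be the same for all n, so every bound derived
  from them is uniform in n. The moment is an extended integral, so its bound includes finiteness
  and yields integrability.\<close>

locale exchangeable_moments =
  fixes n :: nat and N :: "'b measure" and X :: "nat \<Rightarrow> 'b \<Rightarrow> real" and D :: nat and \<epsilon> C :: real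
  assumes rv: "random_vector n N X" and ex: "exchangeable n N X" and n: "1 \<le> n"
    and \<epsilon>: "0 < \<epsilon>" and C: "0 \<le> C"
    and mom: "(\<integral>\<^sup>+w. ennreal (\<bar>X 1 w\<bar> powr (D + \<epsilon>)) \<partial>N) \<le> ennreal C"
begin

sublocale prob_space N
  using rv by (simp add: random_vector_def)

lemma X_measurable [measurable]: "i \<in> {1..n} \<Longrightarrow> X i \<in> borel_measurable N"
  using rv by (simp add: random_vector_def)

lemma power_moment:
  assumes "\<alpha> \<in> {1..n}"
  shows "integrable N (\<lambda>w. \<bar>X \<alpha> w\<bar> powr (D + \<epsilon>))"
    and "(\<integral>w. \<bar>X \<alpha> w\<bar> powr (D + \<epsilon>) \<partial>N) \<le> C"
proof -
  have one: "1 \<in> {1..n}" using n by simp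
  have \<sigma>: "Transposition.transpose 1 \<alpha> permutes {1..n}"
    using assms one by (rule permutes_swap_id[rotated])
  define P where "P \<tau> = distr N (Pi\<^sub>M {1..n} (\<lambda>_. borel :: real measure)) (\<lambda>w. \<lambda>i\<in>{1..n}. X (\<tau> i) w)" for \<tau>
  have m: "(\<lambda>w. \<lambda>i\<in>{1..n}. X (\<tau> i) w) \<in> N \<rightarrow>\<^sub>M Pi\<^sub>M {1..n} (\<lambda>_. borel)"
    if "\<And>i. i \<in> {1..n} \<Longrightarrow> \<tau> i \<in> {1..n}" for \<tau>
    using that by (intro measurable_restrict X_measurable) auto
  have h: "(\<lambda>x. ennreal (\<bar>x 1\<bar> powr (D + \<epsilon>))) \<in> borel_measurable (Pi\<^sub>M {1..n} (\<lambda>_. borel :: real measure))"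
    using one by measurable
  have nnd: "(\<integral>\<^sup>+x. ennreal (\<bar>x 1\<bar> powr (D + \<epsilon>)) \<partial>P \<tau>) = (\<integral>\<^sup>+w. ennreal (\<bar>X (\<tau> 1) w\<bar> powr (D + \<epsilon>)) \<partial>N)"
    if "\<And>i. i \<in> {1..n} \<Longrightarrow> \<tau> i \<in> {1..n}" for \<tau>
    unfolding P_def using one h by (subst nn_integral_distr[OF m[OF that]]) auto
  have "P (Transposition.transpose 1 \<alpha>) = P id"
    using ex \<sigma> unfolding exchangeable_def P_def by simp
  then have "(\<integral>\<^sup>+x. ennreal (\<bar>x 1\<bar> powr (D + \<epsilon>)) \<partial>P (Transposition.transpose 1 \<alpha>))
      = (\<integral>\<^sup>+x. ennreal (\<bar>x 1\<bar> powr (D + \<epsilon>)) \<partial>P id)"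
    by simp
  then have eq: "(\<integral>\<^sup>+w. ennreal (\<bar>X \<alpha> w\<bar> powr (D + \<epsilon>)) \<partial>N) = (\<integral>\<^sup>+w. ennreal (\<bar>X 1 w\<bar> powr (D + \<epsilon>)) \<partial>N)"
    using nnd[of "Transposition.transpose 1 \<alpha>"] nnd[of id] permutes_in_image[OF \<sigma>] by simp
  then have le: "(\<integral>\<^sup>+w. ennreal (\<bar>X \<alpha> w\<bar> powr (D + \<epsilon>)) \<partial>N) \<le> ennreal C"
    using mom by simp
  have meas: "(\<lambda>w. \<bar>X \<alpha> w\<bar> powr (D + \<epsilon>)) \<in> borel_measurable N"
    using X_measurable[OF assms] by measurable
  show int: "integrable N (\<lambda>w. \<bar>X \<alpha> w\<bar> powr (D + \<epsilon>))"
    using le meas by (intro integrableI_nonneg) (auto intro: le_less_trans)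
  show "(\<integral>w. \<bar>X \<alpha> w\<bar> powr (D + \<epsilon>) \<partial>N) \<le> C"
    using le nn_integral_eq_integral[OF int] C by simp
qed

lemma monomial_moment:
  assumes U: "U \<subseteq> {1..n}" and e: "sum e U \<le> D"
  shows "integrable N (\<lambda>w. \<Prod>\<alpha>\<in>U. X \<alpha> w ^ e \<alpha>)"
    and "\<bar>\<integral>w. (\<Prod>\<alpha>\<in>U. X \<alpha> w ^ e \<alpha>) \<partial>N\<bar> \<le> 1 + card U * C"
proof -
  have fin: "finite U" using U finite_subset by blast
  define g where "g w = 1 + (\<Sum>\<alpha>\<in>U. \<bar>X \<alpha> w\<bar> powr (D + \<epsilon>))" for w
  have g: "integrable N g"
    unfolding g_def using U by (intro Bochner_Integration.integrable_add integrable_const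
        Bochner_Integration.integrable_sum power_moment) auto
  have Eg: "(\<integral>w. g w \<partial>N) \<le> 1 + card U * C"
  proof -
    have pm: "integrable N (\<lambda>w. \<bar>X \<alpha> w\<bar> powr (D + \<epsilon>))" if "\<alpha> \<in> U" for \<alpha>
      using U that by (intro power_moment(1)) auto
    have "(\<integral>w. g w \<partial>N) = (\<integral>w. 1 \<partial>N) + (\<integral>w. (\<Sum>\<alpha>\<in>U. \<bar>X \<alpha> w\<bar> powr (D + \<epsilon>)) \<partial>N)"
      unfolding g_def by (intro Bochner_Integration.integral_add integrable_const
        Bochner_Integration.integrable_sum pm)
    also have "(\<integral>w. (\<Sum>\<alpha>\<in>U. \<bar>X \<alpha> w\<bar> powr (D + \<epsilon>)) \<partial>N) = (\<Sum>\<alpha>\<in>U. \<integral>w. \<bar>X \<alpha> w\<bar> powr (D + \<epsilon>) \<partial>N)"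
      by (rule Bochner_Integration.integral_sum[OF pm])
    also have "(\<integral>w. 1 \<partial>N) = (1 :: real)" by (simp add: prob_space)
    finally have "(\<integral>w. g w \<partial>N) = 1 + (\<Sum>\<alpha>\<in>U. \<integral>w. \<bar>X \<alpha> w\<bar> powr (D + \<epsilon>) \<partial>N)" .
    also have "\<dots> \<le> 1 + (\<Sum>\<alpha>\<in>U. C)"
      using U power_moment(2) by (intro add_left_mono sum_mono) auto
    finally show ?thesis by simp
  qed
  have le: "\<bar>\<Prod>\<alpha>\<in>U. X \<alpha> w ^ e \<alpha>\<bar> \<le> g w" for w
    using monomial_le_one_plus[OF fin, of "\<lambda>\<alpha>. \<bar>X \<alpha> w\<bar>" e D \<epsilon>] e \<epsilon>
    by (simp add: g_def abs_prod power_abs)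
  have meas: "(\<lambda>w. \<Prod>\<alpha>\<in>U. X \<alpha> w ^ e \<alpha>) \<in> borel_measurable N"
    using U by (intro borel_measurable_prod borel_measurable_power X_measurable) auto
  show int: "integrable N (\<lambda>w. \<Prod>\<alpha>\<in>U. X \<alpha> w ^ e \<alpha>)"
  proof (rule Bochner_Integration.integrable_bound[OF g meas], rule AE_I2)
    fix w show "norm (\<Prod>\<alpha>\<in>U. X \<alpha> w ^ e \<alpha>) \<le> norm (g w)"
      unfolding real_norm_def by (rule order_trans[OF le abs_ge_self])
  qed
  have "\<bar>\<integral>w. (\<Prod>\<alpha>\<in>U. X \<alpha> w ^ e \<alpha>) \<partial>N\<bar> \<le> (\<integral>w. \<bar>\<Prod>\<alpha>\<in>U. X \<alpha> w ^ e \<alpha>\<bar> \<partial>N)"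
    by (rule integral_abs_bound)
  also have "\<dots> \<le> (\<integral>w. g w \<partial>N)"
    by (rule integral_mono[OF integrable_abs[OF int] g le])
  finally show "\<bar>\<integral>w. (\<Prod>\<alpha>\<in>U. X \<alpha> w ^ e \<alpha>) \<partial>N\<bar> \<le> 1 + card U * C"
    using Eg by linarith
qed

definition sq_moment :: "nat set \<Rightarrow> real" where
  "sq_moment U = (\<integral>w. (\<Prod>\<alpha>\<in>U. (X \<alpha> w)\<^sup>2) \<partial>N)"

lemma sq_moment_cong_card:
  assumes U: "U \<subseteq> {1..n}" and V: "V \<subseteq> {1..n}" and card: "card U = card V"
  shows "sq_moment U = sq_moment V"
proof -
  obtain \<sigma> where \<sigma>: "\<sigma> permutes {1..n}" "\<sigma> ` U = V"
    using permutes_mapping_subset[OF _ U V card] by auto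
  have h: "(\<lambda>x. \<Prod>\<alpha>\<in>U. (x \<alpha>)\<^sup>2) \<in> borel_measurable (Pi\<^sub>M {1..n} (\<lambda>_. borel :: real measure))"
    using U by (intro borel_measurable_prod borel_measurable_power measurable_component_singleton) auto
  have inj: "inj_on \<sigma> U"
    using permutes_inj[OF \<sigma>(1)] by (rule inj_on_subset) simp
  have "sq_moment V = (\<integral>w. (\<Prod>\<alpha>\<in>U. (X (\<sigma> \<alpha>) w)\<^sup>2) \<partial>N)"
    unfolding sq_moment_def \<sigma>(2)[symmetric] by (simp add: prod.reindex[OF inj])
  also have "\<dots> = (\<integral>w. (\<Prod>\<alpha>\<in>U. ((\<lambda>i\<in>{1..n}. X (\<sigma> i) w) \<alpha>)\<^sup>2) \<partial>N)"
    using U by (intro Bochner_Integration.integral_cong refl prod.cong) auto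
  also have "\<dots> = (\<integral>w. (\<Prod>\<alpha>\<in>U. ((\<lambda>i\<in>{1..n}. X i w) \<alpha>)\<^sup>2) \<partial>N)"
    by (rule exchangeable_integral[OF rv ex \<sigma>(1) h])
  also have "\<dots> = sq_moment U"
    unfolding sq_moment_def using U by (intro Bochner_Integration.integral_cong refl prod.cong) auto
  finally show ?thesis ..
qed

end

section \<open>Square moments and the empirical second moment\<close>

context exchangeable_moments
begin

text \<open>Bounds all monomial moments of degree at most D in at most D variables, uniformly in
  n.\<close>

definition B :: real where "B = 1 + D * C"

lemma B_ge: "1 \<le> B" using C by (simp add: B_def)

lemma monomial_moment_le:
  assumes "U \<subseteq> {1..n}" "sum e U \<le> D" "card U \<le> D"
  shows "\<bar>\<integral>w. (\<Prod>\<alpha>\<in>U. X \<alpha> w ^ e \<alpha>) \<partial>N\<bar> \<le> B"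
proof -
  have "real (card U) * C \<le> D * C"
    using assms(3) C by (intro mult_right_mono) auto
  then show ?thesis using monomial_moment(2)[OF assms(1,2)] by (simp add: B_def)
qed

lemma sq_moment_integrable:
  assumes "U \<subseteq> {1..n}" "2 * card U \<le> D"
  shows "integrable N (\<lambda>w. \<Prod>\<alpha>\<in>U. (X \<alpha> w)\<^sup>2)"
  using monomial_moment(1)[OF assms(1), of "\<lambda>_. 2"] assms by (simp add: mult.commute)

lemma sq_moment_nonneg: "0 \<le> sq_moment U"
  unfolding sq_moment_def by (intro integral_nonneg_AE AE_I2 prod_nonneg) simp

lemma sq_moment_le:
  assumes "U \<subseteq> {1..n}" "2 * card U \<le> D"
  shows "sq_moment U \<le> B"
  using monomial_moment_le[OF assms(1), of "\<lambda>_. 2"] assms by (simp add: mult.commute sq_moment_def)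

text \<open>The exponents in the product of the squares over A times the square of coordinate j. If
  j lies in A its exponent is 4, and both cases are treated as one monomial.\<close>

definition dbl :: "nat set \<Rightarrow> nat \<Rightarrow> nat \<Rightarrow> nat" where
  "dbl A j \<alpha> = (if \<alpha> \<in> A then 2 else 0) + (if \<alpha> = j then 2 else 0)"

lemma prod_dbl:
  fixes y :: "nat \<Rightarrow> real"
  assumes "finite A"
  shows "(\<Prod>\<alpha>\<in>insert j A. y \<alpha> ^ dbl A j \<alpha>) = (\<Prod>\<alpha>\<in>A. (y \<alpha>)\<^sup>2) * (y j)\<^sup>2"
proof -
  have "(\<Prod>\<alpha>\<in>insert j A. y \<alpha> ^ dbl A j \<alpha>)
      = (\<Prod>\<alpha>\<in>insert j A. if \<alpha> \<in> A then (y \<alpha>)\<^sup>2 else 1) * (\<Prod>\<alpha>\<in>insert j A. if \<alpha> = j then (y \<alpha>)\<^sup>2 else 1)"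
    unfolding prod.distrib[symmetric] dbl_def power_add by (intro prod.cong refl) simp
  also have "(\<Prod>\<alpha>\<in>insert j A. if \<alpha> \<in> A then (y \<alpha>)\<^sup>2 else 1) = (\<Prod>\<alpha>\<in>A. (y \<alpha>)\<^sup>2)"
    using assms by (intro prod.mono_neutral_cong_right) auto
  also have "(\<Prod>\<alpha>\<in>insert j A. if \<alpha> = j then (y \<alpha>)\<^sup>2 else 1) = (y j)\<^sup>2"
    using assms by (subst prod.delta) auto
  finally show ?thesis .
qed

lemma sum_dbl: "finite A \<Longrightarrow> sum (dbl A j) (insert j A) = 2 * card A + 2"
proof -
  assume A: "finite A"
  have "sum (dbl A j) (insert j A) = (\<Sum>\<alpha>\<in>insert j A. if \<alpha> \<in> A then 2 else 0) + (\<Sum>\<alpha>\<in>insert j A. if \<alpha> = j then 2 else 0)"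
    unfolding dbl_def by (rule sum.distrib)
  also have "(\<Sum>\<alpha>\<in>insert j A. if \<alpha> \<in> A then 2 else 0) = (\<Sum>\<alpha>\<in>A. 2::nat)"
    using A by (intro sum.mono_neutral_cong_right) auto
  also have "(\<Sum>\<alpha>\<in>insert j A. if \<alpha> = j then 2 else 0) = (2::nat)"
    using A by (subst sum.delta) auto
  finally show ?thesis by simp
qed

lemma times_square_moment:
  assumes A: "A \<subseteq> {1..n}" and j: "j \<in> {1..n}" and D: "2 * card A + 2 \<le> D"
  shows "integrable N (\<lambda>w. (\<Prod>\<alpha>\<in>A. (X \<alpha> w)\<^sup>2) * (X j w)\<^sup>2)"
    and "\<bar>\<integral>w. (\<Prod>\<alpha>\<in>A. (X \<alpha> w)\<^sup>2) * (X j w)\<^sup>2 \<partial>N\<bar> \<le> B"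
    and "j \<notin> A \<Longrightarrow> (\<integral>w. (\<Prod>\<alpha>\<in>A. (X \<alpha> w)\<^sup>2) * (X j w)\<^sup>2 \<partial>N) = sq_moment (insert j A)"
proof -
  have fin: "finite A" using A finite_subset by blast
  have U: "insert j A \<subseteq> {1..n}" using A j by auto
  have s: "sum (dbl A j) (insert j A) \<le> D" using D by (simp add: sum_dbl[OF fin])
  have c: "card (insert j A) \<le> D" using D fin by (simp add: card_insert_if)
  note eq = prod_dbl[OF fin, of "\<lambda>\<alpha>. X \<alpha> w" j for w]
  show "integrable N (\<lambda>w. (\<Prod>\<alpha>\<in>A. (X \<alpha> w)\<^sup>2) * (X j w)\<^sup>2)"
    using monomial_moment(1)[OF U s] unfolding eq .
  show "\<bar>\<integral>w. (\<Prod>\<alpha>\<in>A. (X \<alpha> w)\<^sup>2) * (X j w)\<^sup>2 \<partial>N\<bar> \<le> B"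
    using monomial_moment_le[OF U s c] unfolding eq .
  show "(\<integral>w. (\<Prod>\<alpha>\<in>A. (X \<alpha> w)\<^sup>2) * (X j w)\<^sup>2 \<partial>N) = sq_moment (insert j A)" if "j \<notin> A"
    unfolding sq_moment_def using that fin by (simp add: mult.commute)
qed

text \<open>The empirical second moment: under the integral it may replace a single square outside
  the other factors, up to O(1/n).\<close>

definition S :: "'b \<Rightarrow> real" where "S w = (\<Sum>j\<in>{1..n}. (X j w)\<^sup>2) / n"

lemma square_integrable: "j \<in> {1..n} \<Longrightarrow> 2 \<le> D \<Longrightarrow> integrable N (\<lambda>w. (X j w)\<^sup>2)"
  using times_square_moment(1)[of "{}" j] by simp

text \<open>E S is the first square moment. In E S^2 the n diagonal pairs contribute at most B/n
  after division by n^2, and each other pair has the second square moment as its value.\<close>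

lemma mean_square_deviation:
  assumes D: "4 \<le> D" and n2: "2 \<le> n"
  shows "integrable N S" and "integrable N (\<lambda>w. (S w - 1)\<^sup>2)"
    and "(\<integral>w. (S w - 1)\<^sup>2 \<partial>N) \<le> B / n + sq_moment {1..2} - 2 * sq_moment {1..1} + 1"
proof -
  show S: "integrable N S"
    unfolding S_def[abs_def] using D
    by (intro Bochner_Integration.integrable_sum integrable_divide_zero square_integrable) auto
  have int: "integrable N (\<lambda>w. (X i w)\<^sup>2 * (X j w)\<^sup>2)" if "i \<in> {1..n}" "j \<in> {1..n}" for i j
    using times_square_moment(1)[of "{i}" j] that D by simp
  have S2: "(S w)\<^sup>2 = (\<Sum>i\<in>{1..n}. \<Sum>j\<in>{1..n}. (X i w)\<^sup>2 * (X j w)\<^sup>2) / (real n)\<^sup>2" for w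
    by (simp add: S_def power_divide power2_eq_square[of "sum _ _"] sum_product)
  have intS2: "integrable N (\<lambda>w. (S w)\<^sup>2)"
    unfolding S2 by (intro Bochner_Integration.integrable_sum integrable_divide_zero int) auto
  have sq: "(S w - 1)\<^sup>2 = (S w)\<^sup>2 - 2 * S w + 1" for w
    by (simp add: power2_eq_square algebra_simps)
  show "integrable N (\<lambda>w. (S w - 1)\<^sup>2)"
    unfolding sq using intS2 S by simp
  have ES: "(\<integral>w. S w \<partial>N) = sq_moment {1..1}"
  proof -
    have "(\<integral>w. S w \<partial>N) = (\<Sum>j\<in>{1..n}. \<integral>w. (X j w)\<^sup>2 \<partial>N) / n"
      unfolding S_def using D
      by (subst integral_divide_zero, subst Bochner_Integration.integral_sum) (auto intro: square_integrable)
    also have "(\<Sum>j\<in>{1..n}. \<integral>w. (X j w)\<^sup>2 \<partial>N) = (\<Sum>j\<in>{1..n}. sq_moment {1..1})"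
    proof (rule sum.cong[OF refl])
      fix j assume j: "j \<in> {1..n}"
      have "sq_moment {j} = sq_moment {1..1}" using j n by (intro sq_moment_cong_card) auto
      then show "(\<integral>w. (X j w)\<^sup>2 \<partial>N) = sq_moment {1..1}" by (simp add: sq_moment_def)
    qed
    finally show ?thesis using n by simp
  qed
  have ES2: "(\<integral>w. (S w)\<^sup>2 \<partial>N) \<le> B / n + sq_moment {1..2}"
  proof -
    have "(\<integral>w. (S w)\<^sup>2 \<partial>N) = (\<Sum>i\<in>{1..n}. \<Sum>j\<in>{1..n}. \<integral>w. (X i w)\<^sup>2 * (X j w)\<^sup>2 \<partial>N) / (real n)\<^sup>2"
    proof -
      have "(\<integral>w. (\<Sum>i\<in>{1..n}. \<Sum>j\<in>{1..n}. (X i w)\<^sup>2 * (X j w)\<^sup>2) \<partial>N)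
          = (\<Sum>i\<in>{1..n}. \<integral>w. (\<Sum>j\<in>{1..n}. (X i w)\<^sup>2 * (X j w)\<^sup>2) \<partial>N)"
        by (intro Bochner_Integration.integral_sum Bochner_Integration.integrable_sum int)
      also have "\<dots> = (\<Sum>i\<in>{1..n}. \<Sum>j\<in>{1..n}. \<integral>w. (X i w)\<^sup>2 * (X j w)\<^sup>2 \<partial>N)"
        by (intro sum.cong refl Bochner_Integration.integral_sum int)
      finally show ?thesis unfolding S2 by simp
    qed
    also have "\<dots> \<le> (\<Sum>i\<in>{1..n}. B + n * sq_moment {1..2}) / (real n)\<^sup>2"
    proof (intro divide_right_mono sum_mono)
      fix i assume i: "i \<in> {1..n}"
      have "(\<Sum>j\<in>{1..n}. \<integral>w. (X i w)\<^sup>2 * (X j w)\<^sup>2 \<partial>N) \<le> (\<Sum>j\<in>{1..n}. (if j = i then B else 0) + sq_moment {1..2})"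
      proof (rule sum_mono)
        fix j assume j: "j \<in> {1..n}"
        show "(\<integral>w. (X i w)\<^sup>2 * (X j w)\<^sup>2 \<partial>N) \<le> (if j = i then B else 0) + sq_moment {1..2}"
        proof (cases "j = i")
          case True
          then show ?thesis
            using times_square_moment(2)[of "{i}" j] i j D sq_moment_nonneg[of "{1..2}"] by simp
        next
          case False
          have "sq_moment (insert j {i}) = sq_moment {1..2}"
            using i j n2 False by (intro sq_moment_cong_card) auto
          then show ?thesis
            using times_square_moment(3)[of "{i}" j] i j D False by simp
        qed
      qed
      also have "\<dots> = B + n * sq_moment {1..2}"
        using i by (simp add: sum.distrib)
      finally show "(\<Sum>j\<in>{1..n}. \<integral>w. (X i w)\<^sup>2 * (X j w)\<^sup>2 \<partial>N) \<le> B + n * sq_moment {1..2}" .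
    qed simp
    also have "\<dots> = B / n + sq_moment {1..2}"
      using n by (simp add: field_simps power2_eq_square)
    finally show ?thesis .
  qed
  have "(\<integral>w. (S w - 1)\<^sup>2 \<partial>N) = (\<integral>w. (S w)\<^sup>2 \<partial>N) - 2 * (\<integral>w. S w \<partial>N) + 1"
    unfolding sq using intS2 S by (simp add: prob_space)
  then show "(\<integral>w. (S w - 1)\<^sup>2 \<partial>N) \<le> B / n + sq_moment {1..2} - 2 * sq_moment {1..1} + 1"
    using ES ES2 by simp
qed

text \<open>Follows from |y| \<le> \<delta> + y^2 / \<delta>. The parameter \<delta> stays free
  because it must later be chosen after the truncation level M.\<close>

lemma mean_abs_deviation:
  assumes "4 \<le> D" "2 \<le> n" and \<delta>: "\<delta> > 0"
  shows "(\<integral>w. \<bar>S w - 1\<bar> \<partial>N) \<le> \<delta> + (B / n + sq_moment {1..2} - 2 * sq_moment {1..1} + 1) / \<delta>"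
proof -
  note ms = mean_square_deviation[OF assms(1,2)]
  have "\<bar>S w - 1\<bar> \<le> \<delta> + (S w - 1)\<^sup>2 / \<delta>" for w
  proof (cases "\<bar>S w - 1\<bar> \<le> \<delta>")
    case True
    moreover have "0 \<le> (S w - 1)\<^sup>2 / \<delta>" using \<delta> by simp
    ultimately show ?thesis by linarith
  next
    case False
    then have "\<bar>S w - 1\<bar> * \<delta> \<le> \<bar>S w - 1\<bar> * \<bar>S w - 1\<bar>" by (intro mult_left_mono) auto
    then have "\<bar>S w - 1\<bar> \<le> (S w - 1)\<^sup>2 / \<delta>"
      using \<delta> by (simp add: le_divide_eq power2_eq_square)
    then show ?thesis using \<delta> by linarith
  qed
  then have "(\<integral>w. \<bar>S w - 1\<bar> \<partial>N) \<le> (\<integral>w. \<delta> + (S w - 1)\<^sup>2 / \<delta> \<partial>N)"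
    using ms(1,2) by (intro integral_mono) auto
  also have "\<dots> = \<delta> + (\<integral>w. (S w - 1)\<^sup>2 \<partial>N) / \<delta>"
    using ms(2) by (simp add: prob_space)
  also have "\<dots> \<le> \<delta> + (B / n + sq_moment {1..2} - 2 * sq_moment {1..1} + 1) / \<delta>"
    using ms(3) \<delta> by (intro add_left_mono divide_right_mono) auto
  finally show ?thesis .
qed

text \<open>With Z the product of the first k - 1 squares, E(Z X_j^2) is the k-th square moment for
  every j beyond k - 1, so E(Z S) equals it up to k - 1 exceptional terms. Then Z S is compared with
  Z: through |S - 1| where the factors of Z stay below M, and through the moment of order D +
  \<epsilon> elsewhere.\<close>

lemma sq_moment_step:
  assumes k: "1 \<le> k" "k \<le> n" "2 * k \<le> D" and D: "4 \<le> D" and n2: "2 \<le> n"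
    and M: "1 \<le> M" and \<delta>: "\<delta> > 0"
  shows "\<bar>sq_moment {1..k} - sq_moment {1..k - 1}\<bar> \<le> 2 * k * B / n
     + (M ^ D * (\<delta> + (B / n + sq_moment {1..2} - 2 * sq_moment {1..1} + 1) / \<delta>) + M powr (- \<epsilon>) * (2 * k * C))"
proof -
  define A where "A = {1..k - 1}"
  have A: "A \<subseteq> {1..n}" "finite A" "card A = k - 1" using k by (auto simp: A_def)
  have D2: "2 * card A + 2 \<le> D" using k A(3) by simp
  define Z where "Z w = (\<Prod>\<alpha>\<in>A. (X \<alpha> w)\<^sup>2)" for w
  define W where "W \<alpha> w = \<bar>X \<alpha> w\<bar> powr (D + \<epsilon>)" for \<alpha> w
  have Z0: "0 \<le> Z w" for w unfolding Z_def by (intro prod_nonneg) simp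
  have zy_int: "integrable N (\<lambda>w. Z w * (X j w)\<^sup>2)" if "j \<in> {1..n}" for j
    unfolding Z_def by (rule times_square_moment(1)[OF A(1) that D2])
  have ZS: "Z w * S w = (\<Sum>j\<in>{1..n}. Z w * (X j w)\<^sup>2) / n" for w
    by (simp add: S_def sum_distrib_left)
  have ZS_int: "integrable N (\<lambda>w. Z w * S w)"
    unfolding ZS by (intro integrable_divide_zero Bochner_Integration.integrable_sum zy_int) auto
  have Z_int: "integrable N Z"
    unfolding Z_def[abs_def] using sq_moment_integrable[OF A(1)] D2 by simp
  have EZ: "integral\<^sup>L N Z = sq_moment {1..k - 1}" by (simp add: Z_def[abs_def] sq_moment_def A_def)
  have EZS: "(\<integral>w. Z w * S w \<partial>N) = (\<Sum>j\<in>{1..n}. \<integral>w. Z w * (X j w)\<^sup>2 \<partial>N) / n"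
    unfolding ZS by (subst integral_divide_zero, subst Bochner_Integration.integral_sum) (auto intro: zy_int)
  have n0: "real n > 0" using n by simp
  have first: "\<bar>sq_moment {1..k} - (\<integral>w. Z w * S w \<partial>N)\<bar> \<le> 2 * k * B / n"
  proof -
    have "sq_moment {1..k} - (\<integral>w. Z w * S w \<partial>N) = (\<Sum>j\<in>{1..n}. sq_moment {1..k} - (\<integral>w. Z w * (X j w)\<^sup>2 \<partial>N)) / n"
      unfolding EZS sum_subtractf using n0 by (simp add: diff_divide_distrib)
    moreover have "\<bar>\<Sum>j\<in>{1..n}. sq_moment {1..k} - (\<integral>w. Z w * (X j w)\<^sup>2 \<partial>N)\<bar> \<le> 2 * k * B"
    proof -
      have "\<bar>sq_moment {1..k} - (\<integral>w. Z w * (X j w)\<^sup>2 \<partial>N)\<bar> \<le> (if j \<in> A then 2 * B else 0)" if j: "j \<in> {1..n}" for j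
      proof (cases "j \<in> A")
        case True
        have "\<bar>\<integral>w. Z w * (X j w)\<^sup>2 \<partial>N\<bar> \<le> B"
          unfolding Z_def by (rule times_square_moment(2)[OF A(1) j D2])
        moreover have "sq_moment {1..k} \<le> B" using k by (intro sq_moment_le) auto
        ultimately show ?thesis using True sq_moment_nonneg[of "{1..k}"] by (simp add: abs_le_iff)
      next
        case False
        have "sq_moment (insert j A) = sq_moment {1..k}"
          using j A k False by (intro sq_moment_cong_card) auto
        moreover have "(\<integral>w. Z w * (X j w)\<^sup>2 \<partial>N) = sq_moment (insert j A)"
          unfolding Z_def by (rule times_square_moment(3)[OF A(1) j D2 False])
        ultimately show ?thesis using False by simp
      qed
      then have "\<bar>\<Sum>j\<in>{1..n}. sq_moment {1..k} - (\<integral>w. Z w * (X j w)\<^sup>2 \<partial>N)\<bar> \<le> (\<Sum>j\<in>{1..n}. if j \<in> A then 2 * B else 0)"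
        by (intro order_trans[OF sum_abs] sum_mono)
      also have "\<dots> = (\<Sum>j\<in>A. 2 * B)"
        using A by (intro sum.mono_neutral_cong_right) auto
      also have "\<dots> \<le> 2 * k * B"
        using A(3) k B_ge by simp
      finally show ?thesis .
    qed
    ultimately show ?thesis using n0 by (simp add: divide_right_mono)
  qed
  \<comment> \<open>Dominates Z S + Z as soon as some factor of Z exceeds M. The single sum and the
    averaged double sum each have expectation at most k C, whence 2 k C.\<close>
  define T where "T w = M powr (- \<epsilon>) * ((\<Sum>\<alpha>\<in>A. W \<alpha> w) + (\<Sum>j\<in>{1..n}. \<Sum>\<alpha>\<in>insert j A. W \<alpha> w) / n)" for w
  have W0: "0 \<le> W \<alpha> w" for \<alpha> w by (simp add: W_def)
  have W_int: "integrable N (W \<alpha>)" and EW: "integral\<^sup>L N (W \<alpha>) \<le> C" if "\<alpha> \<in> {1..n}" for \<alpha>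
    using power_moment[OF that] by (simp_all add: W_def[abs_def])
  have Wsum_int: "integrable N (\<lambda>w. \<Sum>\<alpha>\<in>U. W \<alpha> w)" if "U \<subseteq> {1..n}" for U
    using that by (intro Bochner_Integration.integrable_sum W_int) auto
  have Wsum: "(\<integral>w. (\<Sum>\<alpha>\<in>U. W \<alpha> w) \<partial>N) \<le> card U * C" if "U \<subseteq> {1..n}" for U
  proof -
    have "(\<integral>w. (\<Sum>\<alpha>\<in>U. W \<alpha> w) \<partial>N) = (\<Sum>\<alpha>\<in>U. integral\<^sup>L N (W \<alpha>))"
      using that by (intro Bochner_Integration.integral_sum W_int) auto
    also have "\<dots> \<le> card U * C" using that EW by (intro sum_bounded_above) auto
    finally show ?thesis .
  qed
  have iA: "insert j A \<subseteq> {1..n}" if "j \<in> {1..n}" for j using A that by auto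
  have dblsum_int: "integrable N (\<lambda>w. \<Sum>j\<in>{1..n}. \<Sum>\<alpha>\<in>insert j A. W \<alpha> w)"
    by (intro Bochner_Integration.integrable_sum[of "{1..n}"] Wsum_int iA)
  have T_int: "integrable N T"
    unfolding T_def[abs_def] using dblsum_int Wsum_int[OF A(1)] by simp
  have ET: "integral\<^sup>L N T \<le> M powr (- \<epsilon>) * (2 * k * C)"
  proof -
    have "(\<integral>w. (\<Sum>j\<in>{1..n}. \<Sum>\<alpha>\<in>insert j A. W \<alpha> w) \<partial>N) = (\<Sum>j\<in>{1..n}. \<integral>w. (\<Sum>\<alpha>\<in>insert j A. W \<alpha> w) \<partial>N)"
      by (intro Bochner_Integration.integral_sum Wsum_int iA)
    also have "\<dots> \<le> (\<Sum>j\<in>{1..n}. k * C)"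
    proof (rule sum_mono)
      fix j assume j: "j \<in> {1..n}"
      have "card (insert j A) \<le> k" using A k by (simp add: card_insert_if)
      then have "card (insert j A) * C \<le> k * C" using C by (intro mult_right_mono) auto
      with Wsum[OF iA[OF j]] show "(\<integral>w. (\<Sum>\<alpha>\<in>insert j A. W \<alpha> w) \<partial>N) \<le> k * C" by linarith
    qed
    finally have "(\<integral>w. (\<Sum>j\<in>{1..n}. \<Sum>\<alpha>\<in>insert j A. W \<alpha> w) \<partial>N) / n \<le> k * C"
      using n0 by (simp add: divide_le_eq mult.commute)
    moreover have "(\<integral>w. (\<Sum>\<alpha>\<in>A. W \<alpha> w) \<partial>N) \<le> k * C"
    proof -
      have "card A * C \<le> k * C" using C A(3) by (intro mult_right_mono) auto
      with Wsum[OF A(1)] show ?thesis by linarith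
    qed
    moreover have "integral\<^sup>L N T = M powr (- \<epsilon>) * ((\<integral>w. (\<Sum>\<alpha>\<in>A. W \<alpha> w) \<partial>N)
        + (\<integral>w. (\<Sum>j\<in>{1..n}. \<Sum>\<alpha>\<in>insert j A. W \<alpha> w) \<partial>N) / n)"
      unfolding T_def[abs_def] using dblsum_int Wsum_int[OF A(1)]
      by (simp only: integral_mult_right_zero integral_divide_zero Bochner_Integration.integral_add integrable_divide_zero)
    ultimately show ?thesis by (simp add: mult_left_mono)
  qed
  have pointwise: "\<bar>Z w * S w - Z w\<bar> \<le> M ^ D * \<bar>S w - 1\<bar> + T w" for w
  proof -
    have T0: "0 \<le> T w" unfolding T_def
      by (intro mult_nonneg_nonneg add_nonneg_nonneg divide_nonneg_nonneg sum_nonneg W0) auto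
    have S0: "0 \<le> S w" by (simp add: S_def sum_nonneg)
    have eq: "\<bar>Z w * S w - Z w\<bar> = Z w * \<bar>S w - 1\<bar>"
      using Z0[of w] by (simp add: right_diff_distrib[of "Z w" "S w" 1, simplified, symmetric] abs_mult)
    show ?thesis
    proof (cases "\<exists>\<alpha>\<in>A. M < \<bar>X \<alpha> w\<bar>")
      case False
      then have "(\<Prod>\<alpha>\<in>A. \<bar>X \<alpha> w\<bar> ^ 2) \<le> M ^ D"
        using D2 by (intro monomial_le_power[OF A(2) _ _ M]) (auto simp: not_less)
      then have "Z w \<le> M ^ D" by (simp add: Z_def)
      then have "Z w * \<bar>S w - 1\<bar> \<le> M ^ D * \<bar>S w - 1\<bar>" by (intro mult_right_mono) auto
      then show ?thesis using T0 eq by linarith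
    next
      case True
      have "(\<Prod>\<alpha>\<in>A. \<bar>X \<alpha> w\<bar> ^ 2) \<le> M powr (- \<epsilon>) * (\<Sum>\<alpha>\<in>A. \<bar>X \<alpha> w\<bar> powr (D + \<epsilon>))"
        using D2 \<epsilon> by (intro monomial_le_powr_sum[OF A(2) _ M True]) auto
      then have 1: "Z w \<le> M powr (- \<epsilon>) * (\<Sum>\<alpha>\<in>A. W \<alpha> w)" by (simp add: Z_def W_def)
      \<comment> \<open>Truncation is decided by the indices in A alone, so the coordinate j may
        have any size here; the bound uses the large factor from A and the total degree 2k \<le>
        D.\<close>
      have 2: "Z w * (X j w)\<^sup>2 \<le> M powr (- \<epsilon>) * (\<Sum>\<alpha>\<in>insert j A. W \<alpha> w)" for j
      proof -
        have "(\<Prod>\<alpha>\<in>insert j A. \<bar>X \<alpha> w\<bar> ^ dbl A j \<alpha>)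
            \<le> M powr (- \<epsilon>) * (\<Sum>\<alpha>\<in>insert j A. \<bar>X \<alpha> w\<bar> powr (D + \<epsilon>))"
        proof (rule monomial_le_powr_sum)
          show "\<exists>a\<in>insert j A. M < \<bar>X a w\<bar>" using True by blast
          show "sum (dbl A j) (insert j A) \<le> D" using D2 by (simp add: sum_dbl[OF A(2)])
        qed (use A(2) M \<epsilon> in simp_all)
        then show ?thesis
          unfolding prod_dbl[OF A(2), of "\<lambda>\<alpha>. \<bar>X \<alpha> w\<bar>" j] by (simp add: Z_def W_def)
      qed
      have "Z w * S w \<le> (\<Sum>j\<in>{1..n}. M powr (- \<epsilon>) * (\<Sum>\<alpha>\<in>insert j A. W \<alpha> w)) / n"
        unfolding ZS by (intro divide_right_mono sum_mono 2) simp
      then have "Z w * S w + Z w \<le> T w"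
        using 1 by (simp add: T_def sum_distrib_left[symmetric] distrib_left)
      moreover have "\<bar>Z w * S w - Z w\<bar> \<le> Z w * S w + Z w"
        using Z0[of w] S0 mult_nonneg_nonneg[of "Z w" "S w"] by (simp add: abs_le_iff)
      moreover have "0 \<le> M ^ D * \<bar>S w - 1\<bar>" using M by simp
      ultimately show ?thesis by linarith
    qed
  qed
  have S_int: "integrable N S" by (rule mean_square_deviation(1)[OF D n2])
  have "\<bar>(\<integral>w. Z w * S w \<partial>N) - sq_moment {1..k - 1}\<bar> = \<bar>\<integral>w. Z w * S w - Z w \<partial>N\<bar>"
    unfolding EZ[symmetric] using ZS_int Z_int by simp
  also have "\<dots> \<le> (\<integral>w. \<bar>Z w * S w - Z w\<bar> \<partial>N)" by (rule integral_abs_bound)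
  also have "\<dots> \<le> (\<integral>w. M ^ D * \<bar>S w - 1\<bar> + T w \<partial>N)"
    using ZS_int Z_int T_int S_int by (intro integral_mono pointwise) auto
  also have "\<dots> = M ^ D * (\<integral>w. \<bar>S w - 1\<bar> \<partial>N) + integral\<^sup>L N T"
    using T_int S_int by simp
  also have "\<dots> \<le> M ^ D * (\<delta> + (B / n + sq_moment {1..2} - 2 * sq_moment {1..1} + 1) / \<delta>) + M powr (- \<epsilon>) * (2 * k * C)"
    using M by (intro add_mono mult_left_mono mean_abs_deviation[OF D n2 \<delta>] ET) auto
  finally show ?thesis using first by linarith
qed

end

text \<open>The total degree is 4r + 2(2d - 2r) = 4d for every r, exactly the degree up to which
  moments are bounded.\<close>

lemma (in exchangeable_moments) mixed_moment_le:
  assumes D: "D = 4 * d" and n: "2 * d \<le> n" and r: "r \<le> d"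
  shows "(\<integral>w. (\<Prod>i\<in>{1..r}. (X i w) ^ 4) * (\<Prod>i\<in>{r+1..2*d-r}. (X i w)\<^sup>2) \<partial>N) \<le> B"
proof -
  define U V where "U = {1..r}" and "V = {r+1..2*d-r}"
  define f :: "nat \<Rightarrow> nat" where "f \<alpha> = (if \<alpha> \<le> r then 4 else 2)" for \<alpha>
  have UV: "finite U" "finite V" "U \<inter> V = {}" by (auto simp: U_def V_def)
  have card: "card U = r" "card V = 2 * d - 2 * r" by (simp_all add: U_def V_def)
  have sub: "U \<union> V \<subseteq> {1..n}" using n r by (auto simp: U_def V_def)
  have "sum f U = (\<Sum>\<alpha>\<in>U. 4)" "sum f V = (\<Sum>\<alpha>\<in>V. 2)"
    by (auto intro!: sum.cong simp: f_def U_def V_def)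
  then have s: "sum f (U \<union> V) \<le> D"
    using r by (simp add: sum.union_disjoint[OF UV] card D)
  have c: "card (U \<union> V) \<le> D"
    using r by (simp add: card_Un_disjoint[OF UV] card D)
  have "(\<Prod>\<alpha>\<in>U. X \<alpha> w ^ f \<alpha>) = (\<Prod>i\<in>U. (X i w) ^ 4)" "(\<Prod>\<alpha>\<in>V. X \<alpha> w ^ f \<alpha>) = (\<Prod>i\<in>V. (X i w)\<^sup>2)" for w
    by (auto intro!: prod.cong simp: f_def U_def V_def)
  then have eq: "(\<Prod>\<alpha>\<in>U \<union> V. X \<alpha> w ^ f \<alpha>) = (\<Prod>i\<in>U. (X i w) ^ 4) * (\<Prod>i\<in>V. (X i w)\<^sup>2)" for w
    by (simp only: prod.union_disjoint[OF UV])
  have "(\<integral>w. (\<Prod>\<alpha>\<in>U \<union> V. X \<alpha> w ^ f \<alpha>) \<partial>N) \<le> B"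
    using monomial_moment_le[OF sub s c] by (rule abs_le_D1)
  then show ?thesis unfolding eq unfolding U_def V_def .
qed

text \<open>Induction on k by the one-step estimate, whose variance term tends to 1 - 2 + 1 = 0 by
  the two assumed limits.\<close>

lemma square_moments_tendsto:
  fixes N :: "nat \<Rightarrow> 'b measure" and X :: "nat \<Rightarrow> nat \<Rightarrow> 'b \<Rightarrow> real"
  defines "E \<equiv> \<lambda>n U. \<integral>w. (\<Prod>\<alpha>\<in>U. (X n \<alpha> w)\<^sup>2) \<partial>N n"
  assumes em: "\<And>n. 1 \<le> n \<Longrightarrow> exchangeable_moments n (N n) (X n) D \<epsilon> C"
    and D: "4 \<le> D" and E1: "(\<lambda>n. E n {1..1}) \<longlonglongrightarrow> 1" and E2: "(\<lambda>n. E n {1..2}) \<longlonglongrightarrow> 1"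
    and k: "2 * k \<le> D"
  shows "(\<lambda>n. E n {1..k}) \<longlonglongrightarrow> 1"
  using k
proof (induction k)
  case 0
  have "E n {1..0} = 1" if "1 \<le> n" for n
  proof -
    interpret exchangeable_moments n "N n" "X n" D \<epsilon> C by (rule em[OF that])
    show ?thesis by (simp add: E_def prob_space)
  qed
  then have "\<forall>\<^sub>F n in sequentially. E n {1..0} = 1"
    by (rule eventually_sequentiallyI)
  then show ?case by (rule tendsto_eventually)
next
  case (Suc k)
  define K where "K = Suc k"
  define b0 where "b0 = 1 + real D * C"
  have \<epsilon>: "0 < \<epsilon>" using exchangeable_moments.\<epsilon>[OF em[OF order_refl]] .
  have step: "\<bar>E n {1..K} - E n {1..k}\<bar> \<le> 2 * K * b0 / n
     + (M ^ D * (\<delta> + (b0 / n + E n {1..2} - 2 * E n {1..1} + 1) / \<delta>) + M powr (- \<epsilon>) * (2 * K * C))"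
    if "K \<le> n" "2 \<le> n" "1 \<le> M" "\<delta> > 0" for n M \<delta>
  proof -
    interpret exchangeable_moments n "N n" "X n" D \<epsilon> C using that by (intro em) simp
    show ?thesis
      using sq_moment_step[of K M \<delta>] that Suc.prems D unfolding sq_moment_def E_def B_def b0_def by (simp add: K_def)
  qed
  have "(\<lambda>n. E n {1..K} - E n {1..k}) \<longlonglongrightarrow> 0"
  proof (rule tendstoI)
    fix r :: real assume r: "r > 0"
    have "((\<lambda>M. M powr (- \<epsilon>) * (2 * K * C)) \<longlongrightarrow> 0 * (2 * K * C)) at_top"
      by (intro tendsto_mult tendsto_const tendsto_neg_powr filterlim_ident) (use \<epsilon> in simp)
    then have "\<forall>\<^sub>F M in at_top. M powr (- \<epsilon>) * (2 * K * C) < r / 3"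
      using r by (intro order_tendstoD(2)[where y=0]) auto
    then have "\<forall>\<^sub>F M in at_top. M powr (- \<epsilon>) * (2 * K * C) < r / 3 \<and> 1 \<le> M"
      using eventually_ge_at_top[of 1] by (rule eventually_conj)
    \<comment> \<open>M is fixed first to make the tail small, then \<delta> is scaled by M^D, and
      only then n tends to infinity.\<close>
    then obtain M where M: "M powr (- \<epsilon>) * (2 * K * C) < r / 3" "1 \<le> M"
      using eventually_happens'[OF trivial_limit_at_top_linorder] by blast
    define \<delta> where "\<delta> = r / 3 / M ^ D"
    have MD: "M ^ D > 0" using M(2) by simp
    have \<delta>: "\<delta> > 0" using r MD by (simp add: \<delta>_def)
    define b where "b n = 2 * K * b0 / real n
     + (M ^ D * (\<delta> + (b0 / real n + E n {1..2} - 2 * E n {1..1} + 1) / \<delta>) + M powr (- \<epsilon>) * (2 * K * C))" for n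
    have "b \<longlonglongrightarrow> 0 + (M ^ D * (\<delta> + (0 + 1 - 2 * 1 + 1) / \<delta>) + M powr (- \<epsilon>) * (2 * K * C))"
      unfolding b_def[abs_def] using \<delta> by (intro tendsto_intros E1 E2 lim_const_over_n) auto
    moreover have "0 + (M ^ D * (\<delta> + (0 + 1 - 2 * 1 + 1) / \<delta>) + M powr (- \<epsilon>) * (2 * K * C)) < r"
      using M MD r by (simp add: \<delta>_def)
    ultimately have "\<forall>\<^sub>F n in sequentially. b n < r"
      by (rule order_tendstoD(2))
    then show "\<forall>\<^sub>F n in sequentially. dist (E n {1..K} - E n {1..k}) 0 < r"
      using eventually_ge_at_top[of "max K 2"]
    proof eventually_elim
      case (elim n)
      then have "\<bar>E n {1..K} - E n {1..k}\<bar> \<le> b n"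
        unfolding b_def using M(2) \<delta> by (intro step) auto
      then show ?case using elim by (simp add: dist_real_def)
    qed
  qed
  moreover have "(\<lambda>n. E n {1..k}) \<longlonglongrightarrow> 1" using Suc by simp
  ultimately have "(\<lambda>n. (E n {1..K} - E n {1..k}) + E n {1..k}) \<longlonglongrightarrow> 0 + 1"
    by (rule tendsto_add)
  then show ?case by (simp add: K_def)
qed

section \<open>Quadratic forms of tensor vectors\<close>

lemma rademacher_odd_moment: "odd k \<Longrightarrow> (\<integral>x. x ^ k \<partial>rademacher) = 0"
  unfolding rademacher_def by (subst integral_pmf_of_set) auto

lemma integral_product_measure:
  fixes f g :: "_ \<Rightarrow> real"
  assumes "sigma_finite_measure M1" "sigma_finite_measure M2" "integrable M1 f" "integrable M2 g"
  shows "(\<integral>p. f (fst p) * g (snd p) \<partial>(M1 \<Otimes>\<^sub>M M2)) = integral\<^sup>L M1 f * integral\<^sup>L M2 g"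
proof -
  interpret A: sigma_finite_measure M1 by fact
  interpret B: sigma_finite_measure M2 by fact
  interpret pair_sigma_finite M1 M2 ..
  note [measurable] = borel_measurable_integrable[OF assms(3)] borel_measurable_integrable[OF assms(4)]
  have "integrable (M1 \<Otimes>\<^sub>M M2) (\<lambda>p. f (fst p) * g (snd p))"
  proof (rule Fubini_integrable)
    show "integrable M1 (\<lambda>x. \<integral>y. norm (f (fst (x, y)) * g (snd (x, y))) \<partial>M2)"
      using assms(3,4) by (simp add: abs_mult)
    show "AE x in M1. integrable M2 (\<lambda>y. f (fst (x, y)) * g (snd (x, y)))"
      using assms(4) by simp
  qed measurable
  from integral_fst'[OF this] show ?thesis by simp
qed

text \<open>Under the law with random signs the integral factors into a sign part and a moment of X,
  and the sign part contains an odd Rademacher moment.\<close>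

lemma unconditional_odd_moment:
  assumes rv: "random_vector n N X" and un: "unconditional n N X"
    and U: "U \<subseteq> {1..n}" and int: "integrable N (\<lambda>w. \<Prod>\<alpha>\<in>U. X \<alpha> w ^ e \<alpha>)"
    and \<beta>: "\<beta> \<in> U" "odd (e \<beta>)"
  shows "(\<integral>w. (\<Prod>\<alpha>\<in>U. X \<alpha> w ^ e \<alpha>) \<partial>N) = 0"
proof -
  have fin: "finite U" using U finite_subset by blast
  interpret N: prob_space N using rv by (simp add: random_vector_def)
  interpret R: prob_space rademacher unfolding rademacher_def by (rule prob_space_measure_pmf)
  interpret product_sigma_finite "\<lambda>_::nat. rademacher"
    by (simp add: product_sigma_finite_def R.sigma_finite_measure_axioms)
  interpret PR: prob_space "Pi\<^sub>M {1..n} (\<lambda>_. rademacher)"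
    by (rule prob_space_PiM) (rule R.prob_space_axioms)
  define h where "h x = (\<Prod>\<alpha>\<in>U. x \<alpha> ^ e \<alpha>)" for x :: "nat \<Rightarrow> real"
  have h: "h \<in> borel_measurable (Pi\<^sub>M {1..n} (\<lambda>_. borel))"
    unfolding h_def using U by (intro borel_measurable_prod borel_measurable_power measurable_component_singleton) auto
  have mX: "(\<lambda>w. \<lambda>i\<in>{1..n}. X i w) \<in> N \<rightarrow>\<^sub>M Pi\<^sub>M {1..n} (\<lambda>_. borel)"
    using rv by (intro measurable_restrict) (auto simp: random_vector_def)
  have hr: "h (\<lambda>i\<in>{1..n}. y i) = (\<Prod>\<alpha>\<in>U. y \<alpha> ^ e \<alpha>)" for y
    unfolding h_def using U by (intro prod.cong) auto
  define f where "f i = (\<lambda>x::real. if i \<in> U then x ^ e i else 1)" for i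
  have f_int: "integrable rademacher (f i)" for i
    unfolding rademacher_def by (rule integrable_measure_pmf_finite) (simp add: set_pmf_of_set)
  have fU: "(\<Prod>i\<in>{1..n}. f i (y i)) = (\<Prod>\<alpha>\<in>U. y \<alpha> ^ e \<alpha>)" for y
    unfolding f_def using U by (intro prod.mono_neutral_cong_right) auto
  have "(\<integral>\<epsilon>. (\<Prod>i\<in>{1..n}. f i (\<epsilon> i)) \<partial>Pi\<^sub>M {1..n} (\<lambda>_. rademacher)) = (\<Prod>i\<in>{1..n}. integral\<^sup>L rademacher (f i))"
    by (rule product_integral_prod) (auto intro: f_int)
  also have "\<dots> = 0"
  proof (rule prod_zero)
    have "integral\<^sup>L rademacher (f \<beta>) = 0"
      unfolding f_def using \<beta> rademacher_odd_moment[of "e \<beta>"] by simp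
    then show "\<exists>i\<in>{1..n}. integral\<^sup>L rademacher (f i) = 0" using \<beta>(1) U by blast
  qed simp
  finally have sign0: "(\<integral>\<epsilon>. (\<Prod>\<alpha>\<in>U. \<epsilon> \<alpha> ^ e \<alpha>) \<partial>Pi\<^sub>M {1..n} (\<lambda>_. rademacher)) = 0"
    unfolding fU .
  have sign_int: "integrable (Pi\<^sub>M {1..n} (\<lambda>_. rademacher)) (\<lambda>\<epsilon>. \<Prod>\<alpha>\<in>U. \<epsilon> \<alpha> ^ e \<alpha>)"
    using product_integrable_prod[of "{1..n}" f] f_int unfolding fU by simp
  have "(\<integral>w. (\<Prod>\<alpha>\<in>U. X \<alpha> w ^ e \<alpha>) \<partial>N) = (\<integral>w. h (\<lambda>i\<in>{1..n}. X i w) \<partial>N)"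
    unfolding hr ..
  also have "\<dots> = integral\<^sup>L (distr N (Pi\<^sub>M {1..n} (\<lambda>_. borel)) (\<lambda>w. \<lambda>i\<in>{1..n}. X i w)) h"
    by (rule integral_distr[symmetric, OF mX h])
  also have "\<dots> = integral\<^sup>L (distr (Pi\<^sub>M {1..n} (\<lambda>_. rademacher) \<Otimes>\<^sub>M N) (Pi\<^sub>M {1..n} (\<lambda>_. borel))
       (\<lambda>(\<epsilon>, w). \<lambda>i\<in>{1..n}. \<epsilon> i * X i w)) h"
    using un unfolding unconditional_def by (rule arg_cong2[where f="integral\<^sup>L", OF sym refl])
  also have "\<dots> = (\<integral>p. h ((\<lambda>(\<epsilon>, w). \<lambda>i\<in>{1..n}. \<epsilon> i * X i w) p) \<partial>(Pi\<^sub>M {1..n} (\<lambda>_. rademacher) \<Otimes>\<^sub>M N))"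
    by (rule integral_distr[OF random_vector_signed_measurable[OF rv] h])
  also have "\<dots> = (\<integral>p. (\<Prod>\<alpha>\<in>U. fst p \<alpha> ^ e \<alpha>) * (\<Prod>\<alpha>\<in>U. X \<alpha> (snd p) ^ e \<alpha>)
      \<partial>(Pi\<^sub>M {1..n} (\<lambda>_. rademacher) \<Otimes>\<^sub>M N))"
    by (simp only: case_prod_beta hr power_mult_distrib prod.distrib)
  also have "\<dots> = 0"
    unfolding integral_product_measure[OF PR.sigma_finite_measure_axioms N.sigma_finite_measure_axioms sign_int int]
    by (simp only: sign0 mult_zero_left)
  finally show ?thesis .
qed

text \<open>A union bound over T, where n C(n-1, d-1) = d C(n, d) counts the sets through one point:
  a proportion of at most |T| d / n of the d-sets meets T. The product form avoids division.\<close>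

lemma card_nsets_meeting:
  assumes A: "finite A" and d: "1 \<le> d" and T: "finite T"
  shows "card A * card {i \<in> nsets A d. i \<inter> T \<noteq> {}} \<le> card T * (d * (card A choose d))"
proof -
  have one: "card A * card {i \<in> nsets A d. \<alpha> \<in> i} \<le> d * (card A choose d)" for \<alpha>
  proof (cases "\<alpha> \<in> A")
    case True
    have "{i \<in> nsets A d. \<alpha> \<in> i} \<subseteq> insert \<alpha> ` nsets (A - {\<alpha>}) (d - 1)"
    proof
      fix i assume "i \<in> {i \<in> nsets A d. \<alpha> \<in> i}"
      then have i: "i \<subseteq> A" "finite i" "card i = d" "\<alpha> \<in> i" by (auto simp: nsets_def)
      then have "i - {\<alpha>} \<in> nsets (A - {\<alpha>}) (d - 1)"
        by (auto simp: nsets_def card_Diff_singleton)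
      moreover have "i = insert \<alpha> (i - {\<alpha>})" using i(4) by auto
      ultimately show "i \<in> insert \<alpha> ` nsets (A - {\<alpha>}) (d - 1)" by blast
    qed
    then have "card {i \<in> nsets A d. \<alpha> \<in> i} \<le> card (nsets (A - {\<alpha>}) (d - 1))"
      using A by (intro surj_card_le finite_imp_finite_nsets) auto
    also have "\<dots> = (card A - 1) choose (d - 1)"
      using True A by (simp add: card_Diff_singleton)
    finally have "card A * card {i \<in> nsets A d. \<alpha> \<in> i} \<le> card A * ((card A - 1) choose (d - 1))"
      by (rule mult_left_mono) simp
    also have "\<dots> = d * (card A choose d)"
      using binomial_absorption[of "d - 1" "card A"] d by simp
    finally show ?thesis .
  next
    case False
    then have "{i \<in> nsets A d. \<alpha> \<in> i} = {}" by (auto simp: nsets_def)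
    then show ?thesis by (simp only: card.empty mult_zero_right le0)
  qed
  have "{i \<in> nsets A d. i \<inter> T \<noteq> {}} = (\<Union>\<alpha>\<in>T. {i \<in> nsets A d. \<alpha> \<in> i})" by auto
  then have "card {i \<in> nsets A d. i \<inter> T \<noteq> {}} \<le> (\<Sum>\<alpha>\<in>T. card {i \<in> nsets A d. \<alpha> \<in> i})"
    using card_UN_le[OF T] by simp
  then have "card A * card {i \<in> nsets A d. i \<inter> T \<noteq> {}} \<le> (\<Sum>\<alpha>\<in>T. card A * card {i \<in> nsets A d. \<alpha> \<in> i})"
    unfolding sum_distrib_left[symmetric] by (rule mult_left_mono) simp
  also have "\<dots> \<le> (\<Sum>\<alpha>\<in>T. d * (card A choose d))"
    by (intro sum_mono one)
  finally show ?thesis by simp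
qed

lemma integral_square_sum:
  fixes m :: "'i \<Rightarrow> 'a \<Rightarrow> real" and c :: "'i \<Rightarrow> real"
  assumes int: "\<And>a b. a \<in> P \<Longrightarrow> b \<in> P \<Longrightarrow> integrable M (\<lambda>w. m a w * m b w)"
  shows "integrable M (\<lambda>w. (\<Sum>a\<in>P. c a * m a w)\<^sup>2)"
    and "(\<integral>w. (\<Sum>a\<in>P. c a * m a w)\<^sup>2 \<partial>M) = (\<Sum>a\<in>P. \<Sum>b\<in>P. c a * c b * (\<integral>w. m a w * m b w \<partial>M))"
proof -
  have eq: "(\<Sum>a\<in>P. c a * m a w)\<^sup>2 = (\<Sum>a\<in>P. \<Sum>b\<in>P. (c a * c b) * (m a w * m b w))" for w
    unfolding power2_eq_square sum_product by (intro sum.cong refl) simp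
  have int': "integrable M (\<lambda>w. (c a * c b) * (m a w * m b w))" if "a \<in> P" "b \<in> P" for a b
    by (rule integrable_mult_right[OF int[OF that]])
  show "integrable M (\<lambda>w. (\<Sum>a\<in>P. c a * m a w)\<^sup>2)"
    unfolding eq by (intro Bochner_Integration.integrable_sum int')
  have "(\<integral>w. (\<Sum>a\<in>P. c a * m a w)\<^sup>2 \<partial>M) = (\<Sum>a\<in>P. \<integral>w. (\<Sum>b\<in>P. (c a * c b) * (m a w * m b w)) \<partial>M)"
    unfolding eq by (intro Bochner_Integration.integral_sum Bochner_Integration.integrable_sum int')
  also have "\<dots> = (\<Sum>a\<in>P. \<Sum>b\<in>P. \<integral>w. (c a * c b) * (m a w * m b w) \<partial>M)"
    by (intro sum.cong refl Bochner_Integration.integral_sum int')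
  finally show "(\<integral>w. (\<Sum>a\<in>P. c a * m a w)\<^sup>2 \<partial>M) = (\<Sum>a\<in>P. \<Sum>b\<in>P. c a * c b * (\<integral>w. m a w * m b w \<partial>M))"
    by simp
qed

section \<open>Second moments of quadratic forms in tensor coordinates\<close>

text \<open>Degree 4d accommodates products of four tensor coordinates; n \<ge> 2d makes the square
  moment over 2d indices available for disjoint pairs.\<close>

locale tensor_moments = exchangeable_moments n N X "4 * d" \<epsilon> C
  for n :: nat and N :: "'b measure" and X and d :: nat and \<epsilon> C :: real +
  assumes un: "unconditional n N X" and d: "1 \<le> d" and n2d: "2 * d \<le> n"
begin

abbreviation I :: "nat set set" where "I \<equiv> nsets {1..n} d"

definition tensor :: "nat set \<Rightarrow> 'b \<Rightarrow> real" where
  "tensor i w = (\<Prod>\<alpha>\<in>i. X \<alpha> w)"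

definition p :: real where "p = card I"

lemma finite_I: "finite I" by (intro finite_imp_finite_nsets) simp

lemma in_I: "i \<in> I \<Longrightarrow> i \<subseteq> {1..n} \<and> finite i \<and> card i = d"
  by (auto simp: nsets_def)

lemma p_pos: "p > 0"
  using n2d by (simp add: p_def)

lemma n_pos: "real n > 0" using n by simp

lemma prod_subset_power:
  assumes "finite U" "i \<subseteq> U"
  shows "(\<Prod>\<alpha>\<in>U. X \<alpha> w ^ of_bool (\<alpha> \<in> i)) = tensor i w"
  unfolding tensor_def using assms by (intro prod.mono_neutral_cong_right) auto

lemma sum_of_bool_subset:
  assumes "finite U" "i \<subseteq> U"
  shows "(\<Sum>\<alpha>\<in>U. of_bool (\<alpha> \<in> i)) = card i"
  using assms by (simp add: Int_absorb1 flip: sum.inter_filter)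

text \<open>The exponent of a coordinate counts the sets containing its index. It is odd exactly
  when the index belongs to one of the two symmetric differences and not to the other.\<close>

lemma four_tensors:
  assumes "i \<in> I" "j \<in> I" "k \<in> I" "l \<in> I"
  shows "integrable N (\<lambda>w. tensor i w * tensor j w * (tensor k w * tensor l w))"
    and "\<bar>\<integral>w. tensor i w * tensor j w * (tensor k w * tensor l w) \<partial>N\<bar> \<le> B"
    and "sym_diff i j \<noteq> sym_diff k l \<Longrightarrow> (\<integral>w. tensor i w * tensor j w * (tensor k w * tensor l w) \<partial>N) = 0"
proof -
  define U where "U = i \<union> j \<union> (k \<union> l)"
  define e :: "nat \<Rightarrow> nat" where
    "e \<alpha> = of_bool (\<alpha> \<in> i) + of_bool (\<alpha> \<in> j) + (of_bool (\<alpha> \<in> k) + of_bool (\<alpha> \<in> l))" for \<alpha>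
  note ijkl = assms[THEN in_I]
  have U: "U \<subseteq> {1..n}" "finite U" using ijkl by (auto simp: U_def)
  have sub: "i \<subseteq> U" "j \<subseteq> U" "k \<subseteq> U" "l \<subseteq> U" by (auto simp: U_def)
  have s: "sum e U = 4 * d"
    unfolding e_def sum.distrib using ijkl by (simp add: sum_of_bool_subset[OF U(2)] sub)
  have "card U \<le> card i + card j + (card k + card l)"
    unfolding U_def by (meson add_mono card_Un_le order_trans)
  then have c: "card U \<le> 4 * d" using ijkl by simp
  have eq: "(\<Prod>\<alpha>\<in>U. X \<alpha> w ^ e \<alpha>) = tensor i w * tensor j w * (tensor k w * tensor l w)" for w
    unfolding e_def power_add prod.distrib by (simp only: prod_subset_power[OF U(2)] sub)
  show int: "integrable N (\<lambda>w. tensor i w * tensor j w * (tensor k w * tensor l w))"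
    using monomial_moment(1)[OF U(1), of e] s unfolding eq by simp
  show "\<bar>\<integral>w. tensor i w * tensor j w * (tensor k w * tensor l w) \<partial>N\<bar> \<le> B"
    using monomial_moment_le[OF U(1), of e] s c unfolding eq by simp
  assume "sym_diff i j \<noteq> sym_diff k l"
  then obtain \<beta> where \<beta>: "\<beta> \<in> sym_diff i j \<longleftrightarrow> \<beta> \<notin> sym_diff k l" by blast
  then have "odd (e \<beta>)" "\<beta> \<in> U" by (auto simp: e_def U_def of_bool_def)
  then have "(\<integral>w. (\<Prod>\<alpha>\<in>U. X \<alpha> w ^ e \<alpha>) \<partial>N) = 0"
    by (intro unconditional_odd_moment[OF rv un U(1)]) (simp_all add: eq int)
  then show "(\<integral>w. tensor i w * tensor j w * (tensor k w * tensor l w) \<partial>N) = 0"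
    unfolding eq .
qed

lemma two_squares:
  assumes "i \<in> I" "j \<in> I" "i \<inter> j = {}"
  shows "(\<integral>w. tensor i w * tensor i w * (tensor j w * tensor j w) \<partial>N) = sq_moment {1..2 * d}"
proof -
  note ij = assms(1,2)[THEN in_I]
  have "tensor i w * tensor i w * (tensor j w * tensor j w) = (\<Prod>\<alpha>\<in>i \<union> j. (X \<alpha> w)\<^sup>2)" for w
    using ij assms(3) by (simp add: tensor_def prod.union_disjoint power2_eq_square prod.distrib)
  then have "(\<integral>w. tensor i w * tensor i w * (tensor j w * tensor j w) \<partial>N) = sq_moment (i \<union> j)"
    by (simp add: sq_moment_def)
  also have "\<dots> = sq_moment {1..2 * d}"
    using ij assms(3) n2d by (intro sq_moment_cong_card) (auto simp: card_Un_disjoint)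
  finally show ?thesis .
qed

lemma one_square:
  assumes "i \<in> I"
  shows "integrable N (\<lambda>w. (tensor i w)\<^sup>2)" "(\<integral>w. (tensor i w)\<^sup>2 \<partial>N) = sq_moment {1..d}"
proof -
  note i = in_I[OF assms]
  have eq: "(tensor i w)\<^sup>2 = (\<Prod>\<alpha>\<in>i. (X \<alpha> w)\<^sup>2)" for w
    by (simp add: tensor_def prod_power_distrib)
  show "integrable N (\<lambda>w. (tensor i w)\<^sup>2)"
    unfolding eq using i by (intro sq_moment_integrable) auto
  have "(\<integral>w. (tensor i w)\<^sup>2 \<partial>N) = sq_moment i" unfolding eq sq_moment_def ..
  also have "\<dots> = sq_moment {1..d}" using i n2d by (intro sq_moment_cong_card) auto
  finally show "(\<integral>w. (tensor i w)\<^sup>2 \<partial>N) = sq_moment {1..d}" .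
qed

lemma card_meeting:
  assumes T: "finite T" "card T \<le> b"
  shows "real (card {k \<in> I. k \<inter> T \<noteq> {}}) \<le> b * d * p / n"
proof -
  have "n * card {k \<in> I. k \<inter> T \<noteq> {}} \<le> card T * (d * card I)"
    using card_nsets_meeting[of "{1..n}" d T] d T by simp
  also have "\<dots> \<le> b * (d * card I)" using T by (intro mult_right_mono) auto
  finally have "real (n * card {k \<in> I. k \<inter> T \<noteq> {}}) \<le> real (b * (d * card I))"
    by (rule of_nat_mono)
  then show ?thesis using n_pos by (simp add: p_def field_simps)
qed

text \<open>The product moment of two squares minus 1 is the vanishing quantity \<open>v\<close> for
  disjoint index sets and at most 4B otherwise, and each i has at most d^2 p / n sets that meet
  it.\<close>

lemma diagonal_part:
  fixes c :: "nat set \<Rightarrow> real"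
  assumes c: "\<And>i. i \<in> I \<Longrightarrow> \<bar>c i\<bar> \<le> s" and s: "0 \<le> s"
  shows "integrable N (\<lambda>w. (\<Sum>i\<in>I. c i * ((tensor i w)\<^sup>2 - 1))\<^sup>2)"
    and "(\<integral>w. (\<Sum>i\<in>I. c i * ((tensor i w)\<^sup>2 - 1))\<^sup>2 \<partial>N)
      \<le> s\<^sup>2 * p\<^sup>2 * (\<bar>sq_moment {1..2 * d} - 2 * sq_moment {1..d} + 1\<bar> + 4 * B * d\<^sup>2 / n)"
proof -
  define v where "v = sq_moment {1..2 * d} - 2 * sq_moment {1..d} + 1"
  have eq: "((tensor i w)\<^sup>2 - 1) * ((tensor j w)\<^sup>2 - 1)
      = tensor i w * tensor i w * (tensor j w * tensor j w) - (tensor i w)\<^sup>2 - (tensor j w)\<^sup>2 + 1" for i j w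
    by (simp add: power2_eq_square algebra_simps)
  have int: "integrable N (\<lambda>w. ((tensor i w)\<^sup>2 - 1) * ((tensor j w)\<^sup>2 - 1))" if "i \<in> I" "j \<in> I" for i j
    unfolding eq using four_tensors(1)[of i i j j] one_square(1) that by simp
  have E: "(\<integral>w. ((tensor i w)\<^sup>2 - 1) * ((tensor j w)\<^sup>2 - 1) \<partial>N)
      = (\<integral>w. tensor i w * tensor i w * (tensor j w * tensor j w) \<partial>N) - 2 * sq_moment {1..d} + 1" if "i \<in> I" "j \<in> I" for i j
    unfolding eq using four_tensors(1)[of i i j j] one_square that by (simp add: prob_space)
  have EYd: "0 \<le> sq_moment {1..d}" "sq_moment {1..d} \<le> B"
    using sq_moment_nonneg sq_moment_le[of "{1..d}"] n2d by auto
  have le: "\<bar>\<integral>w. ((tensor i w)\<^sup>2 - 1) * ((tensor j w)\<^sup>2 - 1) \<partial>N\<bar> \<le> \<bar>v\<bar> + (if j \<inter> i \<noteq> {} then 4 * B else 0)"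
    if ij: "i \<in> I" "j \<in> I" for i j
  proof (cases "j \<inter> i = {}")
    case True
    then have "i \<inter> j = {}" by blast
    then show ?thesis using True unfolding E[OF ij] two_squares[OF ij \<open>i \<inter> j = {}\<close>] v_def by simp
  next
    case False
    have "\<bar>\<integral>w. tensor i w * tensor i w * (tensor j w * tensor j w) \<partial>N\<bar> \<le> B"
      by (rule four_tensors(2)) (use ij in auto)
    \<comment> \<open>The bound is B + 2B + 1 \<le> 4B, as B \<ge> 1.\<close>
    then have "\<bar>(\<integral>w. tensor i w * tensor i w * (tensor j w * tensor j w) \<partial>N) - 2 * sq_moment {1..d} + 1\<bar> \<le> 4 * B"
      using EYd B_ge by linarith
    then show ?thesis using False unfolding E[OF ij] by simp
  qed
  show "integrable N (\<lambda>w. (\<Sum>i\<in>I. c i * ((tensor i w)\<^sup>2 - 1))\<^sup>2)"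
    by (rule integral_square_sum(1)[OF int])
  have "(\<integral>w. (\<Sum>i\<in>I. c i * ((tensor i w)\<^sup>2 - 1))\<^sup>2 \<partial>N)
      = (\<Sum>i\<in>I. \<Sum>j\<in>I. c i * c j * (\<integral>w. ((tensor i w)\<^sup>2 - 1) * ((tensor j w)\<^sup>2 - 1) \<partial>N))"
    by (rule integral_square_sum(2)[OF int])
  also have "\<dots> \<le> (\<Sum>i\<in>I. \<Sum>j\<in>I. s * s * (\<bar>v\<bar> + (if j \<inter> i \<noteq> {} then 4 * B else 0)))"
  proof (intro sum_mono)
    fix i j assume ij: "i \<in> I" "j \<in> I"
    have "c i * c j * (\<integral>w. ((tensor i w)\<^sup>2 - 1) * ((tensor j w)\<^sup>2 - 1) \<partial>N)
        \<le> \<bar>c i\<bar> * \<bar>c j\<bar> * \<bar>\<integral>w. ((tensor i w)\<^sup>2 - 1) * ((tensor j w)\<^sup>2 - 1) \<partial>N\<bar>"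
      unfolding abs_mult[symmetric] by (rule abs_ge_self)
    also have "\<dots> \<le> s * s * (\<bar>v\<bar> + (if j \<inter> i \<noteq> {} then 4 * B else 0))"
      using ij s by (intro mult_mono c le) auto
    finally show "c i * c j * (\<integral>w. ((tensor i w)\<^sup>2 - 1) * ((tensor j w)\<^sup>2 - 1) \<partial>N)
      \<le> s * s * (\<bar>v\<bar> + (if j \<inter> i \<noteq> {} then 4 * B else 0))" .
  qed
  also have "\<dots> = s * s * (\<Sum>i\<in>I. p * \<bar>v\<bar> + 4 * B * card {j \<in> I. j \<inter> i \<noteq> {}})"
  proof -
    have "(\<Sum>j\<in>I. if j \<inter> i \<noteq> {} then 4 * B else 0) = 4 * B * card {j \<in> I. j \<inter> i \<noteq> {}}" for i
      by (simp only: sum.inter_filter[OF finite_I, symmetric] sum_constant) simp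
    then show ?thesis by (simp only: sum_distrib_left[symmetric] sum.distrib sum_constant p_def)
  qed
  also have "\<dots> \<le> s * s * (\<Sum>i\<in>I. p * \<bar>v\<bar> + 4 * B * (d * d * p / n))"
  proof (intro mult_left_mono sum_mono add_left_mono)
    fix i assume "i \<in> I"
    then show "real (card {j \<in> I. j \<inter> i \<noteq> {}}) \<le> d * d * p / n"
      using in_I by (intro card_meeting) auto
  qed (use s B_ge in auto)
  also have "\<dots> = s\<^sup>2 * p\<^sup>2 * (\<bar>v\<bar> + 4 * B * d\<^sup>2 / n)"
    by (simp only: sum_constant p_def[symmetric]) (simp add: power2_eq_square algebra_simps)
  finally show "(\<integral>w. (\<Sum>i\<in>I. c i * ((tensor i w)\<^sup>2 - 1))\<^sup>2 \<partial>N)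
      \<le> s\<^sup>2 * p\<^sup>2 * (\<bar>sq_moment {1..2 * d} - 2 * sq_moment {1..d} + 1\<bar> + 4 * B * d\<^sup>2 / n)"
    unfolding v_def .
qed

definition off_diag :: "(nat set \<times> nat set) set" where
  "off_diag = {a \<in> I \<times> I. fst a \<noteq> snd a}"

lemma finite_off_diag: "finite off_diag"
  unfolding off_diag_def using finite_I by simp

text \<open>A pair (k, l) with symmetric difference T is determined by k, because l is the symmetric
  difference of k and T. Moreover k meets T: it is not contained in l, a different set of the same
  size.\<close>

lemma card_same_sym_diff:
  assumes ij: "(i, j) \<in> off_diag"
  shows "real (card {b \<in> off_diag. sym_diff i j = sym_diff (fst b) (snd b)}) \<le> 2 * d * d * p / n"
proof -
  define T where "T = sym_diff i j"
  have i: "i \<in> I" "j \<in> I" using ij by (auto simp: off_diag_def)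
  note ij' = in_I[OF i(1)] in_I[OF i(2)]
  have T: "finite T" "card T \<le> 2 * d"
  proof -
    show "finite T" using ij' by (simp add: T_def)
    have "card T \<le> card (i - j) + card (j - i)" unfolding T_def by (rule card_Un_le)
    also have "\<dots> \<le> card i + card j" using ij' by (intro add_mono card_mono) auto
    finally show "card T \<le> 2 * d" using ij' by simp
  qed
  let ?F = "{b \<in> off_diag. T = sym_diff (fst b) (snd b)}"
  have "inj_on fst ?F"
  proof (rule inj_onI)
    fix a b assume "a \<in> ?F" "b \<in> ?F" "fst a = fst b"
    then have "sym_diff (fst a) (snd a) = sym_diff (fst a) (snd b)" by auto
    then have "snd a = snd b" by blast
    with \<open>fst a = fst b\<close> show "a = b" by (simp add: prod_eq_iff)
  qed
  moreover have "fst ` ?F \<subseteq> {k \<in> I. k \<inter> T \<noteq> {}}"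
  proof
    fix k assume "k \<in> fst ` ?F"
    then obtain l where kl: "(k, l) \<in> off_diag" "T = sym_diff k l" by auto
    then have kl': "k \<in> I" "l \<in> I" "k \<noteq> l" by (auto simp: off_diag_def)
    then have "\<not> k \<subseteq> l" using in_I card_subset_eq by metis
    then show "k \<in> {k \<in> I. k \<inter> T \<noteq> {}}" using kl kl' by auto
  qed
  ultimately have "card ?F \<le> card {k \<in> I. k \<inter> T \<noteq> {}}"
    using finite_I by (intro card_inj_on_le[of fst]) auto
  also have "real (card {k \<in> I. k \<inter> T \<noteq> {}}) \<le> (2 * d) * d * p / n"
    using card_meeting[OF T] by simp
  finally show ?thesis by (simp add: T_def)
qed

text \<open>Only pairs with equal symmetric difference interact. By |c_a c_b| \<le> (c_a^2 + c_b^2)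
  / 2 the double sum reduces to the number of partners times the squared Hilbert-Schmidt norm, which
  is at most p s^2.\<close>

lemma off_diagonal_part:
  fixes A :: "nat set \<Rightarrow> nat set \<Rightarrow> real"
  assumes A: "\<And>i. i \<in> I \<Longrightarrow> (\<Sum>j\<in>I. (A i j)\<^sup>2) \<le> s\<^sup>2"
  shows "integrable N (\<lambda>w. (\<Sum>a\<in>off_diag. A (fst a) (snd a) * (tensor (fst a) w * tensor (snd a) w))\<^sup>2)"
    and "(\<integral>w. (\<Sum>a\<in>off_diag. A (fst a) (snd a) * (tensor (fst a) w * tensor (snd a) w))\<^sup>2 \<partial>N)
      \<le> s\<^sup>2 * p\<^sup>2 * (2 * B * d\<^sup>2 / n)"
proof -
  define c where "c a = A (fst a) (snd a)" for a
  define m where "m a w = tensor (fst a) w * tensor (snd a) w" for a w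
  define sd where "sd a = sym_diff (fst a) (snd a)" for a :: "nat set \<times> nat set"
  have OffD: "fst a \<in> I" "snd a \<in> I" if "a \<in> off_diag" for a using that by (auto simp: off_diag_def)
  have int: "integrable N (\<lambda>w. m a w * m b w)" if "a \<in> off_diag" "b \<in> off_diag" for a b
    unfolding m_def by (intro four_tensors(1) OffD that)
  have bound: "\<bar>\<integral>w. m a w * m b w \<partial>N\<bar> \<le> (if sd a = sd b then B else 0)" if "a \<in> off_diag" "b \<in> off_diag" for a b
    using four_tensors(2,3)[OF OffD[OF that(1)] OffD[OF that(2)]] unfolding m_def sd_def by auto
  show "integrable N (\<lambda>w. (\<Sum>a\<in>off_diag. A (fst a) (snd a) * (tensor (fst a) w * tensor (snd a) w))\<^sup>2)"
    using integral_square_sum(1)[OF int, where c=c] unfolding c_def m_def by simp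
  have B0: "0 \<le> B" using B_ge by simp
  have "(\<integral>w. (\<Sum>a\<in>off_diag. c a * m a w)\<^sup>2 \<partial>N) = (\<Sum>a\<in>off_diag. \<Sum>b\<in>off_diag. c a * c b * (\<integral>w. m a w * m b w \<partial>N))"
    by (rule integral_square_sum(2)[OF int])
  also have "\<dots> \<le> (\<Sum>a\<in>off_diag. \<Sum>b\<in>off_diag. (if sd a = sd b then B / 2 * (c a)\<^sup>2 else 0) + (if sd b = sd a then B / 2 * (c b)\<^sup>2 else 0))"
  proof (intro sum_mono)
    fix a b assume ab: "a \<in> off_diag" "b \<in> off_diag"
    have "c a * c b * (\<integral>w. m a w * m b w \<partial>N) \<le> \<bar>c a * c b\<bar> * \<bar>\<integral>w. m a w * m b w \<partial>N\<bar>"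
      unfolding abs_mult[symmetric] by (rule abs_ge_self)
    also have "\<dots> \<le> \<bar>c a * c b\<bar> * (if sd a = sd b then B else 0)"
      by (intro mult_left_mono bound ab) simp
    also have "\<dots> \<le> (((c a)\<^sup>2 + (c b)\<^sup>2) / 2) * (if sd a = sd b then B else 0)"
    proof (rule mult_right_mono)
      have "0 \<le> (\<bar>c a\<bar> - \<bar>c b\<bar>)\<^sup>2" by simp
      also have "\<dots> = (c a)\<^sup>2 + (c b)\<^sup>2 - 2 * \<bar>c a * c b\<bar>"
        by (simp add: power2_diff abs_mult)
      finally show "\<bar>c a * c b\<bar> \<le> ((c a)\<^sup>2 + (c b)\<^sup>2) / 2" by simp
    qed (use B0 in simp)
    also have "\<dots> = (if sd a = sd b then B / 2 * (c a)\<^sup>2 else 0) + (if sd b = sd a then B / 2 * (c b)\<^sup>2 else 0)"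
      by (simp add: algebra_simps)
    finally show "c a * c b * (\<integral>w. m a w * m b w \<partial>N)
      \<le> (if sd a = sd b then B / 2 * (c a)\<^sup>2 else 0) + (if sd b = sd a then B / 2 * (c b)\<^sup>2 else 0)" .
  qed
  also have "\<dots> = 2 * (\<Sum>a\<in>off_diag. \<Sum>b\<in>off_diag. if sd a = sd b then B / 2 * (c a)\<^sup>2 else 0)"
  proof -
    have "(\<Sum>a\<in>off_diag. \<Sum>b\<in>off_diag. if sd b = sd a then B / 2 * (c b)\<^sup>2 else 0)
        = (\<Sum>b\<in>off_diag. \<Sum>a\<in>off_diag. if sd b = sd a then B / 2 * (c b)\<^sup>2 else 0)"
      by (rule sum.swap)
    then show ?thesis by (simp only: sum.distrib mult_2)
  qed
  also have "(\<Sum>a\<in>off_diag. \<Sum>b\<in>off_diag. if sd a = sd b then B / 2 * (c a)\<^sup>2 else 0)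
      = (\<Sum>a\<in>off_diag. card {b \<in> off_diag. sd a = sd b} * (B / 2 * (c a)\<^sup>2))"
    by (simp only: sum.inter_filter[OF finite_off_diag, symmetric] sum_constant)
  also have "\<dots> \<le> (\<Sum>a\<in>off_diag. 2 * d * d * p / n * (B / 2 * (c a)\<^sup>2))"
  proof (intro sum_mono mult_right_mono)
    fix a assume "a \<in> off_diag"
    then show "real (card {b \<in> off_diag. sd a = sd b}) \<le> 2 * d * d * p / n"
      using card_same_sym_diff[of "fst a" "snd a"] by (simp add: sd_def)
  qed (use B0 in auto)
  also have "\<dots> = (d * d * p / n * B) * (\<Sum>a\<in>off_diag. (c a)\<^sup>2)"
    by (simp add: sum_distrib_left sum_divide_distrib mult_ac)
  also have "\<dots> \<le> (d * d * p / n * B) * (p * s\<^sup>2)"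
  proof (rule mult_left_mono)
    have "(\<Sum>a\<in>off_diag. (c a)\<^sup>2) \<le> (\<Sum>a\<in>I \<times> I. (c a)\<^sup>2)"
      unfolding off_diag_def using finite_I by (intro sum_mono2) auto
    also have "\<dots> = (\<Sum>i\<in>I. \<Sum>j\<in>I. (A i j)\<^sup>2)"
      by (simp add: sum.cartesian_product c_def case_prod_beta)
    also have "\<dots> \<le> (\<Sum>i\<in>I. s\<^sup>2)" by (intro sum_mono A)
    finally show "(\<Sum>a\<in>off_diag. (c a)\<^sup>2) \<le> p * s\<^sup>2" by (simp only: sum_constant p_def)
  qed (use B0 p_pos in simp)
  finally have "(\<integral>w. (\<Sum>a\<in>off_diag. c a * m a w)\<^sup>2 \<partial>N) \<le> 2 * ((d * d * p / n * B) * (p * s\<^sup>2))" by simp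
  then show "(\<integral>w. (\<Sum>a\<in>off_diag. A (fst a) (snd a) * (tensor (fst a) w * tensor (snd a) w))\<^sup>2 \<partial>N)
      \<le> s\<^sup>2 * p\<^sup>2 * (2 * B * d\<^sup>2 / n)"
    unfolding c_def m_def by (simp add: power2_eq_square mult_ac)
qed

text \<open>The diagonal and off-diagonal parts are combined by (F + G)^2 \<le> 2 F^2 + 2 G^2, so
  the constants 4 and 2 yield 12.\<close>

lemma quadratic_form_concentration:
  fixes A :: "nat set \<Rightarrow> nat set \<Rightarrow> real"
  assumes diag: "\<And>i. i \<in> I \<Longrightarrow> \<bar>A i i\<bar> \<le> s" and rows: "\<And>i. i \<in> I \<Longrightarrow> (\<Sum>j\<in>I. (A i j)\<^sup>2) \<le> s\<^sup>2"
    and s: "0 \<le> s"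
  defines "Q \<equiv> \<lambda>w. inner_on I (\<lambda>i. tensor i w) (mult_vec I A (\<lambda>i. tensor i w)) - trace_on I A"
  shows "integrable N Q"
    and "(\<integral>w. \<bar>Q w\<bar> \<partial>N) \<le> s * p * sqrt (2 * \<bar>sq_moment {1..2 * d} - 2 * sq_moment {1..d} + 1\<bar> + 12 * B * d\<^sup>2 / n)"
proof -
  define v where "v = \<bar>sq_moment {1..2 * d} - 2 * sq_moment {1..d} + 1\<bar>"
  define F where "F w = (\<Sum>i\<in>I. A i i * ((tensor i w)\<^sup>2 - 1))" for w
  define G where "G w = (\<Sum>a\<in>off_diag. A (fst a) (snd a) * (tensor (fst a) w * tensor (snd a) w))" for w
  note dp = diagonal_part[of "\<lambda>i. A i i" s, OF diag s, folded F_def v_def]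
  note op = off_diagonal_part[of A s, OF rows, folded G_def]
  have QFG: "Q w = F w + G w" for w
  proof -
    define f where "f a = A (fst a) (snd a) * (tensor (fst a) w * tensor (snd a) w)" for a
    have "inner_on I (\<lambda>i. tensor i w) (mult_vec I A (\<lambda>i. tensor i w)) = (\<Sum>a\<in>I \<times> I. f a)"
      unfolding f_def by (simp add: inner_on_def mult_vec_def sum_distrib_left sum.cartesian_product case_prod_beta mult_ac)
    also have "I \<times> I = off_diag \<union> (\<lambda>i. (i, i)) ` I" by (auto simp: off_diag_def)
    also have "(\<Sum>a\<in>off_diag \<union> (\<lambda>i. (i, i)) ` I. f a) = sum f off_diag + sum f ((\<lambda>i. (i, i)) ` I)"
      using finite_off_diag finite_I by (intro sum.union_disjoint) (auto simp: off_diag_def)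
    also have "sum f ((\<lambda>i. (i, i)) ` I) = (\<Sum>i\<in>I. A i i * (tensor i w)\<^sup>2)"
      by (subst sum.reindex) (auto simp: inj_on_def f_def power2_eq_square)
    finally show ?thesis
      by (simp add: Q_def F_def G_def f_def trace_on_def right_diff_distrib sum_subtractf)
  qed
  have tm: "tensor i \<in> borel_measurable N" if "i \<in> I" for i
    unfolding tensor_def[abs_def] using in_I[OF that] by (intro borel_measurable_prod X_measurable) auto
  have Fm: "F \<in> borel_measurable N" unfolding F_def[abs_def]
    by (intro borel_measurable_sum borel_measurable_times borel_measurable_diff borel_measurable_power
        borel_measurable_const tm)
  have Gm: "G \<in> borel_measurable N" unfolding G_def[abs_def]
    by (intro borel_measurable_sum borel_measurable_times borel_measurable_const tm) (auto simp: off_diag_def)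
  have Qm: "Q \<in> borel_measurable N" unfolding QFG[abs_def] using Fm Gm by simp
  have Q2: "(Q w)\<^sup>2 \<le> 2 * (F w)\<^sup>2 + 2 * (G w)\<^sup>2" for w
  proof -
    have "0 \<le> (F w - G w)\<^sup>2" by simp
    then show ?thesis unfolding QFG by (simp add: power2_eq_square algebra_simps)
  qed
  have intb: "integrable N (\<lambda>w. 2 * (F w)\<^sup>2 + 2 * (G w)\<^sup>2)" using dp(1) op(1) by simp
  have intQ2: "integrable N (\<lambda>w. (Q w)\<^sup>2)"
  proof (rule Bochner_Integration.integrable_bound[OF intb])
    show "AE w in N. norm ((Q w)\<^sup>2) \<le> norm (2 * (F w)\<^sup>2 + 2 * (G w)\<^sup>2)"
      using Q2 by (intro AE_I2) simp
  qed (use Qm in simp)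
  show int: "integrable N Q"
  proof (rule Bochner_Integration.integrable_bound[of N "\<lambda>w. 1 + (Q w)\<^sup>2"])
    have "\<bar>y\<bar> \<le> 1 + y\<^sup>2" for y :: real
    proof -
      have "0 \<le> (\<bar>y\<bar> - 1)\<^sup>2" by simp
      then have "2 * \<bar>y\<bar> \<le> 1 + y\<^sup>2" by (simp add: power2_diff)
      then show ?thesis by linarith
    qed
    then show "AE w in N. norm (Q w) \<le> norm (1 + (Q w)\<^sup>2)" by (intro AE_I2) simp
  qed (use intQ2 Qm in auto)
  have "(\<integral>w. (Q w)\<^sup>2 \<partial>N) \<le> (\<integral>w. 2 * (F w)\<^sup>2 + 2 * (G w)\<^sup>2 \<partial>N)"
    by (rule integral_mono[OF intQ2 intb Q2])
  also have "\<dots> = 2 * (\<integral>w. (F w)\<^sup>2 \<partial>N) + 2 * (\<integral>w. (G w)\<^sup>2 \<partial>N)"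
    using dp(1) op(1) by simp
  also have "\<dots> \<le> 2 * (s\<^sup>2 * p\<^sup>2 * (v + 4 * B * d\<^sup>2 / n)) + 2 * (s\<^sup>2 * p\<^sup>2 * (2 * B * d\<^sup>2 / n))"
    using dp(2) op(2) by linarith
  also have "\<dots> = (s * p)\<^sup>2 * (2 * v + 12 * B * d\<^sup>2 / n)"
    by (simp add: power_mult_distrib algebra_simps add_divide_distrib)
  finally have EQ2: "(\<integral>w. (Q w)\<^sup>2 \<partial>N) \<le> (s * p)\<^sup>2 * (2 * v + 12 * B * d\<^sup>2 / n)" .
  \<comment> \<open>Cauchy-Schwarz in the form of a nonnegative variance.\<close>
  have "(\<integral>w. \<bar>Q w\<bar> \<partial>N)\<^sup>2 \<le> (\<integral>w. (Q w)\<^sup>2 \<partial>N)"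
    using variance_eq[of "\<lambda>w. \<bar>Q w\<bar>"] variance_positive[of "\<lambda>w. \<bar>Q w\<bar>"] int intQ2 by simp
  with EQ2 have "(\<integral>w. \<bar>Q w\<bar> \<partial>N)\<^sup>2 \<le> (s * p)\<^sup>2 * (2 * v + 12 * B * d\<^sup>2 / n)" by linarith
  then have "\<bar>\<integral>w. \<bar>Q w\<bar> \<partial>N\<bar> \<le> sqrt ((s * p)\<^sup>2 * (2 * v + 12 * B * d\<^sup>2 / n))"
    by (metis real_sqrt_abs real_sqrt_le_mono)
  also have "\<dots> = s * p * sqrt (2 * v + 12 * B * d\<^sup>2 / n)"
    using s p_pos by (simp add: real_sqrt_mult)
  finally show "(\<integral>w. \<bar>Q w\<bar> \<partial>N) \<le> s * p * sqrt (2 * \<bar>sq_moment {1..2 * d} - 2 * sq_moment {1..d} + 1\<bar> + 12 * B * d\<^sup>2 / n)"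
    unfolding v_def by simp
qed

end

section \<open>The self-consistent equation\<close>

lemma gram_resolvent_measurable:
  fixes x :: "'z \<Rightarrow> nat \<Rightarrow> 'i \<Rightarrow> real"
  assumes "\<And>k i. k \<in> set ks \<Longrightarrow> i \<in> I \<Longrightarrow> (\<lambda>z. x z k i) \<in> borel_measurable Z" and "i \<in> I" "j \<in> I"
  shows "(\<lambda>z. gram_resolvent I a t (x z) ks i j) \<in> borel_measurable Z"
  using assms
proof (induction ks arbitrary: i j)
  case Nil
  then show ?case by simp
next
  case (Cons k ks)
  have xk: "(\<lambda>z. x z k l) \<in> borel_measurable Z" if "l \<in> I" for l
    using Cons.prems(1)[of k l] that by simp
  have G: "(\<lambda>z. gram_resolvent I a t (x z) ks l l') \<in> borel_measurable Z" if "l \<in> I" "l' \<in> I" for l l'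
    using Cons.IH[of l l'] Cons.prems(1) that by simp
  have w: "(\<lambda>z. mult_vec I (gram_resolvent I a t (x z) ks) (x z k) l) \<in> borel_measurable Z" if "l \<in> I" for l
    unfolding mult_vec_def using that by (intro borel_measurable_sum borel_measurable_times G xk)
  have q: "(\<lambda>z. inner_on I (x z k) (mult_vec I (gram_resolvent I a t (x z) ks) (x z k))) \<in> borel_measurable Z"
    unfolding inner_on_def by (intro borel_measurable_sum borel_measurable_times w xk)
  show ?case
    unfolding gram_resolvent.simps sm_update_def using Cons.prems(2,3)
    by (intro borel_measurable_diff borel_measurable_divide borel_measurable_times borel_measurable_add
        borel_measurable_const G w q)
qed

lemma gram_resolvent_cong: "(\<And>k. k \<in> set ks \<Longrightarrow> x k = y k) \<Longrightarrow> gram_resolvent I a t x ks = gram_resolvent I a t y ks"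
  by (induction ks) simp_all

section \<open>Leave-one-out resolvents of i.i.d. columns\<close>

text \<open>The law of a column enters only through the concentration in mean of its quadratic
  forms, for matrices with the two bounds that resolvents satisfy; the tensor structure is forgotten
  here.\<close>

locale iid_columns =
  fixes I :: "'i set" and \<nu> :: "('i \<Rightarrow> real) measure" and m :: nat and t \<eta> :: real
  assumes I: "finite I" "I \<noteq> {}" and \<nu>: "prob_space \<nu>"
    and sets_\<nu>: "sets \<nu> = sets (Pi\<^sub>M I (\<lambda>_. borel))"
    and m: "1 \<le> m" and t: "0 < t"
    and quad_int: "\<And>A. (\<And>i. i \<in> I \<Longrightarrow> \<bar>A i i\<bar> \<le> 1 / t) \<Longrightarrow> (\<And>i. i \<in> I \<Longrightarrow> (\<Sum>j\<in>I. (A i j)\<^sup>2) \<le> (1 / t)\<^sup>2) \<Longrightarrow>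
        integrable \<nu> (\<lambda>y. inner_on I y (mult_vec I A y) - trace_on I A)"
    and quad: "\<And>A. (\<And>i. i \<in> I \<Longrightarrow> \<bar>A i i\<bar> \<le> 1 / t) \<Longrightarrow> (\<And>i. i \<in> I \<Longrightarrow> (\<Sum>j\<in>I. (A i j)\<^sup>2) \<le> (1 / t)\<^sup>2) \<Longrightarrow>
        (\<integral>y. \<bar>inner_on I y (mult_vec I A y) - trace_on I A\<bar> \<partial>\<nu>) \<le> \<eta> * card I"
begin

definition P :: "(nat \<Rightarrow> 'i \<Rightarrow> real) measure" where "P = Pi\<^sub>M {1..m} (\<lambda>_. \<nu>)"

definition p :: real where "p = card I"

definition a :: real where "a = 1 / m"

definition R :: "(nat \<Rightarrow> 'i \<Rightarrow> real) \<Rightarrow> 'i \<Rightarrow> 'i \<Rightarrow> real" where "R w = gram_resolvent I a t w [1..<Suc m]"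

definition stieltjes :: "(nat \<Rightarrow> 'i \<Rightarrow> real) \<Rightarrow> real" where "stieltjes w = trace_on I (R w) / p"

definition others :: "nat \<Rightarrow> nat list" where "others k = filter (\<lambda>l. l \<noteq> k) [1..<Suc m]"

definition Rk :: "nat \<Rightarrow> (nat \<Rightarrow> 'i \<Rightarrow> real) \<Rightarrow> 'i \<Rightarrow> 'i \<Rightarrow> real" where "Rk k w = gram_resolvent I a t w (others k)"

lemma p_pos: "p > 0" using I by (simp add: p_def card_gt_0_iff)

lemma m_pos: "real m > 0" using m by simp

lemma a_pos: "a > 0" using m by (simp add: a_def)

lemma a_nonneg: "0 \<le> a" using a_pos by simp

sublocale P: prob_space P
  unfolding P_def by (rule prob_space_PiM) (rule \<nu>)

lemma others: "distinct (others k)" "set (others k) = {1..m} - {k}"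
  unfolding others_def by (auto simp del: upt_Suc)

lemma is_resolvent_R: "is_resolvent I a t w {1..m} (R w)"
  using is_resolvent_gram_resolvent[OF I(1) a_nonneg t, of "[1..<Suc m]" w]
  by (simp add: R_def atLeastLessThanSuc_atLeastAtMost del: upt_Suc)

lemma is_resolvent_Rk: "is_resolvent I a t w ({1..m} - {k}) (Rk k w)"
  using is_resolvent_gram_resolvent[OF I(1) a_nonneg t others(1), of w k] by (simp add: Rk_def others)

text \<open>Both sides are resolvents of the same set of columns, so uniqueness moves column k to
  the last position.\<close>

lemma R_eq_update:
  assumes "k \<in> {1..m}" "i \<in> I" "j \<in> I"
  shows "R w i j = sm_update I a (w k) (Rk k w) i j"
proof -
  have "is_resolvent I a t w (insert k ({1..m} - {k})) (sm_update I a (w k) (Rk k w))"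
    by (rule is_resolvent_update[OF I(1) a_nonneg t is_resolvent_Rk]) auto
  then have "is_resolvent I a t w {1..m} (sm_update I a (w k) (Rk k w))"
    using assms(1) by (simp add: insert_absorb)
  then show ?thesis
    by (intro resolvent_unique[OF I(1) a_nonneg t is_resolvent_R] assms)
qed

lemma trace_R_eq_update: "k \<in> {1..m} \<Longrightarrow> trace_on I (R w) = trace_on I (sm_update I a (w k) (Rk k w))"
  unfolding trace_on_def by (intro sum.cong refl R_eq_update)

lemma trace_R_bounds:
  assumes "k \<in> {1..m}"
  shows "trace_on I (R w) \<le> trace_on I (Rk k w)" "trace_on I (Rk k w) - 1 / t \<le> trace_on I (R w)"
  unfolding trace_R_eq_update[OF assms]
  using trace_sm_update_bounds[OF I(1) a_nonneg t is_resolvent_Rk] by auto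

lemma Rk_fun_upd: "Rk k (w(k := y)) = Rk k w"
  unfolding Rk_def by (rule gram_resolvent_cong) (simp add: others)

lemma stieltjes_bounds: "0 \<le> stieltjes w" "stieltjes w \<le> 1 / t"
proof -
  show "0 \<le> stieltjes w"
    using resolvent_trace_bounds(1)[OF I(1) a_nonneg t is_resolvent_R, of w] p_pos by (simp add: stieltjes_def)
  have "trace_on I (R w) \<le> p / t"
    using resolvent_trace_bounds(2)[OF I(1) a_nonneg t is_resolvent_R, of w] by (simp add: p_def)
  then show "stieltjes w \<le> 1 / t" using p_pos t by (simp add: stieltjes_def field_simps)
qed

text \<open>Both traces lie within 1/t below the trace of the resolvent without column k, which the
  replacement leaves unchanged.\<close>

lemma stieltjes_diff: "k \<in> {1..m} \<Longrightarrow> \<bar>stieltjes w - stieltjes (w(k := y))\<bar> \<le> 1 / (t * p)"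
proof -
  assume k: "k \<in> {1..m}"
  have "\<bar>trace_on I (R w) - trace_on I (R (w(k := y)))\<bar> \<le> 1 / t"
    using trace_R_bounds[OF k, of w] trace_R_bounds[OF k, of "w(k := y)"] unfolding Rk_fun_upd by linarith
  then have "\<bar>trace_on I (R w) - trace_on I (R (w(k := y)))\<bar> / p \<le> 1 / t / p"
    using p_pos by (intro divide_right_mono) auto
  then show ?thesis using p_pos by (simp add: stieltjes_def flip: diff_divide_distrib)
qed

lemma column_measurable:
  assumes "k \<in> S" "i \<in> I"
  shows "(\<lambda>w. w k i) \<in> borel_measurable (Pi\<^sub>M S (\<lambda>_. \<nu>))"
proof -
  have "(\<lambda>y. y i) \<in> borel_measurable \<nu>"
    using measurable_component_singleton[OF assms(2), of "\<lambda>_. borel"]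
      measurable_cong_sets[OF sets_\<nu> refl] by blast
  from measurable_compose[OF measurable_component_singleton[OF assms(1)] this] show ?thesis .
qed

lemma stieltjes_measurable [measurable]: "stieltjes \<in> borel_measurable P"
  unfolding stieltjes_def[abs_def] trace_on_def R_def P_def
  by (intro borel_measurable_divide borel_measurable_sum borel_measurable_const gram_resolvent_measurable column_measurable)
    (auto simp: atLeastLessThanSuc_atLeastAtMost simp del: upt_Suc)

definition stieltjes_mean :: real where "stieltjes_mean = (\<integral>w. stieltjes w \<partial>P)"

lemma stieltjes_integrable: "integrable P stieltjes"
  using stieltjes_bounds t by (intro P.integrable_const_bound[where B="1 / t"]) auto

lemma stieltjes_mean_bounds: "0 \<le> stieltjes_mean" "stieltjes_mean \<le> 1 / t"
proof -
  show "0 \<le> stieltjes_mean" unfolding stieltjes_mean_def using stieltjes_bounds by (intro integral_nonneg_AE AE_I2)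
  have "stieltjes_mean \<le> (\<integral>w. 1 / t \<partial>P)"
    unfolding stieltjes_mean_def using stieltjes_bounds stieltjes_integrable by (intro integral_mono) auto
  then show "stieltjes_mean \<le> 1 / t" by (simp add: P.prob_space)
qed

text \<open>Bounded differences are applied to the transform and to its negative, and exp (l |u|) is
  at most the sum of the two exponentials; this is the factor 2.\<close>

lemma stieltjes_mgf:
  assumes l: "l > 0"
  shows "(\<integral>\<^sup>+w. ennreal (exp (l * \<bar>stieltjes w - stieltjes_mean\<bar>)) \<partial>P) \<le> ennreal (2 * exp (l\<^sup>2 * (1 / (t * p))\<^sup>2 * m / 2))"
proof -
  define E where "E = exp (l\<^sup>2 * (1 / (t * p))\<^sup>2 * m / 2)"
  have c: "1 / (t * p) > 0" using t p_pos by simp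
  have cm: "real (card {1..m}) = m" by simp
  have sb: "\<bar>stieltjes w\<bar> \<le> 1 / t" for w using stieltjes_bounds[of w] by simp
  have 1: "(\<integral>\<^sup>+w. ennreal (exp (l * (stieltjes w - stieltjes_mean))) \<partial>P) \<le> ennreal E"
    using bounded_differences_mgf[of "\<lambda>_. \<nu>" "{1..m}" "1 / (t * p)" l stieltjes "1 / t", OF \<nu> _ c l _ sb stieltjes_diff]
      stieltjes_measurable unfolding stieltjes_mean_def P_def E_def cm by simp
  have 2: "(\<integral>\<^sup>+w. ennreal (exp (l * (- stieltjes w - (\<integral>w. - stieltjes w \<partial>P)))) \<partial>P) \<le> ennreal E"
    using bounded_differences_mgf[of "\<lambda>_. \<nu>" "{1..m}" "1 / (t * p)" l "\<lambda>w. - stieltjes w" "1 / t", OF \<nu> _ c l]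
      sb stieltjes_diff stieltjes_measurable unfolding P_def E_def cm by (simp add: abs_minus_commute)
  have "(\<integral>\<^sup>+w. ennreal (exp (l * \<bar>stieltjes w - stieltjes_mean\<bar>)) \<partial>P)
      \<le> (\<integral>\<^sup>+w. ennreal (exp (l * (stieltjes w - stieltjes_mean))) + ennreal (exp (l * (- stieltjes w - (\<integral>w. - stieltjes w \<partial>P)))) \<partial>P)"
  proof (rule nn_integral_mono)
    fix w
    have "exp (l * \<bar>u\<bar>) \<le> exp (l * u) + exp (l * (- u))" for u :: real
      by (cases "u \<ge> 0") auto
    from this[of "stieltjes w - stieltjes_mean"]
    show "ennreal (exp (l * \<bar>stieltjes w - stieltjes_mean\<bar>))
      \<le> ennreal (exp (l * (stieltjes w - stieltjes_mean))) + ennreal (exp (l * (- stieltjes w - (\<integral>w. - stieltjes w \<partial>P))))"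
      by (simp add: stieltjes_mean_def algebra_simps ennreal_leI flip: ennreal_plus)
  qed
  also have "\<dots> = (\<integral>\<^sup>+w. ennreal (exp (l * (stieltjes w - stieltjes_mean))) \<partial>P)
      + (\<integral>\<^sup>+w. ennreal (exp (l * (- stieltjes w - (\<integral>w. - stieltjes w \<partial>P)))) \<partial>P)"
    by (rule nn_integral_add) measurable
  also have "\<dots> \<le> ennreal E + ennreal E" by (rule add_mono[OF 1 2])
  also have "\<dots> = ennreal (2 * E)"
    unfolding mult_2 by (rule ennreal_plus[symmetric]) (simp_all add: E_def)
  finally show ?thesis unfolding E_def .
qed

text \<open>Chernoff's bound. When m is of order p the exponent is of order p as well.\<close>

lemma stieltjes_tail:
  assumes \<delta>: "\<delta> > 0"
  shows "P.prob {w \<in> space P. \<delta> \<le> \<bar>stieltjes w - stieltjes_mean\<bar>} \<le> 2 * exp (- (\<delta>\<^sup>2 * t\<^sup>2 * p\<^sup>2 / (2 * m)))"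
proof -
  \<comment> \<open>The minimiser of -l \<delta> + l^2 m / (2 t^2 p^2).\<close>
  define l where "l = \<delta> * t\<^sup>2 * p\<^sup>2 / m"
  have l: "l > 0" using \<delta> t p_pos m_pos by (simp add: l_def)
  have ex: "- (l * \<delta>) + l\<^sup>2 * (1 / (t * p))\<^sup>2 * m / 2 = - (\<delta>\<^sup>2 * t\<^sup>2 * p\<^sup>2 / (2 * m))"
    using t p_pos m_pos by (simp add: l_def field_simps power2_eq_square)
  have "emeasure P {w \<in> space P. \<delta> \<le> \<bar>stieltjes w - stieltjes_mean\<bar>}
      \<le> (\<integral>\<^sup>+w. ennreal (exp (- (l * \<delta>))) * ennreal (exp (l * \<bar>stieltjes w - stieltjes_mean\<bar>)) \<partial>P)"
  proof -
    have "emeasure P {w \<in> space P. \<delta> \<le> \<bar>stieltjes w - stieltjes_mean\<bar>}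
       = (\<integral>\<^sup>+w. indicator {w \<in> space P. \<delta> \<le> \<bar>stieltjes w - stieltjes_mean\<bar>} w \<partial>P)"
      by (rule nn_integral_indicator[symmetric]) measurable
    also have "\<dots> \<le> (\<integral>\<^sup>+w. ennreal (exp (- (l * \<delta>))) * ennreal (exp (l * \<bar>stieltjes w - stieltjes_mean\<bar>)) \<partial>P)"
    proof (rule nn_integral_mono)
      fix w
      show "indicator {w \<in> space P. \<delta> \<le> \<bar>stieltjes w - stieltjes_mean\<bar>} w
          \<le> ennreal (exp (- (l * \<delta>))) * ennreal (exp (l * \<bar>stieltjes w - stieltjes_mean\<bar>))"
      proof (cases "\<delta> \<le> \<bar>stieltjes w - stieltjes_mean\<bar>")
        case True
        then have "l * \<delta> \<le> l * \<bar>stieltjes w - stieltjes_mean\<bar>" using l by simp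
        then have "1 \<le> exp (- (l * \<delta>)) * exp (l * \<bar>stieltjes w - stieltjes_mean\<bar>)"
          by (simp flip: exp_add)
        then have "ennreal 1 \<le> ennreal (exp (- (l * \<delta>)) * exp (l * \<bar>stieltjes w - stieltjes_mean\<bar>))"
          by (rule ennreal_leI)
        also have "\<dots> = ennreal (exp (- (l * \<delta>))) * ennreal (exp (l * \<bar>stieltjes w - stieltjes_mean\<bar>))"
          by (rule ennreal_mult) simp_all
        finally show ?thesis by (auto simp: indicator_def)
      qed (simp add: indicator_def)
    qed
    finally show ?thesis .
  qed
  also have "\<dots> = ennreal (exp (- (l * \<delta>))) * (\<integral>\<^sup>+w. ennreal (exp (l * \<bar>stieltjes w - stieltjes_mean\<bar>)) \<partial>P)"
    by (rule nn_integral_cmult) measurable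
  also have "\<dots> \<le> ennreal (exp (- (l * \<delta>))) * ennreal (2 * exp (l\<^sup>2 * (1 / (t * p))\<^sup>2 * m / 2))"
    by (rule mult_left_mono[OF stieltjes_mgf[OF l]]) simp
  also have "\<dots> = ennreal (exp (- (l * \<delta>)) * (2 * exp (l\<^sup>2 * (1 / (t * p))\<^sup>2 * m / 2)))"
    by (rule ennreal_mult[symmetric]) simp_all
  also have "exp (- (l * \<delta>)) * (2 * exp (l\<^sup>2 * (1 / (t * p))\<^sup>2 * m / 2)) = 2 * exp (- (\<delta>\<^sup>2 * t\<^sup>2 * p\<^sup>2 / (2 * m)))"
    unfolding ex[symmetric] exp_add by simp
  finally show ?thesis
    unfolding P.emeasure_eq_measure by simp
qed

lemma stieltjes_mean_abs_dev: "(\<integral>w. \<bar>stieltjes w - stieltjes_mean\<bar> \<partial>P) \<le> 4 * sqrt m / (t * p)"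
proof -
  \<comment> \<open>This choice makes the exponent in the generating function 1/2. The bound then
    follows from |y| \<le> exp (l |y|) / l and 2 exp (1/2) \<le> 4.\<close>
  define l where "l = t * p / sqrt m"
  have l: "l > 0" using t p_pos m_pos by (simp add: l_def)
  have ex: "l\<^sup>2 * (1 / (t * p))\<^sup>2 * m / 2 = 1 / 2"
    using t p_pos m_pos by (simp add: l_def power_divide power_mult_distrib)
  have int: "integrable P (\<lambda>w. \<bar>stieltjes w - stieltjes_mean\<bar>)" using stieltjes_integrable by simp
  have "ennreal (\<integral>w. \<bar>stieltjes w - stieltjes_mean\<bar> \<partial>P) = (\<integral>\<^sup>+w. ennreal \<bar>stieltjes w - stieltjes_mean\<bar> \<partial>P)"
    by (rule nn_integral_eq_integral[symmetric, OF int]) simp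
  also have "\<dots> \<le> (\<integral>\<^sup>+w. ennreal (1 / l) * ennreal (exp (l * \<bar>stieltjes w - stieltjes_mean\<bar>)) \<partial>P)"
  proof (rule nn_integral_mono)
    fix w
    have "l * \<bar>stieltjes w - stieltjes_mean\<bar> \<le> exp (l * \<bar>stieltjes w - stieltjes_mean\<bar>)"
      using exp_ge_add_one_self[of "l * \<bar>stieltjes w - stieltjes_mean\<bar>"] by linarith
    then have "\<bar>stieltjes w - stieltjes_mean\<bar> \<le> 1 / l * exp (l * \<bar>stieltjes w - stieltjes_mean\<bar>)"
      using l by (simp add: field_simps)
    then have "ennreal \<bar>stieltjes w - stieltjes_mean\<bar> \<le> ennreal (1 / l * exp (l * \<bar>stieltjes w - stieltjes_mean\<bar>))"
      by (rule ennreal_leI)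
    also have "\<dots> = ennreal (1 / l) * ennreal (exp (l * \<bar>stieltjes w - stieltjes_mean\<bar>))"
      using l by (intro ennreal_mult) simp_all
    finally show "ennreal \<bar>stieltjes w - stieltjes_mean\<bar> \<le> ennreal (1 / l) * ennreal (exp (l * \<bar>stieltjes w - stieltjes_mean\<bar>))" .
  qed
  also have "\<dots> = ennreal (1 / l) * (\<integral>\<^sup>+w. ennreal (exp (l * \<bar>stieltjes w - stieltjes_mean\<bar>)) \<partial>P)"
    by (rule nn_integral_cmult) measurable
  also have "\<dots> \<le> ennreal (1 / l) * ennreal (2 * exp (1 / 2))"
    using stieltjes_mgf[OF l] unfolding ex by (rule mult_left_mono) simp
  also have "\<dots> = ennreal (1 / l * (2 * exp (1 / 2)))"
    using l by (intro ennreal_mult[symmetric]) simp_all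
  finally have "(\<integral>w. \<bar>stieltjes w - stieltjes_mean\<bar> \<partial>P) \<le> 1 / l * (2 * exp (1 / 2))"
    using l by (subst (asm) ennreal_le_iff) auto
  also have "\<dots> \<le> 1 / l * 4"
  proof -
    have "exp (1 / 2 :: real) \<le> 2" using exp_bound_half[of "1 / 2 :: real"] by simp
    then show ?thesis using l by (intro mult_left_mono) auto
  qed
  also have "\<dots> = 4 * sqrt m / (t * p)" by (simp add: l_def)
  finally show ?thesis .
qed

end

section \<open>The averaged equation\<close>

context iid_columns
begin

definition err :: "nat \<Rightarrow> (nat \<Rightarrow> 'i \<Rightarrow> real) \<Rightarrow> real" where
  "err k w = inner_on I (w k) (mult_vec I (Rk k w) (w k)) - trace_on I (Rk k w)"

lemma Rk_measurable:
  assumes "k \<in> {1..m}" "i \<in> I" "j \<in> I"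
  shows "(\<lambda>w. Rk k w i j) \<in> borel_measurable P"
  unfolding Rk_def P_def using others
  by (intro gram_resolvent_measurable column_measurable assms) auto

lemma err_measurable:
  assumes k: "k \<in> {1..m}"
  shows "err k \<in> borel_measurable P"
proof -
  have w: "(\<lambda>w. w k i) \<in> borel_measurable P" if "i \<in> I" for i
    unfolding P_def by (rule column_measurable[OF k that])
  show ?thesis
    unfolding err_def[abs_def] inner_on_def mult_vec_def trace_on_def
    by (intro borel_measurable_diff borel_measurable_sum borel_measurable_times w Rk_measurable k)
qed

text \<open>\<^term>\<open>Rk k w\<close> does not involve the column \<open>k\<close>, so by Fubini it may be treated as deterministic.\<close>

lemma err_nn_integral:
  assumes k: "k \<in> {1..m}"
  shows "(\<integral>\<^sup>+w. ennreal \<bar>err k w\<bar> \<partial>P) \<le> ennreal (\<eta> * p)"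
proof -
  define J where "J = {1..m} - {k}"
  have J: "insert k J = {1..m}" "k \<notin> J" "finite J" using k by (auto simp: J_def)
  interpret nu: prob_space \<nu> by (rule \<nu>)
  interpret product_sigma_finite "\<lambda>_::nat. \<nu>"
    by (simp add: product_sigma_finite_def nu.sigma_finite_measure_axioms)
  interpret PJ: prob_space "Pi\<^sub>M J (\<lambda>_. \<nu>)" by (rule prob_space_PiM) (rule \<nu>)
  have "(\<lambda>w. ennreal \<bar>err k w\<bar>) \<in> borel_measurable (Pi\<^sub>M (insert k J) (\<lambda>_. \<nu>))"
    using err_measurable[OF k] unfolding J(1) P_def by measurable
  then have "(\<integral>\<^sup>+w. ennreal \<bar>err k w\<bar> \<partial>P) = (\<integral>\<^sup>+w. \<integral>\<^sup>+y. ennreal \<bar>err k (w(k := y))\<bar> \<partial>\<nu> \<partial>Pi\<^sub>M J (\<lambda>_. \<nu>))"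
    unfolding P_def J(1)[symmetric] by (rule product_nn_integral_insert[OF J(3,2)])
  also have "\<dots> \<le> (\<integral>\<^sup>+w. ennreal (\<eta> * p) \<partial>Pi\<^sub>M J (\<lambda>_. \<nu>))"
  proof (rule nn_integral_mono)
    fix w :: "nat \<Rightarrow> 'i \<Rightarrow> real"
    define A where "A = Rk k w"
    have entries: "0 \<le> A i i" "A i i \<le> 1 / t" "(\<Sum>j\<in>I. (A i j)\<^sup>2) \<le> 1 / t\<^sup>2" if "i \<in> I" for i
      using resolvent_entries[OF I(1) a_nonneg t is_resolvent_Rk that] unfolding A_def by auto
    have A: "\<And>i. i \<in> I \<Longrightarrow> \<bar>A i i\<bar> \<le> 1 / t" "\<And>i. i \<in> I \<Longrightarrow> (\<Sum>j\<in>I. (A i j)\<^sup>2) \<le> (1 / t)\<^sup>2"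
      using entries by (simp_all add: power_divide)
    have "(\<integral>\<^sup>+y. ennreal \<bar>err k (w(k := y))\<bar> \<partial>\<nu>) = (\<integral>\<^sup>+y. ennreal \<bar>inner_on I y (mult_vec I A y) - trace_on I A\<bar> \<partial>\<nu>)"
      unfolding err_def Rk_fun_upd A_def by simp
    also have "\<dots> = ennreal (\<integral>y. \<bar>inner_on I y (mult_vec I A y) - trace_on I A\<bar> \<partial>\<nu>)"
      by (rule nn_integral_eq_integral) (use quad_int[OF A] in simp_all)
    also have "\<dots> \<le> ennreal (\<eta> * p)"
      unfolding p_def by (intro ennreal_leI quad A)
    finally show "(\<integral>\<^sup>+y. ennreal \<bar>err k (w(k := y))\<bar> \<partial>\<nu>) \<le> ennreal (\<eta> * p)" .
  qed
  also have "\<dots> = ennreal (\<eta> * p)" by (simp add: PJ.emeasure_space_1)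
  finally show ?thesis .
qed

text \<open>The sign of the error level is read off from the zero matrix.\<close>

lemma eta_p_nonneg: "0 \<le> \<eta> * p"
proof -
  have "0 \<le> (\<integral>y. \<bar>inner_on I y (mult_vec I (\<lambda>_ _. 0) y) - trace_on I (\<lambda>_ _. 0)\<bar> \<partial>\<nu>)" by simp
  also have "\<dots> \<le> \<eta> * p"
    unfolding p_def using t by (intro quad) auto
  finally show ?thesis .
qed

lemma err_integral:
  assumes k: "k \<in> {1..m}"
  shows "integrable P (\<lambda>w. \<bar>err k w\<bar>)" "(\<integral>w. \<bar>err k w\<bar> \<partial>P) \<le> \<eta> * p"
proof -
  show int: "integrable P (\<lambda>w. \<bar>err k w\<bar>)"
    using err_nn_integral[OF k] err_measurable[OF k]
    by (intro integrableI_nonneg) (auto intro: le_less_trans)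
  show "(\<integral>w. \<bar>err k w\<bar> \<partial>P) \<le> \<eta> * p"
    using err_nn_integral[OF k] nn_integral_eq_integral[OF int] eta_p_nonneg by simp
qed

text \<open>Each q_k is close to u = c times \<open>stieltjes_mean\<close>, and y / (1 + y) is
  1-Lipschitz on [0, \<infinity>). The three errors belong to the quadratic form (c \<eta>), to the
  omitted column (1/(t m)) and to the fluctuation of the trace (4/(t sqrt m)).\<close>

lemma self_consistent:
  defines "c \<equiv> p / m"
  shows "\<bar>c - t * c * stieltjes_mean - c * stieltjes_mean / (1 + c * stieltjes_mean)\<bar> \<le> c * \<eta> + 1 / (t * m) + 4 / (t * sqrt m)"
proof -
  define u where "u = c * stieltjes_mean"
  have u: "0 \<le> u" using stieltjes_mean_bounds p_pos m_pos by (simp add: u_def c_def)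
  define q where "q k w = a * inner_on I (w k) (mult_vec I (Rk k w) (w k))" for k w
  have q: "0 \<le> q k w" for k w
    unfolding q_def using a_nonneg by (intro mult_nonneg_nonneg resolvent_form_nonneg[OF I(1) a_nonneg t is_resolvent_Rk])
  have ap: "a * p = c" by (simp add: a_def c_def)
  have identity: "t * p * stieltjes w + (\<Sum>k\<in>{1..m}. q k w / (1 + q k w)) = p" for w
  proof -
    have "a * inner_on I (w k) (mult_vec I (R w) (w k)) = q k w / (1 + q k w)" if k: "k \<in> {1..m}" for k
    proof -
      have "inner_on I (w k) (mult_vec I (R w) (w k)) = inner_on I (w k) (mult_vec I (sm_update I a (w k) (Rk k w)) (w k))"
        unfolding inner_on_def mult_vec_def using R_eq_update[OF k] by (intro sum.cong refl) simp
      then show ?thesis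
        unfolding q_def using inner_on_sm_update[OF I(1) a_nonneg t is_resolvent_Rk, of "w k" k w] by simp
    qed
    then have "(\<Sum>k\<in>{1..m}. q k w / (1 + q k w)) = (\<Sum>k\<in>{1..m}. a * inner_on I (w k) (mult_vec I (R w) (w k)))"
      by (intro sum.cong refl) simp
    moreover have "t * trace_on I (R w) + (\<Sum>k\<in>{1..m}. a * inner_on I (w k) (mult_vec I (R w) (w k))) = p"
      using resolvent_trace_identity[OF I(1) a_nonneg t is_resolvent_R] unfolding p_def .
    moreover have "trace_on I (R w) = p * stieltjes w" using p_pos by (simp add: stieltjes_def)
    ultimately show ?thesis by (simp add: mult.assoc)
  qed
  define b where "b k w = a * \<bar>err k w\<bar> + a / t + c * \<bar>stieltjes w - stieltjes_mean\<bar>" for k w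
  have close: "\<bar>q k w / (1 + q k w) - u / (1 + u)\<bar> \<le> b k w" if k: "k \<in> {1..m}" for k w
  proof -
    have "q k w / (1 + q k w) - u / (1 + u) = (q k w - u) / ((1 + q k w) * (1 + u))"
    proof -
      have "1 + q k w \<noteq> 0" "1 + u \<noteq> 0" using q[of k w] u by linarith+
      then have "q k w / (1 + q k w) - u / (1 + u) = (q k w * (1 + u) - u * (1 + q k w)) / ((1 + q k w) * (1 + u))"
        by (rule diff_frac_eq)
      also have "q k w * (1 + u) - u * (1 + q k w) = q k w - u" by (simp add: algebra_simps)
      finally show ?thesis .
    qed
    moreover have "\<bar>(q k w - u) / ((1 + q k w) * (1 + u))\<bar> \<le> \<bar>q k w - u\<bar>"
    proof -
      have "1 * 1 \<le> (1 + q k w) * (1 + u)" using q[of k w] u by (intro mult_mono) auto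
      then have "\<bar>q k w - u\<bar> / ((1 + q k w) * (1 + u)) \<le> \<bar>q k w - u\<bar> / 1"
        by (intro divide_left_mono) auto
      then show ?thesis using q[of k w] u by (simp add: abs_mult)
    qed
    moreover have "\<bar>q k w - u\<bar> \<le> b k w"
    proof -
      have trR: "trace_on I (R w) = p * stieltjes w" using p_pos by (simp add: stieltjes_def)
      \<comment> \<open>Quadratic form against trace, trace without against trace with column k, and
        trace against its mean.\<close>
      have "q k w - u = a * err k w + a * (trace_on I (Rk k w) - trace_on I (R w)) + c * (stieltjes w - stieltjes_mean)"
        unfolding q_def err_def u_def trR ap[symmetric] by (simp add: algebra_simps)
      moreover have "\<bar>a * err k w\<bar> = a * \<bar>err k w\<bar>" using a_nonneg by (simp add: abs_mult)
      moreover have "\<bar>a * (trace_on I (Rk k w) - trace_on I (R w))\<bar> \<le> a / t"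
      proof -
        have "\<bar>trace_on I (Rk k w) - trace_on I (R w)\<bar> \<le> 1 / t" using trace_R_bounds[OF k, of w] by linarith
        then have "a * \<bar>trace_on I (Rk k w) - trace_on I (R w)\<bar> \<le> a * (1 / t)" using a_nonneg by (rule mult_left_mono)
        then show ?thesis using a_nonneg by (simp add: abs_mult)
      qed
      moreover have "\<bar>c * (stieltjes w - stieltjes_mean)\<bar> = c * \<bar>stieltjes w - stieltjes_mean\<bar>"
        using p_pos m_pos by (simp add: abs_mult c_def)
      ultimately show ?thesis unfolding b_def by linarith
    qed
    ultimately show ?thesis by linarith
  qed
  have pointwise: "\<bar>p - t * p * stieltjes w - m * (u / (1 + u))\<bar> \<le> (\<Sum>k\<in>{1..m}. b k w)" for w
  proof -
    have "p - t * p * stieltjes w - m * (u / (1 + u)) = (\<Sum>k\<in>{1..m}. q k w / (1 + q k w) - u / (1 + u))"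
      using identity[of w] by (simp add: sum_subtractf)
    also have "\<bar>\<dots>\<bar> \<le> (\<Sum>k\<in>{1..m}. b k w)"
      by (rule order_trans[OF sum_abs sum_mono]) (rule close)
    finally show ?thesis .
  qed
  have b_int: "integrable P (b k)" if "k \<in> {1..m}" for k
    unfolding b_def[abs_def] using err_integral(1)[OF that] stieltjes_integrable by simp
  have Eb: "integral\<^sup>L P (b k) \<le> a * (\<eta> * p) + a / t + c * (4 * sqrt m / (t * p))" if k: "k \<in> {1..m}" for k
  proof -
    have "integral\<^sup>L P (b k) = a * (\<integral>w. \<bar>err k w\<bar> \<partial>P) + a / t + c * (\<integral>w. \<bar>stieltjes w - stieltjes_mean\<bar> \<partial>P)"
      unfolding b_def[abs_def] using err_integral(1)[OF k] stieltjes_integrable by (simp add: P.prob_space)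
    also have "\<dots> \<le> a * (\<eta> * p) + a / t + c * (4 * sqrt m / (t * p))"
      using a_nonneg p_pos m_pos
      by (intro add_mono mult_left_mono err_integral(2)[OF k] stieltjes_mean_abs_dev) (auto simp: c_def)
    finally show ?thesis .
  qed
  have "\<bar>p - t * p * stieltjes_mean - m * (u / (1 + u))\<bar> = \<bar>\<integral>w. p - t * p * stieltjes w - m * (u / (1 + u)) \<partial>P\<bar>"
    using stieltjes_integrable by (simp add: P.prob_space stieltjes_mean_def)
  also have "\<dots> \<le> (\<integral>w. \<bar>p - t * p * stieltjes w - m * (u / (1 + u))\<bar> \<partial>P)"
    by (rule integral_abs_bound)
  also have "\<dots> \<le> (\<integral>w. (\<Sum>k\<in>{1..m}. b k w) \<partial>P)"
    using stieltjes_integrable by (intro integral_mono pointwise Bochner_Integration.integrable_sum b_int) auto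
  also have "\<dots> = (\<Sum>k\<in>{1..m}. integral\<^sup>L P (b k))"
    by (rule Bochner_Integration.integral_sum[OF b_int])
  also have "\<dots> \<le> (\<Sum>k\<in>{1..m}. a * (\<eta> * p) + a / t + c * (4 * sqrt m / (t * p)))"
    by (rule sum_mono[OF Eb])
  also have "\<dots> = m * (a * (\<eta> * p) + a / t + c * (4 * sqrt m / (t * p)))" by simp
  finally have "\<bar>p - t * p * stieltjes_mean - m * (u / (1 + u))\<bar> / m
      \<le> a * (\<eta> * p) + a / t + c * (4 * sqrt m / (t * p))"
    using m_pos by (simp add: divide_le_eq mult.commute)
  moreover have "\<bar>p - t * p * stieltjes_mean - m * (u / (1 + u))\<bar> / m = \<bar>c - t * c * stieltjes_mean - u / (1 + u)\<bar>"
  proof -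
    have "(p - t * p * stieltjes_mean - m * (u / (1 + u))) / m = c - t * c * stieltjes_mean - u / (1 + u)"
      using m_pos by (simp add: c_def diff_divide_distrib)
    then show ?thesis using m_pos by (metis abs_divide abs_of_pos)
  qed
  moreover have "a * (\<eta> * p) + a / t + c * (4 * sqrt m / (t * p)) = c * \<eta> + 1 / (t * m) + 4 / (t * sqrt m)"
  proof -
    have "c * (4 * sqrt m / (t * p)) = 4 * (sqrt m / m) / t" using p_pos by (simp add: c_def)
    also have "sqrt m / m = 1 / sqrt m"
    proof -
      have "x / (x * x) = 1 / x" if "x > 0" for x :: real using that by simp
      from this[of "sqrt m"] show ?thesis using m_pos by (simp only: real_sqrt_mult_self abs_of_nat real_sqrt_gt_zero)
    qed
    finally show ?thesis by (simp add: a_def c_def mult.commute)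
  qed
  ultimately show ?thesis by (simp add: u_def)
qed

end

section \<open>The limiting quadratic equation and its stability\<close>

text \<open>The radicand (1 + c + t)^2 - 4c equals the discriminant (t + 1 - c)^2 + 4ct, so the
  value found for the transform of the law is the positive root.\<close>

lemma MP_root:
  fixes c t :: real
  assumes c: "c > 0" and t: "t > 0"
  defines "s \<equiv> (c - 1 - t + sqrt ((1 + c + t)\<^sup>2 - 4 * c)) / (2 * c * t)"
  shows "s > 0" "c * t * s\<^sup>2 + (t + 1 - c) * s = 1"
proof -
  define r where "r = sqrt ((1 + c + t)\<^sup>2 - 4 * c)"
  have D: "(1 + c + t)\<^sup>2 - 4 * c = (t + 1 - c)\<^sup>2 + 4 * (c * t)"
    by (simp add: power2_eq_square algebra_simps)
  have ct: "c * t > 0" using c t by simp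
  have r2: "r\<^sup>2 = (t + 1 - c)\<^sup>2 + 4 * (c * t)"
    unfolding r_def D using ct by simp
  have "\<bar>t + 1 - c\<bar> < r"
    unfolding r_def D real_sqrt_abs[symmetric] using ct by (intro real_sqrt_less_mono) simp
  then have "c - 1 - t + r > 0" by linarith
  then show "s > 0" unfolding s_def r_def[symmetric] using ct by simp
  have s: "2 * (c * t) * s = r - (t + 1 - c)"
    unfolding s_def r_def[symmetric] using c t by simp
  have "4 * (c * t) * (c * t * s\<^sup>2 + (t + 1 - c) * s) = (2 * (c * t) * s) * (2 * (c * t) * s + 2 * (t + 1 - c))"
    by (simp add: power2_eq_square algebra_simps)
  also have "\<dots> = r\<^sup>2 - (t + 1 - c)\<^sup>2"
    unfolding s by (simp add: power2_eq_square algebra_simps)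
  also have "\<dots> = 4 * (c * t) * 1" unfolding r2 by simp
  finally show "c * t * s\<^sup>2 + (t + 1 - c) * s = 1"
    using ct by (subst (asm) mult_cancel_left) auto
qed

text \<open>Clearing the denominator turns the approximate equation into a small value of the
  quadratic at f. As s is a root, the quadratic factors as (f - s) D with D \<ge> 1/s for f \<ge> 0,
  so |f - s| is at most s times that value.\<close>

lemma self_consistent_limit:
  fixes c t s :: real and cn f e :: "nat \<Rightarrow> real"
  assumes c: "c > 0" and t: "t > 0" and s: "s > 0" "c * t * s\<^sup>2 + (t + 1 - c) * s = 1"
    and cn: "cn \<longlonglongrightarrow> c" and e: "e \<longlonglongrightarrow> 0"
    and f: "\<forall>\<^sub>F n in sequentially. 0 < cn n \<and> 0 \<le> f n \<and> f n \<le> 1 / t \<and>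
      \<bar>cn n - t * cn n * f n - cn n * f n / (1 + cn n * f n)\<bar> \<le> e n"
  shows "f \<longlonglongrightarrow> s"
proof -
  define h where "h n = s * (e n * (1 + cn n / t) / cn n + \<bar>cn n - c\<bar> * (1 / t + 1 / t))" for n
  have bound: "\<forall>\<^sub>F n in sequentially. norm (f n - s) \<le> h n"
    using f
  proof eventually_elim
    case (elim n)
    define C F where "C = cn n" and "F = f n"
    have C: "0 < C" and F: "0 \<le> F" "F \<le> 1 / t" and err: "\<bar>C - t * C * F - C * F / (1 + C * F)\<bar> \<le> e n"
      using elim by (auto simp: C_def F_def)
    have CF: "0 \<le> C * F" using C F by simp
    have tF: "t * F \<le> 1" using F t by (simp add: field_simps)
    define g where "g = C * t * F\<^sup>2 + (t + 1 - C) * F - 1"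
    have "(C - t * C * F - C * F / (1 + C * F)) * (1 + C * F) = - (C * g)"
    proof -
      have "C * F / (1 + C * F) * (1 + C * F) = C * F" using CF by simp
      then show ?thesis
        by (simp only: left_diff_distrib) (simp add: g_def power2_eq_square algebra_simps)
    qed
    then have "\<bar>C * g\<bar> = \<bar>C - t * C * F - C * F / (1 + C * F)\<bar> * (1 + C * F)"
    proof -
      assume eq: "(C - t * C * F - C * F / (1 + C * F)) * (1 + C * F) = - (C * g)"
      have "\<bar>C * g\<bar> = \<bar>- (C * g)\<bar>" by simp
      also have "\<dots> = \<bar>C - t * C * F - C * F / (1 + C * F)\<bar> * \<bar>1 + C * F\<bar>"
        unfolding eq[symmetric] by (rule abs_mult)
      also have "\<bar>1 + C * F\<bar> = 1 + C * F" using CF by simp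
      finally show ?thesis .
    qed
    also have "\<dots> \<le> e n * (1 + C / t)"
    proof (intro mult_mono err)
      show "1 + C * F \<le> 1 + C / t" using mult_left_mono[OF F(2), of C] C by simp
      show "0 \<le> e n" by (rule order_trans[OF abs_ge_zero err])
    qed (use CF in simp)
    finally have "C * \<bar>g\<bar> \<le> e n * (1 + C / t)" using C by (simp add: abs_mult)
    then have g: "\<bar>g\<bar> \<le> e n * (1 + C / t) / C" using C by (simp add: le_divide_eq mult.commute)
    \<comment> \<open>\<open>g\<close> has the coefficients at stage n, \<open>g'\<close> the
      limiting ones; their difference is controlled by |C - c|.\<close>
    define g' where "g' = c * t * F\<^sup>2 + (t + 1 - c) * F - 1"
    have "g' - g = (c - C) * (F * (t * F) - F)"
      by (simp add: g_def g'_def power2_eq_square algebra_simps)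
    then have "\<bar>g' - g\<bar> = \<bar>C - c\<bar> * \<bar>F * (t * F) - F\<bar>"
      by (simp add: abs_mult abs_minus_commute)
    also have "\<dots> \<le> \<bar>C - c\<bar> * (1 / t + 1 / t)"
    proof (rule mult_left_mono)
      have "F * (t * F) \<le> F * 1" using tF F by (intro mult_left_mono) auto
      moreover have "0 \<le> F * (t * F)" using F t by simp
      moreover have "0 \<le> 1 / t" using t by simp
      ultimately show "\<bar>F * (t * F) - F\<bar> \<le> 1 / t + 1 / t" using F by linarith
    qed simp
    finally have g': "\<bar>g'\<bar> \<le> e n * (1 + C / t) / C + \<bar>C - c\<bar> * (1 / t + 1 / t)" using g by linarith
    define D where "D = c * t * (F + s) + (t + 1 - c)"
    have "g' = (F - s) * D"
      using s(2) by (simp add: g'_def D_def power2_eq_square algebra_simps)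
    moreover have D: "1 / s \<le> D"
    proof -
      have "s * (c * t * s + (t + 1 - c)) = 1" using s(2) by (simp add: power2_eq_square algebra_simps)
      then have "1 / s = c * t * s + (t + 1 - c)" using s(1) by (simp add: field_simps)
      moreover have "0 \<le> c * t * F" using c t F by simp
      ultimately show ?thesis by (simp add: D_def algebra_simps)
    qed
    ultimately have "\<bar>F - s\<bar> * (1 / s) \<le> \<bar>g'\<bar>"
    proof -
      have "0 < D" using D s(1) by (meson less_le_trans zero_less_divide_1_iff)
      then have "\<bar>g'\<bar> = \<bar>F - s\<bar> * D" using \<open>g' = (F - s) * D\<close> by (simp add: abs_mult)
      then show ?thesis using mult_left_mono[OF D, of "\<bar>F - s\<bar>"] by simp
    qed
    then have "\<bar>F - s\<bar> \<le> s * \<bar>g'\<bar>" using s(1) by (simp add: field_simps)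
    also have "\<dots> \<le> h n"
      unfolding h_def C_def[symmetric] using g' s(1) by (intro mult_left_mono) auto
    finally show ?case by (simp add: F_def)
  qed
  have "h \<longlonglongrightarrow> s * (0 * (1 + c / t) / c + \<bar>c - c\<bar> * (1 / t + 1 / t))"
    unfolding h_def[abs_def] using c t by (intro tendsto_intros e cn) auto
  then have "h \<longlonglongrightarrow> 0" by simp
  from Lim_null_comparison[OF bound this] show ?thesis
    by (rule LIM_zero_cancel)
qed

section \<open>Almost sure convergence\<close>

lemma (in tensor_moments) PrincipalT_quadratic_form:
  fixes A :: "nat set \<Rightarrow> nat set \<Rightarrow> real"
  assumes "\<And>i. i \<in> I \<Longrightarrow> \<bar>A i i\<bar> \<le> s" "\<And>i. i \<in> I \<Longrightarrow> (\<Sum>j\<in>I. (A i j)\<^sup>2) \<le> s\<^sup>2" "0 \<le> s"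
  shows "integrable (PrincipalT n d N X) (\<lambda>y. inner_on I y (mult_vec I A y) - trace_on I A)"
    and "(\<integral>y. \<bar>inner_on I y (mult_vec I A y) - trace_on I A\<bar> \<partial>PrincipalT n d N X)
      \<le> s * sqrt (2 * \<bar>sq_moment {1..2 * d} - 2 * sq_moment {1..d} + 1\<bar> + 12 * B * d\<^sup>2 / n) * card I"
proof -
  have meas: "(\<lambda>w. \<lambda>i\<in>I. tensor i w) \<in> N \<rightarrow>\<^sub>M Pi\<^sub>M I (\<lambda>_. borel)"
    using PrincipalT_measurable[OF rv, of d] by (simp add: tensor_def)
  have law: "PrincipalT n d N X = distr N (Pi\<^sub>M I (\<lambda>_. borel)) (\<lambda>w. \<lambda>i\<in>I. tensor i w)"
    by (simp add: PrincipalT_def tensor_def)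
  have c: "(\<lambda>y. y i) \<in> borel_measurable (Pi\<^sub>M I (\<lambda>_. borel :: real measure))" if "i \<in> I" for i
    by (rule measurable_component_singleton[OF that])
  have qm: "(\<lambda>y. inner_on I y (mult_vec I A y) - trace_on I A) \<in> borel_measurable (Pi\<^sub>M I (\<lambda>_. borel))"
    unfolding inner_on_def mult_vec_def
    by (intro borel_measurable_diff borel_measurable_sum borel_measurable_times borel_measurable_const c)
  have eq: "inner_on I (\<lambda>i\<in>I. tensor i w) (mult_vec I A (\<lambda>i\<in>I. tensor i w)) = inner_on I (\<lambda>i. tensor i w) (mult_vec I A (\<lambda>i. tensor i w))" for w
    by (simp add: inner_on_def mult_vec_def)
  note conc = quadratic_form_concentration[OF assms]
  show "integrable (PrincipalT n d N X) (\<lambda>y. inner_on I y (mult_vec I A y) - trace_on I A)"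
    unfolding law integrable_distr_eq[OF meas qm] eq by (rule conc(1))
  have "(\<lambda>y. \<bar>inner_on I y (mult_vec I A y) - trace_on I A\<bar>) \<in> borel_measurable (Pi\<^sub>M I (\<lambda>_. borel))"
    using qm by simp
  from integral_distr[OF meas this]
  show "(\<integral>y. \<bar>inner_on I y (mult_vec I A y) - trace_on I A\<bar> \<partial>PrincipalT n d N X)
      \<le> s * sqrt (2 * \<bar>sq_moment {1..2 * d} - 2 * sq_moment {1..d} + 1\<bar> + 12 * B * d\<^sup>2 / n) * card I"
    using conc(2) unfolding law eq by (simp add: p_def mult_ac)
qed

section \<open>Borel-Cantelli and transfer to the sample space\<close>

text \<open>Borel-Cantelli for each \<delta> = 1/(j + 1). Nothing is assumed about the joint law of
  the Z n, only summable tails from some index on.\<close>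

lemma AE_tendsto_zero:
  fixes Z :: "nat \<Rightarrow> 'a \<Rightarrow> real"
  assumes M: "prob_space M"
    and tail: "\<And>\<delta>. \<delta> > 0 \<Longrightarrow> \<exists>\<kappa>::real. \<kappa> > 0 \<and> (\<forall>\<^sub>F n in sequentially.
        {w \<in> space M. \<delta> \<le> \<bar>Z n w\<bar>} \<in> sets M \<and> measure M {w \<in> space M. \<delta> \<le> \<bar>Z n w\<bar>} \<le> 2 * exp (- \<kappa> * real n))"
  shows "AE w in M. (\<lambda>n. Z n w) \<longlonglongrightarrow> 0"
proof -
  interpret prob_space M by fact
  have ev: "AE w in M. \<forall>\<^sub>F n in sequentially. \<bar>Z n w\<bar> < \<delta>" if \<delta>: "\<delta> > 0" for \<delta>
  proof -
    obtain \<kappa> :: real where \<kappa>: "\<kappa> > 0" and ev: "\<forall>\<^sub>F n in sequentially.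
        {w \<in> space M. \<delta> \<le> \<bar>Z n w\<bar>} \<in> sets M \<and> measure M {w \<in> space M. \<delta> \<le> \<bar>Z n w\<bar>} \<le> 2 * exp (- \<kappa> * real n)"
      using tail[OF \<delta>] by blast
    from ev obtain n0 where n0: "\<And>n. n \<ge> n0 \<Longrightarrow> {w \<in> space M. \<delta> \<le> \<bar>Z n w\<bar>} \<in> sets M \<and>
        measure M {w \<in> space M. \<delta> \<le> \<bar>Z n w\<bar>} \<le> 2 * exp (- \<kappa> * real n)"
      unfolding eventually_sequentially by blast
    \<comment> \<open>Finitely many events of unknown measurability are replaced by the empty
      set.\<close>
    define A where "A n = (if n \<ge> n0 then {w \<in> space M. \<delta> \<le> \<bar>Z n w\<bar>} else {})" for n
    have "exp (- \<kappa>) < 1" using \<kappa> by simp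
    then have "summable (\<lambda>n. 2 * exp (- \<kappa>) ^ n)"
      by (intro summable_mult summable_geometric) simp
    moreover have "norm (measure M (A n)) \<le> 2 * exp (- \<kappa>) ^ n" for n
    proof (cases "n \<ge> n0")
      case True
      have "exp (- \<kappa>) ^ n = exp (- \<kappa> * n)"
        by (simp add: exp_of_nat_mult[symmetric] mult.commute)
      then show ?thesis using n0[OF True] True by (simp add: A_def)
    qed (simp add: A_def)
    ultimately have "summable (\<lambda>n. measure M (A n))"
      by (rule summable_comparison_test'[where N=0])
    moreover have "A n \<in> sets M" for n using n0 by (simp add: A_def)
    ultimately have "AE w in M. \<forall>\<^sub>F n in sequentially. w \<in> space M - A n"
      by (intro borel_cantelli_AE1) (auto simp: emeasure_eq_measure)
    then show ?thesis
    proof (rule AE_mp, intro AE_I2 impI)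
      fix w assume "w \<in> space M" "\<forall>\<^sub>F n in sequentially. w \<in> space M - A n"
      from this(2) eventually_ge_at_top[of n0] show "\<forall>\<^sub>F n in sequentially. \<bar>Z n w\<bar> < \<delta>"
        by eventually_elim (auto simp: A_def not_le)
    qed
  qed
  have "AE w in M. \<forall>j. \<forall>\<^sub>F n in sequentially. \<bar>Z n w\<bar> < inverse (real (Suc j))"
    unfolding AE_all_countable by (intro allI ev) simp
  then show ?thesis
  proof (rule AE_mp, intro AE_I2 impI)
    fix w assume Z: "\<forall>j. \<forall>\<^sub>F n in sequentially. \<bar>Z n w\<bar> < inverse (real (Suc j))"
    show "(\<lambda>n. Z n w) \<longlonglongrightarrow> 0"
    proof (rule tendstoI)
      fix e :: real assume "e > 0"
      then obtain j where j: "inverse (real (Suc j)) < e" using reals_Archimedean by blast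
      show "\<forall>\<^sub>F n in sequentially. dist (Z n w) 0 < e"
        using Z[rule_format, of j] by eventually_elim (use j in \<open>simp add: dist_real_def\<close>)
    qed
  qed
qed

text \<open>From d C(n, d) = n C(n-1, d-1) \<ge> n. Linear growth of p already makes tails of order
  exp (- const p) summable in n.\<close>

lemma binomial_ge_ratio:
  assumes "1 \<le> d" "d \<le> n"
  shows "real n / real d \<le> real (n choose d)"
proof -
  have "1 \<le> (n - 1) choose (d - 1)" using assms by (simp add: Suc_leI zero_less_binomial_iff)
  then have "n * 1 \<le> n * ((n - 1) choose (d - 1))" by (rule mult_left_mono) simp
  also have "\<dots> = d * (n choose d)" using binomial_absorption[of "d - 1" n] assms by simp
  finally have "n \<le> d * (n choose d)" by simp
  then have "real n \<le> real (d * (n choose d))" by (rule of_nat_mono)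
  then show ?thesis using assms by (simp add: divide_le_eq mult.commute)
qed

text \<open>Independence and equal laws make the joint law of the columns the product measure on
  which the bounds were proved, for one n at a time.\<close>

lemma (in iid_columns) sample_tail:
  fixes M :: "'z measure" and x :: "nat \<Rightarrow> 'z \<Rightarrow> 'i \<Rightarrow> real"
  assumes M: "prob_space M"
    and indep: "prob_space.indep_vars M (\<lambda>_. Pi\<^sub>M I (\<lambda>_. borel)) x {1..m}"
    and law: "\<And>k. k \<in> {1..m} \<Longrightarrow> distr M (Pi\<^sub>M I (\<lambda>_. borel)) (x k) = \<nu>"
    and \<delta>: "\<delta> > 0"
  defines "F \<equiv> {w \<in> space M. \<delta> \<le> \<bar>trace_on I (gram_resolvent I (1 / m) t (\<lambda>k. x k w) [1..<Suc m]) / card I - stieltjes_mean\<bar>}"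
  shows "F \<in> sets M" "measure M F \<le> 2 * exp (- (\<delta>\<^sup>2 * t\<^sup>2 * p\<^sup>2 / (2 * m)))"
proof -
  interpret M: prob_space M by fact
  define Y where "Y w = (\<lambda>k\<in>{1..m}. x k w)" for w
  have rv: "x k \<in> M \<rightarrow>\<^sub>M Pi\<^sub>M I (\<lambda>_. borel)" if "k \<in> {1..m}" for k
    using indep that unfolding M.indep_vars_def by blast
  have Y: "Y \<in> M \<rightarrow>\<^sub>M Pi\<^sub>M {1..m} (\<lambda>_. Pi\<^sub>M I (\<lambda>_. borel))"
    unfolding Y_def[abs_def] by (intro measurable_restrict rv)
  have "{1..m} \<noteq> {}" using m by auto
  then have "distr M (Pi\<^sub>M {1..m} (\<lambda>_. Pi\<^sub>M I (\<lambda>_. borel))) Y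
      = Pi\<^sub>M {1..m} (\<lambda>k. distr M (Pi\<^sub>M I (\<lambda>_. borel)) (x k))"
    unfolding Y_def[abs_def] by (rule M.indep_vars_iff_distr_eq_PiM'[OF _ rv, THEN iffD1, OF _ _ indep])
  also have "\<dots> = P"
    unfolding P_def by (rule PiM_cong[OF refl law])
  finally have dist: "distr M (Pi\<^sub>M {1..m} (\<lambda>_. Pi\<^sub>M I (\<lambda>_. borel))) Y = P" .
  define G where "G = {w \<in> space P. \<delta> \<le> \<bar>stieltjes w - stieltjes_mean\<bar>}"
  have G: "G \<in> sets P" unfolding G_def by measurable
  have YP: "Y \<in> M \<rightarrow>\<^sub>M P" using Y unfolding dist[symmetric] by simp
  have eq: "stieltjes (Y w) = trace_on I (gram_resolvent I (1 / m) t (\<lambda>k. x k w) [1..<Suc m]) / card I" for w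
  proof -
    have "R (Y w) = gram_resolvent I (1 / m) t (\<lambda>k. x k w) [1..<Suc m]"
      unfolding R_def a_def
      by (rule gram_resolvent_cong) (simp add: Y_def atLeastLessThanSuc_atLeastAtMost del: upt_Suc)
    then show ?thesis by (simp add: stieltjes_def p_def)
  qed
  have F: "F = Y -` G \<inter> space M"
  proof -
    have "Y w \<in> space P" if "w \<in> space M" for w using measurable_space[OF YP that] .
    then show ?thesis unfolding F_def G_def vimage_def eq[symmetric] by blast
  qed
  show "F \<in> sets M" unfolding F by (rule measurable_sets[OF YP G])
  have "G \<in> sets (Pi\<^sub>M {1..m} (\<lambda>_. Pi\<^sub>M I (\<lambda>_. borel)))"
    using G unfolding dist[symmetric] by simp
  from measure_distr[OF Y this] have "measure M F = measure P G"
    unfolding F dist by (rule sym)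
  then show "measure M F \<le> 2 * exp (- (\<delta>\<^sup>2 * t\<^sup>2 * p\<^sup>2 / (2 * m)))"
    using stieltjes_tail[OF \<delta>] by (simp add: G_def)
qed

text \<open>The spaces \<open>N n\<close> serve only to describe the laws of the vectors, while
  \<open>M\<close> carries all samples. Columns are independent for each n, with nothing assumed
  across different n.\<close>

theorem theorem2p2:
  fixes d :: nat and c :: real and m :: "nat \<Rightarrow> nat"
    and N :: "nat \<Rightarrow> 'b measure" and X :: "nat \<Rightarrow> nat \<Rightarrow> 'b \<Rightarrow> real"
    and M :: "'a measure" and x :: "nat \<Rightarrow> nat \<Rightarrow> 'a \<Rightarrow> nat set \<Rightarrow> real"
  assumes d: "d \<ge> 1"
    and X: "\<And>n. random_vector n (N n) (X n)"
    and exch: "\<And>n. exchangeable n (N n) (X n)"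
    and uncond: "\<And>n. unconditional n (N n) (X n)"
    and c: "c > 0"
    and m: "(\<lambda>n. real (n choose d) / real (m (n choose d))) \<longlonglongrightarrow> c"
    and M: "prob_space M"
    and indep: "\<And>n. prob_space.indep_vars M (\<lambda>_. Pi\<^sub>M (nsets {1..n} d) (\<lambda>_. borel)) (x n)
                      {1..m (n choose d)}"
    and law: "\<And>n k. k \<in> {1..m (n choose d)} \<Longrightarrow>
                distr M (Pi\<^sub>M (nsets {1..n} d) (\<lambda>_. borel)) (x n k) = PrincipalT n d (N n) (X n)"
    and a: "(\<lambda>n. \<integral>\<omega>. (X n 1 \<omega>)\<^sup>2 \<partial>N n) \<longlonglongrightarrow> 1"
    and b: "(\<lambda>n. (\<integral>\<omega>. (X n 1 \<omega>)\<^sup>2 * (X n 2 \<omega>)\<^sup>2 \<partial>N n)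
                 - (\<integral>\<omega>. (X n 1 \<omega>)\<^sup>2 \<partial>N n) * (\<integral>\<omega>. (X n 2 \<omega>)\<^sup>2 \<partial>N n)) \<longlonglongrightarrow> 0"
    and c_moment: "\<exists>e>0. (SUP n\<in>{1..}. \<integral>\<^sup>+\<omega>. ennreal (\<bar>X n 1 \<omega>\<bar> powr (4 * real d + e)) \<partial>N n) < \<infinity>"
  shows "(\<exists>L :: nat \<Rightarrow> real.
            (\<lambda>n. L n * (real d)\<^sup>2 / real n) \<longlonglongrightarrow> 0
          \<and> (\<lambda>n. \<integral>\<omega>. (\<Prod>i\<in>{1..d}. (X n i \<omega>)\<^sup>2) \<partial>N n) \<longlonglongrightarrow> 1
          \<and> (\<lambda>n. (\<integral>\<omega>. (\<Prod>i\<in>{1..2*d}. (X n i \<omega>)\<^sup>2) \<partial>N n)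
                   - (\<integral>\<omega>. (\<Prod>i\<in>{1..d}. (X n i \<omega>)\<^sup>2) \<partial>N n)\<^sup>2) \<longlonglongrightarrow> 0
          \<and> (\<forall>\<^sub>F n in sequentially. \<forall>r\<in>{1..d}.
                (\<integral>\<omega>. (\<Prod>i\<in>{1..r}. (X n i \<omega>) ^ 4) * (\<Prod>i\<in>{r+1..2*d-r}. (X n i \<omega>)\<^sup>2) \<partial>N n)
                  \<le> L n ^ r))
       \<and> (AE \<omega> in M. weak_conv_m
            (\<lambda>n. ESD (sample_cov (nsets {1..n} d) (m (n choose d)) (\<lambda>k. x n k \<omega>)))
            (marchenko_pastur c))"
proof -
  obtain \<epsilon> where \<epsilon>: "\<epsilon> > 0" and
    fin: "(SUP n\<in>{1..}. \<integral>\<^sup>+w. ennreal (\<bar>X n 1 w\<bar> powr (4 * real d + \<epsilon>)) \<partial>N n) < \<infinity>"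
    using c_moment by blast
  define C where "C = enn2real (SUP n\<in>{1..}. \<integral>\<^sup>+w. ennreal (\<bar>X n 1 w\<bar> powr (4 * real d + \<epsilon>)) \<partial>N n)"
  have em: "exchangeable_moments n (N n) (X n) (4 * d) \<epsilon> C" if "1 \<le> n" for n
  proof
    have "(\<integral>\<^sup>+w. ennreal (\<bar>X n 1 w\<bar> powr (4 * real d + \<epsilon>)) \<partial>N n)
        \<le> (SUP n\<in>{1..}. \<integral>\<^sup>+w. ennreal (\<bar>X n 1 w\<bar> powr (4 * real d + \<epsilon>)) \<partial>N n)"
      using that by (intro SUP_upper) simp
    also have "\<dots> = ennreal C"
      unfolding C_def using fin by (intro ennreal_enn2real[symmetric]) simp
    finally show "(\<integral>\<^sup>+w. ennreal (\<bar>X n 1 w\<bar> powr (real (4 * d) + \<epsilon>)) \<partial>N n) \<le> ennreal C" by simp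
    show "0 \<le> C" by (simp add: C_def)
  qed (use X exch that \<epsilon> in auto)
  have tm: "tensor_moments n (N n) (X n) d \<epsilon> C" if "2 * d \<le> n" for n
    using em[of n] that d uncond by (simp add: tensor_moments_def tensor_moments_axioms_def)
  define E where "E n U = (\<integral>w. (\<Prod>\<alpha>\<in>U. (X n \<alpha> w)\<^sup>2) \<partial>N n)" for n U
  \<comment> \<open>The value of the locale constant \<open>B\<close> for D = 4d, the same for all
    n.\<close>
  define b0 where "b0 = 1 + real (4 * d) * C"
  have b0: "1 \<le> b0" by (simp add: b0_def C_def)
  have E1: "(\<lambda>n. E n {1..1}) \<longlonglongrightarrow> 1" using a by (simp add: E_def)
  \<comment> \<open>The product of the two second moments is added back to the covariance; the
    second of them equals the first by exchangeability once n \<ge> 2.\<close>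
  have E2: "(\<lambda>n. E n {1..2}) \<longlonglongrightarrow> 1"
  proof -
    have "(\<lambda>n. ((\<integral>w. (X n 1 w)\<^sup>2 * (X n 2 w)\<^sup>2 \<partial>N n) - E n {1..1} * (\<integral>w. (X n 2 w)\<^sup>2 \<partial>N n)) + E n {1..1} * E n {1..1})
        \<longlonglongrightarrow> 0 + 1 * 1"
      using b by (intro tendsto_add tendsto_mult E1) (simp add: E_def)
    moreover have "\<forall>\<^sub>F n in sequentially. ((\<integral>w. (X n 1 w)\<^sup>2 * (X n 2 w)\<^sup>2 \<partial>N n)
        - E n {1..1} * (\<integral>w. (X n 2 w)\<^sup>2 \<partial>N n)) + E n {1..1} * E n {1..1} = E n {1..2}"
      using eventually_ge_at_top[of 2]
    proof eventually_elim
      case (elim n)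
      interpret exchangeable_moments n "N n" "X n" "4 * d" \<epsilon> C using elim by (intro em) simp
      have "sq_moment {2} = sq_moment {1..1}" using elim by (intro sq_moment_cong_card) auto
      then have 1: "(\<integral>w. (X n 2 w)\<^sup>2 \<partial>N n) = E n {1..1}" by (simp add: sq_moment_def E_def)
      have "{1..2} = {1, 2 :: nat}" by auto
      then have "E n {1..2} = (\<integral>w. (X n 1 w)\<^sup>2 * (X n 2 w)\<^sup>2 \<partial>N n)" by (simp add: E_def)
      with 1 show ?case by simp
    qed
    ultimately have "(\<lambda>n. E n {1..2}) \<longlonglongrightarrow> 0 + 1 * 1" by (rule Lim_transform_eventually)
    then show ?thesis by simp
  qed
  have Ek: "(\<lambda>n. E n {1..k}) \<longlonglongrightarrow> 1" if "k \<le> 2 * d" for k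
    unfolding E_def
    by (rule square_moments_tendsto[OF em _ E1[unfolded E_def] E2[unfolded E_def]]) (use that d in simp_all)
  have Ed: "(\<lambda>n. E n {1..d}) \<longlonglongrightarrow> 1" by (rule Ek) simp
  have E2d: "(\<lambda>n. E n {1..2 * d}) \<longlonglongrightarrow> 1" by (rule Ek) simp
  have "(\<lambda>n. E n {1..2 * d} - (E n {1..d})\<^sup>2) \<longlonglongrightarrow> 1 - 1\<^sup>2"
    by (intro tendsto_intros Ed E2d)
  then have cov: "(\<lambda>n. E n {1..2 * d} - (E n {1..d})\<^sup>2) \<longlonglongrightarrow> 0" by simp
  have mixed: "\<forall>\<^sub>F n in sequentially. \<forall>r\<in>{1..d}.
      (\<integral>w. (\<Prod>i\<in>{1..r}. (X n i w) ^ 4) * (\<Prod>i\<in>{r+1..2*d-r}. (X n i w)\<^sup>2) \<partial>N n) \<le> b0 ^ r"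
    using eventually_ge_at_top[of "2 * d"]
  proof (eventually_elim, intro ballI)
    fix n r assume n2: "2 * d \<le> n" and r: "r \<in> {1..d}"
    interpret exchangeable_moments n "N n" "X n" "4 * d" \<epsilon> C using n2 d by (intro em) simp
    have "(\<integral>w. (\<Prod>i\<in>{1..r}. (X n i w) ^ 4) * (\<Prod>i\<in>{r+1..2*d-r}. (X n i w)\<^sup>2) \<partial>N n) \<le> B"
      by (rule mixed_moment_le[OF refl n2]) (use r in simp)
    also have "B = b0" by (simp only: B_def b0_def)
    \<comment> \<open>A constant L works because b0 \<ge> 1 and r \<ge> 1.\<close>
    also have "b0 \<le> b0 ^ r" using b0 r by (intro self_le_power) auto
    finally show "(\<integral>w. (\<Prod>i\<in>{1..r}. (X n i w) ^ 4) * (\<Prod>i\<in>{r+1..2*d-r}. (X n i w)\<^sup>2) \<partial>N n) \<le> b0 ^ r" .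
  qed

  define pn where "pn n = real (n choose d)" for n
  define mm where "mm n = m (n choose d)" for n
  define cn where "cn n = pn n / mm n" for n
  have cn: "cn \<longlonglongrightarrow> c" using m by (simp add: cn_def[abs_def] pn_def mm_def)
  have pn_ge: "real n / d \<le> pn n" if "d \<le> n" for n
    unfolding pn_def by (rule binomial_ge_ratio[OF d that])
  have big: "\<forall>\<^sub>F n in sequentially. 2 * d \<le> n \<and> 1 \<le> mm n \<and> c / 2 < cn n \<and> real n / d \<le> pn n \<and> 0 < pn n"
  proof -
    have "\<forall>\<^sub>F n in sequentially. c / 2 < cn n" using cn c by (intro order_tendstoD(1)) auto
    then show ?thesis using eventually_ge_at_top[of "2 * d"]
    proof eventually_elim
      case (elim n)
      \<comment> \<open>Division by zero yields 0, so a ratio above c/2 excludes an empty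
        sample.\<close>
      have "mm n \<noteq> 0"
      proof
        assume "mm n = 0"
        then have "cn n = 0" by (simp add: cn_def)
        then show False using elim c by simp
      qed
      moreover have "real n / d \<le> pn n" using elim by (intro pn_ge) simp
      moreover have "0 < pn n" using elim by (simp add: pn_def)
      ultimately show ?case using elim by simp
    qed
  qed
  have inv_n: "(\<lambda>n. K / real n) \<longlonglongrightarrow> 0" for K by (rule lim_const_over_n)
  have inv_m: "(\<lambda>n. 1 / real (mm n)) \<longlonglongrightarrow> 0"
  proof (rule tendsto_sandwich)
    show "\<forall>\<^sub>F n in sequentially. 0 \<le> 1 / real (mm n)" by simp
    show "\<forall>\<^sub>F n in sequentially. 1 / real (mm n) \<le> cn n * (d / real n)"
      using big
    proof eventually_elim
      case (elim n)
      have "real n > 0" using elim d by simp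
      \<comment> \<open>1/m is the ratio p/m divided by p, and p \<ge> n/d.\<close>
      have "1 / real (mm n) = cn n * (1 / pn n)" using elim by (simp add: cn_def)
      also have "\<dots> \<le> cn n * (d / real n)"
      proof (rule mult_left_mono)
        have "1 / pn n \<le> 1 / (real n / d)"
          using elim \<open>real n > 0\<close> d by (intro divide_left_mono) auto
        then show "1 / pn n \<le> d / real n" by simp
      qed (use elim c in simp)
      finally show ?case .
    qed
    show "(\<lambda>n. cn n * (d / real n)) \<longlonglongrightarrow> 0"
      using tendsto_mult[OF cn inv_n[of "real d"]] by simp
  qed simp

  define sn where "sn t n w = trace_on (nsets {1..n} d) (gram_resolvent (nsets {1..n} d) (1 / mm n) t (\<lambda>k. x n k w) [1..<Suc (mm n)])
      / card (nsets {1..n} d)" for t n w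
  have sn_lim: "AE w in M. (\<lambda>n. sn t n w) \<longlonglongrightarrow> (\<integral>y. 1 / (y + t) \<partial>marchenko_pastur c)" if t: "t > 0" for t
  proof -
    \<comment> \<open>The concentration bound for matrices with s = 1/t. It vanishes in the limit
      because the square moments over d and over 2d indices both tend to 1, and 1 - 2 + 1 =
      0.\<close>
    define \<eta> where "\<eta> n = 1 / t * sqrt (2 * \<bar>E n {1..2 * d} - 2 * E n {1..d} + 1\<bar> + 12 * b0 * d\<^sup>2 / n)" for n
    define \<nu> where "\<nu> n = PrincipalT n d (N n) (X n)" for n
    have ic: "iid_columns (nsets {1..n} d) (\<nu> n) (mm n) t (\<eta> n)" if "2 * d \<le> n" "1 \<le> mm n" for n
    proof -
      interpret tensor_moments n "N n" "X n" d \<epsilon> C by (rule tm[OF that(1)])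
      show ?thesis
      proof (rule iid_columns.intro)
        show "finite (nsets {1..n} d)" by (rule finite_I)
        show "nsets {1..n} d \<noteq> {}" using that(1) by (simp add: nsets_eq_empty_iff)
        show "prob_space (\<nu> n)" unfolding \<nu>_def PrincipalT_def
          by (rule prob_space_distr[OF PrincipalT_measurable[OF rv]])
        show "sets (\<nu> n) = sets (Pi\<^sub>M (nsets {1..n} d) (\<lambda>_. borel))" by (simp add: \<nu>_def PrincipalT_def)
        show "1 \<le> mm n" by fact
        show "0 < t" by fact
      next
        fix A :: "nat set \<Rightarrow> nat set \<Rightarrow> real"
        assume A: "\<And>i. i \<in> nsets {1..n} d \<Longrightarrow> \<bar>A i i\<bar> \<le> 1 / t"
          "\<And>i. i \<in> nsets {1..n} d \<Longrightarrow> (\<Sum>j\<in>nsets {1..n} d. (A i j)\<^sup>2) \<le> (1 / t)\<^sup>2"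
        have t': "0 \<le> 1 / t" using t by simp
        show "integrable (\<nu> n) (\<lambda>y. inner_on (nsets {1..n} d) y (mult_vec (nsets {1..n} d) A y) - trace_on (nsets {1..n} d) A)"
          unfolding \<nu>_def by (rule PrincipalT_quadratic_form(1)[where s="1 / t"]) (fact A t')+
        show "(\<integral>y. \<bar>inner_on (nsets {1..n} d) y (mult_vec (nsets {1..n} d) A y) - trace_on (nsets {1..n} d) A\<bar> \<partial>\<nu> n)
            \<le> \<eta> n * card (nsets {1..n} d)"
        proof -
          have "(\<integral>y. \<bar>inner_on (nsets {1..n} d) y (mult_vec (nsets {1..n} d) A y) - trace_on (nsets {1..n} d) A\<bar> \<partial>PrincipalT n d (N n) (X n))
              \<le> 1 / t * sqrt (2 * \<bar>sq_moment {1..2 * d} - 2 * sq_moment {1..d} + 1\<bar> + 12 * B * d\<^sup>2 / n) * card (nsets {1..n} d)"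
            by (rule PrincipalT_quadratic_form(2)) (fact A t')+
          then show ?thesis
            unfolding \<nu>_def \<eta>_def E_def b0_def sq_moment_def B_def .
        qed
      qed
    qed
    define fb where "fb n = iid_columns.stieltjes_mean (nsets {1..n} d) (\<nu> n) (mm n) t" for n
    define s where "s = (c - 1 - t + sqrt ((1 + c + t)\<^sup>2 - 4 * c)) / (2 * c * t)"
    have s: "s > 0" "c * t * s\<^sup>2 + (t + 1 - c) * s = 1"
      unfolding s_def using MP_root[OF c t] by auto
    have fb: "fb \<longlonglongrightarrow> s"
    proof (rule self_consistent_limit[OF c t s cn])
      have "\<eta> \<longlonglongrightarrow> 1 / t * sqrt (2 * \<bar>1 - 2 * 1 + 1\<bar> + 0)"
        unfolding \<eta>_def[abs_def] by (intro tendsto_intros Ed E2d inv_n)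
      then have \<eta>: "\<eta> \<longlonglongrightarrow> 0" by simp
      have "(\<lambda>n. cn n * \<eta> n + 1 / t * (1 / mm n) + 4 / t * sqrt (1 / mm n))
          \<longlonglongrightarrow> c * 0 + 1 / t * 0 + 4 / t * sqrt 0"
        by (intro tendsto_intros cn \<eta> inv_m)
      then show "(\<lambda>n. cn n * \<eta> n + 1 / t * (1 / mm n) + 4 / t * sqrt (1 / mm n)) \<longlonglongrightarrow> 0" by simp
      show "\<forall>\<^sub>F n in sequentially. 0 < cn n \<and> 0 \<le> fb n \<and> fb n \<le> 1 / t \<and>
          \<bar>cn n - t * cn n * fb n - cn n * fb n / (1 + cn n * fb n)\<bar>
            \<le> cn n * \<eta> n + 1 / t * (1 / mm n) + 4 / t * sqrt (1 / mm n)"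
        using big
      proof eventually_elim
        case (elim n)
        interpret iid_columns "nsets {1..n} d" "\<nu> n" "mm n" t "\<eta> n" using elim by (intro ic) auto
        have eq: "iid_columns.p (nsets {1..n} d) / mm n = cn n"
          unfolding iid_columns.p_def[OF iid_columns_axioms] by (simp add: cn_def pn_def)
        have rhs: "cn n * \<eta> n + 1 / t * (1 / mm n) + 4 / t * sqrt (1 / mm n)
            = cn n * \<eta> n + 1 / (t * mm n) + 4 / (t * sqrt (mm n))"
          by (simp add: real_sqrt_divide)
        have "0 < cn n" using elim c by simp
        then show ?case
          unfolding fb_def rhs by (intro conjI stieltjes_mean_bounds self_consistent[unfolded eq])
      qed
    qed
    have "AE w in M. (\<lambda>n. sn t n w - fb n) \<longlonglongrightarrow> 0"
    proof (rule AE_tendsto_zero[OF M])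
      fix \<delta> :: real assume \<delta>: "\<delta> > 0"
      \<comment> \<open>From p^2 / m = (p/m) p, with p/m > c/2 and p \<ge> n/d.\<close>
      define \<kappa> where "\<kappa> = \<delta>\<^sup>2 * t\<^sup>2 / 2 * (c / 2) * (1 / d)"
      have \<kappa>: "\<kappa> > 0" using \<delta> t c d by (simp add: \<kappa>_def)
      have "\<forall>\<^sub>F n in sequentially. {w \<in> space M. \<delta> \<le> \<bar>sn t n w - fb n\<bar>} \<in> sets M \<and>
          measure M {w \<in> space M. \<delta> \<le> \<bar>sn t n w - fb n\<bar>} \<le> 2 * exp (- \<kappa> * real n)"
        using big
      proof eventually_elim
        case (elim n)
        interpret iid_columns "nsets {1..n} d" "\<nu> n" "mm n" t "\<eta> n" using elim by (intro ic) auto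
        have pp: "iid_columns.p (nsets {1..n} d) = pn n"
          unfolding iid_columns.p_def[OF iid_columns_axioms] by (simp add: pn_def)
        have law': "distr M (Pi\<^sub>M (nsets {1..n} d) (\<lambda>_. borel)) (x n k) = \<nu> n" if "k \<in> {1..mm n}" for k
          unfolding \<nu>_def using that by (intro law) (simp add: mm_def)
        have indep': "prob_space.indep_vars M (\<lambda>_. Pi\<^sub>M (nsets {1..n} d) (\<lambda>_. borel)) (x n) {1..mm n}"
          unfolding mm_def by (rule indep)
        define F where "F = {w \<in> space M. \<delta> \<le> \<bar>sn t n w - fb n\<bar>}"
        have "F \<in> sets M"
          unfolding F_def sn_def fb_def by (rule sample_tail(1)[OF M indep' law' \<delta>])
        moreover have "measure M F \<le> 2 * exp (- (\<delta>\<^sup>2 * t\<^sup>2 * (pn n)\<^sup>2 / (2 * mm n)))"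
          unfolding F_def sn_def fb_def pp[symmetric] by (rule sample_tail(2)[OF M indep' law' \<delta>])
        moreover have "exp (- (\<delta>\<^sup>2 * t\<^sup>2 * (pn n)\<^sup>2 / (2 * mm n))) \<le> exp (- \<kappa> * real n)"
        proof -
          have "\<kappa> * real n = \<delta>\<^sup>2 * t\<^sup>2 / 2 * ((c / 2) * (real n / d))" by (simp add: \<kappa>_def)
        also have "\<dots> \<le> \<delta>\<^sup>2 * t\<^sup>2 / 2 * (cn n * pn n)"
          using elim c by (intro mult_left_mono mult_mono) auto
        also have "\<dots> = \<delta>\<^sup>2 * t\<^sup>2 * (pn n)\<^sup>2 / (2 * mm n)"
          by (simp add: cn_def power2_eq_square)
          finally show ?thesis by simp
        qed
        ultimately show ?case
          unfolding F_def[symmetric] by linarith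
      qed
      then show "\<exists>\<kappa>::real. \<kappa> > 0 \<and> (\<forall>\<^sub>F n in sequentially. {w \<in> space M. \<delta> \<le> \<bar>sn t n w - fb n\<bar>} \<in> sets M \<and>
          measure M {w \<in> space M. \<delta> \<le> \<bar>sn t n w - fb n\<bar>} \<le> 2 * exp (- \<kappa> * real n))"
        using \<kappa> by blast
    qed
    then show ?thesis
    proof (rule AE_mp, intro AE_I2 impI)
      fix w assume "(\<lambda>n. sn t n w - fb n) \<longlonglongrightarrow> 0"
      from tendsto_add[OF this fb] show "(\<lambda>n. sn t n w) \<longlonglongrightarrow> (\<integral>y. 1 / (y + t) \<partial>marchenko_pastur c)"
        unfolding stieltjes_marchenko_pastur[OF c t] s_def by simp
    qed
  qed
  \<comment> \<open>Each t has its own null set, so only countably many can be kept; the rational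
    ones are those asked for by \<open>stieltjes_imp_weak_conv\<close>.\<close>
  have "AE w in M. \<forall>t\<in>{t\<in>\<rat>. t > 0}. (\<lambda>n. sn t n w) \<longlonglongrightarrow> (\<integral>y. 1 / (y + t) \<partial>marchenko_pastur c)"
  proof (rule AE_ball_countable')
    show "countable {t\<in>\<rat>. t > (0::real)}"
      by (rule countable_subset[OF _ countable_rat]) blast
  qed (use sn_lim in blast)
  then have "AE w in M. weak_conv_m
      (\<lambda>n. ESD (sample_cov (nsets {1..n} d) (m (n choose d)) (\<lambda>k. x n k w))) (marchenko_pastur c)"
  proof (rule AE_mp, intro AE_I2 impI)
    fix w assume conv: "\<forall>t\<in>{t\<in>\<rat>. t > 0}. (\<lambda>n. sn t n w) \<longlonglongrightarrow> (\<integral>y. 1 / (y + t) \<partial>marchenko_pastur c)"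
    define \<mu> where "\<mu> n = ESD (sample_cov (nsets {1..n} d) (m (n choose d)) (\<lambda>k. x n k w))" for n
    \<comment> \<open>For n < d there are no d-subsets and the spectral distribution is the null
      measure. The shift by d leaves genuine distributions, and the limit does not depend on the
      first d terms.\<close>
    have I: "finite (nsets {1..n + d} d)" "nsets {1..n + d} d \<noteq> {}" for n
      by (simp_all add: finite_imp_finite_nsets nsets_eq_empty_iff)
    interpret nonneg_distr_seq "\<lambda>n. \<mu> (n + d)" "marchenko_pastur c"
    proof (rule nonneg_distr_seq.intro)
      show "real_distribution (\<mu> (n + d))" "AE y in \<mu> (n + d). 0 \<le> y" for n
        unfolding \<mu>_def by (rule ESD_sample_cov[OF I])+
      show "real_distribution (marchenko_pastur c)" by (rule real_distribution_marchenko_pastur[OF c])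
      show "AE y in marchenko_pastur c. 0 \<le> y" by (rule AE_marchenko_pastur_nonneg)
    qed
    have "weak_conv_m (\<lambda>n. \<mu> (n + d)) (marchenko_pastur c)"
    proof (rule stieltjes_imp_weak_conv)
      fix t :: real assume t: "t \<in> \<rat>" "t > 0"
      then have "(\<lambda>n. sn t n w) \<longlonglongrightarrow> (\<integral>y. 1 / (y + t) \<partial>marchenko_pastur c)" using conv by blast
      from LIMSEQ_ignore_initial_segment[OF this, of d]
      show "(\<lambda>n. \<integral>y. 1 / (y + t) \<partial>\<mu> (n + d)) \<longlonglongrightarrow> (\<integral>y. 1 / (y + t) \<partial>marchenko_pastur c)"
        unfolding \<mu>_def sn_def mm_def ESD_sample_cov(3)[OF I t(2)] .
    qed
    then have shifted: "(\<lambda>n. cdf (\<mu> (n + d)) y) \<longlonglongrightarrow> cdf (marchenko_pastur c) y"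
      if "isCont (cdf (marchenko_pastur c)) y" for y
      using that by (simp only: weak_conv_m_def weak_conv_def)
    show "weak_conv_m \<mu> (marchenko_pastur c)"
      unfolding weak_conv_m_def weak_conv_def by (intro allI impI LIMSEQ_offset[OF shifted])
  qed
  note weak = this
  have small: "(\<lambda>n. b0 * (real d)\<^sup>2 / real n) \<longlonglongrightarrow> 0" by (rule inv_n)
  show ?thesis
    by (intro conjI exI[of _ "\<lambda>_. b0"]) (fact small Ed[unfolded E_def] cov[unfolded E_def] mixed weak)+
qed

end
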